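(* There is a universal (sufficiently large) constant $C>0$ such that, with $\delta_n=C\sqrt{K\log(n)/n}$ in the definition of the parameter space $\Theta(n,K,\Delta)$, the following holds. Let $\alpha\in(0,1)$ and $$\overline\Delta^2=4\sigma^2\left(1+\sqrt{1+\frac{Kp}{n\log n}}\right)\log n.$$ If $\Delta^2\le(1-\alpha)\overline\Delta^2$ and $K\le\log n$, then $$\inf_{\hat H}\ \sup_{(H,\boldsymbol\mu)\in\Theta(n,K,\Delta)}\ \mathbb P_{(H,\boldsymbol\mu)}\big(\hat H\ne H\big)\ \ge\ 1-cKn^{-1},$$ where $c>0$ is a constant depending only on $\alpha$, and the infimum is over all estimators $\hat H=\{\hat h_{ik}\}_{i\in[n],k\in[K]}$ of $H=\{h_{ik}\}_{i\in[n],k\in[K]}$, i.e. all measurable functions of the data $(\mathbf X_1,\dots,\mathbf X_n)$.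
   Context: Notation: $[n]=\{1,\dots,n\}$; $n\geq 2$, $2\le K\le n$, $p\ge1$, $\sigma^2>0$, $\Delta>0$. Parameter space: $\Theta(n,K,\Delta)$ is the set of pairs $(H,\boldsymbol\mu)=(\{h_{ik}\},\{\boldsymbol\mu_k\})$ with $h_{ik}\in\{0,1\}$ and $\boldsymbol\mu_k\in\mathbb R^p$ for $i\in[n],k\in[K]$, such that $\sum_{k=1}^Kh_{ik}=1$ for all $i\in[n]$, the cluster sizes $n_k:=\sum_{i=1}^nh_{ik}$ satisfy $n_k\in[(1-\delta_n)\frac nK,(1+\delta_n)\frac nK]$ for all $k\in[K]$, and $\|\boldsymbol\mu_k-\boldsymbol\mu_l\|\ge\Delta$ for all $k\ne l$ in $[K]$. Under $\mathbb P_{(H,\boldsymbol\mu)}$ the observations $\mathbf X_1,\dots,\mathbf X_n\in\mathbb R^p$ are independent with $\mathbf X_i=\boldsymbol\mu_k+\boldsymbol\varepsilon_i$ when $h_{ik}=1$, where $\boldsymbol\varepsilon_i$ are i.i.d. $N(\mathbf 0,\sigma^2I_p)$. *)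

theory Defs
  imports "HOL-Probability.Probability"
begin

text \<open>
  The constants of the minimax bound are uniform in the dimension \<open>p\<close>, so \<open>p\<close> has to be a number and
  not a type: vectors of \<open>\<real>\<^sup>p\<close> are extensional functions on \<open>{1..p}\<close>, with Euclidean norm
  \<^const>\<open>L2_set\<close>. Likewise matrices are extensional in both indices, so that HOL equality of two
  matrices is equality of their entries.
\<close>

definition binary_matrices :: "nat \<Rightarrow> nat \<Rightarrow> (nat \<Rightarrow> nat \<Rightarrow> nat) set" where
  "binary_matrices n K = {1..n} \<rightarrow>\<^sub>E {1..K} \<rightarrow>\<^sub>E {0, 1}"

definition cluster_size :: "nat \<Rightarrow> (nat \<Rightarrow> nat \<Rightarrow> nat) \<Rightarrow> nat \<Rightarrow> nat" where
  "cluster_size n H k = (\<Sum>i\<in>{1..n}. H i k)"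

definition delta_n :: "real \<Rightarrow> nat \<Rightarrow> nat \<Rightarrow> real" where
  "delta_n C n K = C * sqrt (real K * ln (real n) / real n)"

definition Theta ::
    "real \<Rightarrow> nat \<Rightarrow> nat \<Rightarrow> nat \<Rightarrow> real \<Rightarrow> ((nat \<Rightarrow> nat \<Rightarrow> nat) \<times> (nat \<Rightarrow> nat \<Rightarrow> real)) set" where
  "Theta C n K p \<Delta> = {(H, \<mu>).
     H \<in> binary_matrices n K \<and>
     \<mu> \<in> ({1..K} \<rightarrow>\<^sub>E {1..p} \<rightarrow>\<^sub>E UNIV) \<and>
     (\<forall>i\<in>{1..n}. (\<Sum>k\<in>{1..K}. H i k) = 1) \<and>
     (\<forall>k\<in>{1..K}. real (cluster_size n H k) \<in>
        {(1 - delta_n C n K) * (real n / real K) .. (1 + delta_n C n K) * (real n / real K)}) \<and>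
     (\<forall>k\<in>{1..K}. \<forall>l\<in>{1..K}. k \<noteq> l \<longrightarrow> \<Delta> \<le> L2_set (\<lambda>j. \<mu> k j - \<mu> l j) {1..p})}"

text \<open>The law \<open>N(0, \<sigma>\<^sup>2 I\<^sub>p)\<close>; the second parameter of \<^const>\<open>normal_density\<close> is the standard deviation.\<close>

definition isotropic_gaussian :: "nat \<Rightarrow> real \<Rightarrow> (nat \<Rightarrow> real) measure" where
  "isotropic_gaussian p \<sigma> = Pi\<^sub>M {1..p} (\<lambda>_. density lborel (normal_density 0 \<sigma>))"

definition data_space :: "nat \<Rightarrow> nat \<Rightarrow> (nat \<Rightarrow> nat \<Rightarrow> real) measure" where
  "data_space n p = Pi\<^sub>M {1..n} (\<lambda>_. Pi\<^sub>M {1..p} (\<lambda>_. borel))"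

text \<open>
  The joint law of \<open>X\<^sub>1, \<dots>, X\<^sub>n\<close>. Since row \<open>i\<close> of \<open>H\<close> has exactly one entry 1, the sum over \<open>k\<close> is
  the centre \<open>\<mu>\<^sub>k\<close> with \<open>h\<^sub>i\<^sub>k = 1\<close>.
\<close>

definition observation_law ::
    "nat \<Rightarrow> nat \<Rightarrow> nat \<Rightarrow> real \<Rightarrow> (nat \<Rightarrow> nat \<Rightarrow> nat) \<Rightarrow> (nat \<Rightarrow> nat \<Rightarrow> real)
      \<Rightarrow> (nat \<Rightarrow> nat \<Rightarrow> real) measure" where
  "observation_law n K p \<sigma> H \<mu> =
     distr (Pi\<^sub>M {1..n} (\<lambda>_. isotropic_gaussian p \<sigma>)) (data_space n p)
       (\<lambda>\<epsilon>. \<lambda>i\<in>{1..n}. \<lambda>j\<in>{1..p}. (\<Sum>k\<in>{1..K}. real (H i k) * \<mu> k j) + \<epsilon> i j)"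

text \<open>
  Estimators need not have row sums 1. The discrete sigma-algebra is the right one because there are
  only finitely many binary matrices.
\<close>

definition estimators :: "nat \<Rightarrow> nat \<Rightarrow> nat \<Rightarrow> ((nat \<Rightarrow> nat \<Rightarrow> real) \<Rightarrow> (nat \<Rightarrow> nat \<Rightarrow> nat)) set" where
  "estimators n K p = data_space n p \<rightarrow>\<^sub>M count_space (binary_matrices n K)"

definition error_prob ::
    "nat \<Rightarrow> nat \<Rightarrow> nat \<Rightarrow> real \<Rightarrow> ((nat \<Rightarrow> nat \<Rightarrow> real) \<Rightarrow> (nat \<Rightarrow> nat \<Rightarrow> nat))
      \<Rightarrow> (nat \<Rightarrow> nat \<Rightarrow> nat) \<Rightarrow> (nat \<Rightarrow> nat \<Rightarrow> real) \<Rightarrow> real" where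
  "error_prob n K p \<sigma> Hhat H \<mu> =
     measure (observation_law n K p \<sigma> H \<mu>) {X \<in> space (data_space n p). Hhat X \<noteq> H}"

text \<open>In \<^typ>\<open>ereal\<close>, so that the infimum and the supremum always exist.\<close>

definition minimax_risk :: "real \<Rightarrow> nat \<Rightarrow> nat \<Rightarrow> nat \<Rightarrow> real \<Rightarrow> real \<Rightarrow> ereal" where
  "minimax_risk C n K p \<sigma> \<Delta> =
     (INF Hhat\<in>estimators n K p. SUP (H, \<mu>)\<in>Theta C n K p \<Delta>. ereal (error_prob n K p \<sigma> Hhat H \<mu>))"

definition Delta_bar_sq :: "nat \<Rightarrow> nat \<Rightarrow> nat \<Rightarrow> real \<Rightarrow> real" where
  "Delta_bar_sq n K p \<sigma> =
     4 * \<sigma>\<^sup>2 * (1 + sqrt (1 + real K * real p / (real n * ln (real n)))) * ln (real n)"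

lemma sets_isotropic_gaussian [measurable_cong]:
  "sets (isotropic_gaussian p \<sigma>) = sets (Pi\<^sub>M {1..p} (\<lambda>_. borel))"
  unfolding isotropic_gaussian_def by (intro sets_PiM_cong) simp_all

lemma prob_space_isotropic_gaussian:
  "\<sigma> > 0 \<Longrightarrow> prob_space (isotropic_gaussian p \<sigma>)"
  unfolding isotropic_gaussian_def by (intro prob_space_PiM prob_space_normal_density)

lemma prob_space_observation_law:
  assumes "\<sigma> > 0"
  shows "prob_space (observation_law n K p \<sigma> H \<mu>)"
  unfolding observation_law_def data_space_def
proof (rule prob_space.prob_space_distr)
  show "prob_space (Pi\<^sub>M {1..n} (\<lambda>_. isotropic_gaussian p \<sigma>))"
    by (intro prob_space_PiM prob_space_isotropic_gaussian assms)
  have [measurable]: "(\<lambda>\<epsilon>. \<epsilon> i j) \<in> borel_measurable (Pi\<^sub>M {1..n} (\<lambda>_. isotropic_gaussian p \<sigma>))"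
    if "i \<in> {1..n}" "j \<in> {1..p}" for i j
  proof -
    have "(\<lambda>\<epsilon>. \<epsilon> i) \<in> Pi\<^sub>M {1..n} (\<lambda>_. isotropic_gaussian p \<sigma>) \<rightarrow>\<^sub>M Pi\<^sub>M {1..p} (\<lambda>_. borel)"
      using measurable_component_singleton[OF that(1), of "\<lambda>_. isotropic_gaussian p \<sigma>"]
      by (simp add: measurable_cong_sets[OF refl sets_isotropic_gaussian])
    from measurable_compose[OF this measurable_component_singleton[OF that(2)]]
    show ?thesis by simp
  qed
  show "(\<lambda>\<epsilon>. \<lambda>i\<in>{1..n}. \<lambda>j\<in>{1..p}. (\<Sum>k\<in>{1..K}. real (H i k) * \<mu> k j) + \<epsilon> i j)
      \<in> Pi\<^sub>M {1..n} (\<lambda>_. isotropic_gaussian p \<sigma>) \<rightarrow>\<^sub>M Pi\<^sub>M {1..n} (\<lambda>_. Pi\<^sub>M {1..p} (\<lambda>_. borel))"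
    by (intro measurable_restrict borel_measurable_add borel_measurable_const) measurable
qed

lemma error_event_measurable:
  assumes "Hhat \<in> estimators n K p"
  shows "{X \<in> space (data_space n p). Hhat X \<noteq> H} \<in> sets (observation_law n K p \<sigma> H \<mu>)"
proof -
  have "Hhat -` (binary_matrices n K - {H}) \<inter> space (data_space n p) \<in> sets (data_space n p)"
    using assms unfolding estimators_def by (rule measurable_sets) simp
  moreover have "Hhat -` (binary_matrices n K - {H}) \<inter> space (data_space n p)
      = {X \<in> space (data_space n p). Hhat X \<noteq> H}"
    using measurable_space[OF assms[unfolded estimators_def]] by auto
  ultimately show ?thesis by (simp add: observation_law_def)
qed

end

theory Submission
  imports Defs "HOL-Real_Asymp.Real_Asymp"
begin

text \<open>
  Fix all labels except those of a set \<open>S\<close> of order \<open>n / K\<close> points lying in the first two clusters,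
  and give these two clusters the centers \<open>\<theta>\<close> and \<open>- \<theta>\<close>, where \<open>\<theta>\<close> is known if \<open>Kp / (n log n)\<close> is at
  most \<open>\<alpha>\<close>, and is drawn from \<open>N(0, (b/p) I)\<close> otherwise, in units of \<open>\<sigma>\<close>, with \<open>b\<close> between
  \<open>(\<Delta> / 2\<sigma>)\<^sup>2\<close> and the threshold. For the Gaussian prior the marginal likelihood is an increasing function of
  \<open>\<bar>W\<bar>\<close>, where \<open>W\<close> is the signed sum of the observations in the two clusters. Below the threshold
  there are, with probability \<open>1 - O(1/n)\<close>, at least \<open>t = \<lceil>2 log n\<rceil>\<close> points of \<open>S\<close> such that switching
  the labels of any subset of them does not decrease the marginal likelihood. So the posterior
  probability of the true labels is at most \<open>2\<^sup>-\<^sup>t \<le> 1/n\<close> outside an event of probability \<open>O(1/n)\<close>,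
  and no estimator recovers them with probability larger than \<open>O(1/n)\<close>.
\<close>

text \<open>Why subsets are switched: the points that contradict their labels may number only a
  small power of n, so counting single switches would give a bound much weaker than 1/n, while t of
  them already produce \<open>2 ^ t\<close> competing labelings. For a random center, switches
  interact, since |W|^2 is quadratic in the data. This is why \<open>S\<close> is only a small
  fraction of the two clusters: given the remaining points \<open>R\<close>, their sum is a fixed
  direction against which the points of \<open>S\<close> are tested independently, with a margin
  \<open>2 * u\<close>. One \<open>u\<close> pays for the interaction of a point with the rest of
  \<open>S\<close>, the other for its interactions with the at most t points switched along with it.
  Two priors are needed because the norm of a Gaussian center is concentrated up to probability 1/n
  only if p is large against log n. If Kp / (n log n) is small, it barely moves the threshold, and a
  known center is enough. The uniform law on the labelings of \<open>S\<close> is not supported by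
  the parameter space, whose clusters are nearly balanced. At least half of the labelings do belong
  to it, which costs a factor 2.\<close>

subsection \<open>Gaussian integrals\<close>

abbreviation gauss :: "nat \<Rightarrow> (nat \<Rightarrow> real) measure" where
  "gauss p \<equiv> isotropic_gaussian p 1"

abbreviation vectors :: "nat \<Rightarrow> (nat \<Rightarrow> real) measure" where
  "vectors p \<equiv> Pi\<^sub>M {1..p} (\<lambda>_. borel)"

lemma prob_space_std_normal: "prob_space (density lborel (normal_density 0 1))"
  by (rule prob_space_normal_density) simp

text \<open>Completing the square: with \<open>d = 1 - 2 * c\<close> the integrand is a constant
  times the normal density with mean \<open>b / d\<close> and standard deviation
  \<open>1 / sqrt d\<close>. The Laplace transforms below descend from this one.\<close>

lemma nn_integral_std_normal_exp_quadratic: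
  fixes a b c :: real
  assumes c: "c < 1/2"
  shows "(\<integral>\<^sup>+x. ennreal (exp (a + b * x + c * x\<^sup>2)) \<partial>density lborel (normal_density 0 1))
    = ennreal (exp (a + b\<^sup>2 / (2 * (1 - 2 * c))) / sqrt (1 - 2 * c))"
proof -
  define d where "d = 1 - 2 * c"
  have d: "d > 0" and c_eq: "c = (1 - d) / 2"
    using c by (simp_all add: d_def)
  have exponent: "a + b * x + c * x\<^sup>2 - x\<^sup>2 / 2 = a + b\<^sup>2 / (2 * d) - (x - b / d)\<^sup>2 / (2 / d)" for x
    using d unfolding c_eq by (simp add: field_simps power2_eq_square)
  have "normal_density 0 1 x * exp (a + b * x + c * x\<^sup>2)
      = exp (a + b\<^sup>2 / (2 * d)) / sqrt d * normal_density (b / d) (1 / sqrt d) x" for x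
  proof -
    have "normal_density 0 1 x * exp (a + b * x + c * x\<^sup>2)
        = exp (a + b * x + c * x\<^sup>2 - x\<^sup>2 / 2) / sqrt (2 * pi)"
      using exp_add[of "- x\<^sup>2 / 2" "a + b * x + c * x\<^sup>2"]
      by (simp add: normal_density_def algebra_simps)
    also have "\<dots> = exp (a + b\<^sup>2 / (2 * d)) / sqrt d * normal_density (b / d) (1 / sqrt d) x"
    proof -
      have "normal_density (b / d) (1 / sqrt d) x = sqrt d / sqrt (2 * pi) * exp (- ((x - b / d)\<^sup>2 / (2 / d)))"
        using d by (simp add: normal_density_def power_divide real_sqrt_divide real_sqrt_mult)
      moreover have "exp (a + b * x + c * x\<^sup>2 - x\<^sup>2 / 2)
          = exp (a + b\<^sup>2 / (2 * d)) * exp (- ((x - b / d)\<^sup>2 / (2 / d)))"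
        unfolding exponent mult_exp_exp by simp
      ultimately show ?thesis using d by simp
    qed
    finally show ?thesis .
  qed
  then have "(\<integral>\<^sup>+x. ennreal (exp (a + b * x + c * x\<^sup>2)) \<partial>density lborel (normal_density 0 1))
      = (\<integral>\<^sup>+x. ennreal (exp (a + b\<^sup>2 / (2 * d)) / sqrt d) * ennreal (normal_density (b / d) (1 / sqrt d) x) \<partial>lborel)"
    using d by (subst nn_integral_density) (simp_all add: ennreal_mult'[symmetric])
  also have "\<dots> = ennreal (exp (a + b\<^sup>2 / (2 * d)) / sqrt d)"
    using d by (subst nn_integral_cmult) (simp_all add: nn_integral_eq_integral)
  finally show ?thesis by (simp add: d_def)
qed

lemma nn_integral_gauss_exp_quadratic:
  fixes a b :: "nat \<Rightarrow> real"
  assumes c: "c < 1/2"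
  shows "(\<integral>\<^sup>+x. ennreal (exp (\<Sum>j\<in>{1..p}. a j + b j * x j + c * (x j)\<^sup>2)) \<partial>gauss p)
    = ennreal (exp (\<Sum>j\<in>{1..p}. a j + (b j)\<^sup>2 / (2 * (1 - 2 * c))) / sqrt (1 - 2 * c) ^ p)"
proof -
  interpret product_sigma_finite "\<lambda>_::nat. density lborel (normal_density 0 1)"
    by unfold_locales (intro prob_space_imp_sigma_finite prob_space_std_normal
        sigma_finite_measure.sigma_finite_countable)
  have "(\<integral>\<^sup>+x. ennreal (exp (\<Sum>j\<in>{1..p}. a j + b j * x j + c * (x j)\<^sup>2)) \<partial>gauss p)
      = (\<integral>\<^sup>+x. (\<Prod>j\<in>{1..p}. ennreal (exp (a j + b j * x j + c * (x j)\<^sup>2))) \<partial>gauss p)"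
    by (simp add: exp_sum prod_ennreal)
  also have "\<dots> = (\<Prod>j\<in>{1..p}. ennreal (exp (a j + (b j)\<^sup>2 / (2 * (1 - 2 * c))) / sqrt (1 - 2 * c)))"
    unfolding isotropic_gaussian_def
    by (subst product_nn_integral_prod) (simp_all add: nn_integral_std_normal_exp_quadratic[OF c])
  also have "\<dots> = ennreal (exp (\<Sum>j\<in>{1..p}. a j + (b j)\<^sup>2 / (2 * (1 - 2 * c))) / sqrt (1 - 2 * c) ^ p)"
    using c by (subst prod_ennreal) (simp_all add: exp_sum prod_dividef)
  finally show ?thesis .
qed

text \<open>Only the coordinates in \<open>{1..p}\<close> enter, so the arguments need not be
  extensional and pointwise lambda terms can be used freely.\<close>

definition dot :: "nat \<Rightarrow> (nat \<Rightarrow> real) \<Rightarrow> (nat \<Rightarrow> real) \<Rightarrow> real" where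
  "dot p x y = (\<Sum>j\<in>{1..p}. x j * y j)"

abbreviation sq :: "nat \<Rightarrow> (nat \<Rightarrow> real) \<Rightarrow> real" where
  "sq p x \<equiv> dot p x x"

lemma dot_commute: "dot p x y = dot p y x"
  by (simp add: dot_def mult.commute)

lemma dot_add_left: "dot p (\<lambda>j. x j + y j) z = dot p x z + dot p y z"
  and dot_add_right: "dot p z (\<lambda>j. x j + y j) = dot p z x + dot p z y"
  by (simp_all add: dot_def algebra_simps sum.distrib)

lemma dot_diff_left: "dot p (\<lambda>j. x j - y j) z = dot p x z - dot p y z"
  and dot_diff_right: "dot p z (\<lambda>j. x j - y j) = dot p z x - dot p z y"
  by (simp_all add: dot_def algebra_simps sum_subtractf)

lemma dot_scale_left: "dot p (\<lambda>j. c * x j) z = c * dot p x z"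
  and dot_scale_right: "dot p z (\<lambda>j. c * x j) = c * dot p z x"
  by (simp_all add: dot_def sum_distrib_left algebra_simps)

lemma dot_sum_left: "dot p (\<lambda>j. \<Sum>i\<in>A. x i j) z = (\<Sum>i\<in>A. dot p (x i) z)"
  and dot_sum_right: "dot p z (\<lambda>j. \<Sum>i\<in>A. x i j) = (\<Sum>i\<in>A. dot p z (x i))"
  unfolding dot_def sum_distrib_left sum_distrib_right by (rule sum.swap)+

lemmas dot_simps = dot_add_left dot_add_right dot_diff_left dot_diff_right dot_scale_left
  dot_scale_right dot_sum_left dot_sum_right

lemma dot_self_nonneg: "0 \<le> sq p x"
  by (simp add: dot_def sum_nonneg)

lemma dot_cong:
  assumes "\<And>j. j \<in> {1..p} \<Longrightarrow> x j = x' j" "\<And>j. j \<in> {1..p} \<Longrightarrow> y j = y' j"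
  shows "dot p x y = dot p x' y'"
  unfolding dot_def by (rule sum.cong) (simp_all add: assms)

lemma nn_integral_gauss_exp_dot:
  "(\<integral>\<^sup>+x. ennreal (exp (dot p a x)) \<partial>gauss p) = ennreal (exp (sq p a / 2))"
proof -
  have "(\<integral>\<^sup>+x. ennreal (exp (\<Sum>j\<in>{1..p}. 0 + a j * x j + 0 * (x j)\<^sup>2)) \<partial>gauss p)
    = ennreal (exp (\<Sum>j\<in>{1..p}. 0 + (a j)\<^sup>2 / (2 * (1 - 2 * 0))) / sqrt (1 - 2 * 0) ^ p)"
    by (rule nn_integral_gauss_exp_quadratic) simp
  then show ?thesis
    by (simp add: dot_def power2_eq_square sum_divide_distrib)
qed

text \<open>Laplace transform of a noncentral chi-square variable. Negative \<open>l\<close> is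
  allowed and later yields lower tails.\<close>

lemma nn_integral_gauss_exp_square:
  assumes l: "2 * l * w\<^sup>2 < 1"
  shows "(\<integral>\<^sup>+x. ennreal (exp (l * sq p (\<lambda>j. v j + w * x j))) \<partial>gauss p)
    = ennreal (exp (l * sq p v / (1 - 2 * l * w\<^sup>2)) / sqrt (1 - 2 * l * w\<^sup>2) ^ p)"
proof -
  have "l * sq p (\<lambda>j. v j + w * x j)
      = (\<Sum>j\<in>{1..p}. l * (v j)\<^sup>2 + (2 * l * w * v j) * x j + (l * w\<^sup>2) * (x j)\<^sup>2)" for x
    unfolding dot_def sum_distrib_left
    by (rule sum.cong) (simp_all add: algebra_simps power2_eq_square)
  then have "(\<integral>\<^sup>+x. ennreal (exp (l * sq p (\<lambda>j. v j + w * x j))) \<partial>gauss p)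
    = ennreal (exp (\<Sum>j\<in>{1..p}. l * (v j)\<^sup>2 + (2 * l * w * v j)\<^sup>2 / (2 * (1 - 2 * (l * w\<^sup>2))))
        / sqrt (1 - 2 * (l * w\<^sup>2)) ^ p)"
    using l by (simp only:) (subst nn_integral_gauss_exp_quadratic, auto)
  also have "(\<Sum>j\<in>{1..p}. l * (v j)\<^sup>2 + (2 * l * w * v j)\<^sup>2 / (2 * (1 - 2 * (l * w\<^sup>2))))
      = l * sq p v / (1 - 2 * l * w\<^sup>2)"
    unfolding dot_def sum_distrib_left sum_divide_distrib
    using l by (intro sum.cong) (simp_all add: divide_simps power2_eq_square, simp add: algebra_simps)
  finally show ?thesis by (simp add: mult.assoc)
qed

subsection \<open>Exponential moments of the noise\<close>

abbreviation noise :: "nat set \<Rightarrow> nat \<Rightarrow> (nat \<Rightarrow> nat \<Rightarrow> real) measure" where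
  "noise I p \<equiv> Pi\<^sub>M I (\<lambda>_. gauss p)"

lemma prob_space_noise: "prob_space (noise I p)"
  by (intro prob_space_PiM prob_space_isotropic_gaussian) simp

lemma product_sigma_finite_isotropic_gaussian:
  "\<sigma> > 0 \<Longrightarrow> product_sigma_finite (\<lambda>_. isotropic_gaussian p \<sigma>)"
  by (simp add: product_sigma_finite_def prob_space_imp_sigma_finite prob_space_isotropic_gaussian)

lemma measurable_isotropic_gaussian_coordinate:
  "j \<in> {1..p} \<Longrightarrow> (\<lambda>x. x j) \<in> borel_measurable (isotropic_gaussian p \<sigma>)"
  using measurable_component_singleton[of j "{1..p}" "\<lambda>_. borel"]
  by (simp add: measurable_cong_sets[OF sets_isotropic_gaussian refl])

lemma measurable_noise_coordinate:
  assumes "i \<in> I" "j \<in> {1..p}"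
  shows "(\<lambda>e. e i j) \<in> borel_measurable (noise I p)"
  using measurable_compose[OF measurable_component_singleton[OF assms(1)]
      measurable_isotropic_gaussian_coordinate[OF assms(2)]] .

lemma borel_measurable_dot:
  assumes "\<And>j. j \<in> {1..p} \<Longrightarrow> (\<lambda>x. f x j) \<in> borel_measurable M"
    and "\<And>j. j \<in> {1..p} \<Longrightarrow> (\<lambda>x. g x j) \<in> borel_measurable M"
  shows "(\<lambda>x. dot p (f x) (g x)) \<in> borel_measurable M"
  unfolding dot_def by (intro borel_measurable_sum borel_measurable_times assms)

lemma measurable_noise_sum:
  assumes "A \<subseteq> I" "j \<in> {1..p}"
  shows "(\<lambda>e. \<Sum>i\<in>A. e i j) \<in> borel_measurable (noise I p)"
  using assms by (intro borel_measurable_sum measurable_noise_coordinate) auto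

lemma measurable_noise_weighted_sum:
  assumes "A \<subseteq> I" "j \<in> {1..p}"
  shows "(\<lambda>e. \<Sum>i\<in>A. w i * e i j) \<in> borel_measurable (noise I p)"
  using assms by (intro borel_measurable_sum borel_measurable_times borel_measurable_const
      measurable_noise_coordinate) auto

lemma borel_measurable_ennreal_exp:
  "f \<in> borel_measurable M \<Longrightarrow> (\<lambda>x. ennreal (exp (f x :: real))) \<in> borel_measurable M"
  by measurable

lemmas noise_measurable_intros = borel_measurable_times borel_measurable_const borel_measurable_dot
  borel_measurable_add measurable_noise_sum measurable_noise_coordinate

lemma nn_integral_noise_exp_dot:
  assumes "finite I" "A \<subseteq> I"
  shows "(\<integral>\<^sup>+e. ennreal (exp (dot p a (\<lambda>j. \<Sum>i\<in>A. e i j))) \<partial>noise I p)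
    = ennreal (exp (card A * sq p a / 2))"
proof -
  interpret product_sigma_finite "\<lambda>_::nat. gauss p"
    by (rule product_sigma_finite_isotropic_gaussian) simp
  define f where "f i x = (if i \<in> A then ennreal (exp (dot p a x)) else 1)" for i :: nat and x
  have "ennreal (exp (dot p a (\<lambda>j. \<Sum>i\<in>A. e i j))) = (\<Prod>i\<in>I. f i (e i))" for e
    using assms finite_subset[OF assms(2,1)]
    by (simp add: f_def dot_sum_right exp_sum prod_ennreal[symmetric] prod.If_cases Int_absorb1)
  then have "(\<integral>\<^sup>+e. ennreal (exp (dot p a (\<lambda>j. \<Sum>i\<in>A. e i j))) \<partial>noise I p)
      = (\<Prod>i\<in>I. integral\<^sup>N (gauss p) (f i))"
  proof (simp only:, intro product_nn_integral_prod assms)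
    fix i
    have "(\<lambda>x. dot p a x) \<in> borel_measurable (gauss p)"
      by (intro borel_measurable_dot measurable_isotropic_gaussian_coordinate) auto
    then show "f i \<in> borel_measurable (gauss p)"
      unfolding f_def by (cases "i \<in> A") auto
  qed
  also have "\<dots> = (\<Prod>i\<in>I. (if i \<in> A then ennreal (exp (sq p a / 2)) else 1))"
  proof (rule prod.cong[OF refl])
    fix i show "integral\<^sup>N (gauss p) (f i) = (if i \<in> A then ennreal (exp (sq p a / 2)) else 1)"
      using prob_space.emeasure_space_1[OF prob_space_isotropic_gaussian[of 1 p]]
      by (simp add: f_def[abs_def] nn_integral_gauss_exp_dot)
  qed
  also have "\<dots> = ennreal (exp (card A * sq p a / 2))"
    using assms by (simp add: prod.If_cases Int_absorb1 ennreal_power exp_of_nat_mult[symmetric])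
  finally show ?thesis .
qed

text \<open>Integrating out one point replaces \<open>l\<close> by \<open>l / d\<close> and
  contributes the factor \<open>1 / sqrt d ^ p\<close>; hence \<open>l\<close> is arbitrary in the
  induction. Weights instead of a subset let the induction run over the whole index set; indicator
  weights give the subset version.\<close>

lemma nn_integral_noise_exp_square_weighted:
  assumes "finite I" "2 * l * (\<Sum>i\<in>I. (w i)\<^sup>2) < 1"
  shows "(\<integral>\<^sup>+e. ennreal (exp (l * sq p (\<lambda>j. v j + (\<Sum>i\<in>I. w i * e i j)))) \<partial>noise I p)
    = ennreal (exp (l * sq p v / (1 - 2 * l * (\<Sum>i\<in>I. (w i)\<^sup>2))) / sqrt (1 - 2 * l * (\<Sum>i\<in>I. (w i)\<^sup>2)) ^ p)"
  using assms
proof (induction I arbitrary: l)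
  case empty
  interpret product_sigma_finite "\<lambda>_::nat. gauss p"
    by (rule product_sigma_finite_isotropic_gaussian) simp
  show ?case using prob_space.emeasure_space_1[OF prob_space_noise[of "{}" p]] by simp
next
  case (insert i I)
  interpret product_sigma_finite "\<lambda>_::nat. gauss p"
    by (rule product_sigma_finite_isotropic_gaussian) simp
  define q where "q = (\<Sum>i\<in>I. (w i)\<^sup>2)"
  define d where "d = 1 - 2 * l * (w i)\<^sup>2"
  have q: "q \<ge> 0" unfolding q_def by (intro sum_nonneg) simp
  have sum: "2 * l * ((w i)\<^sup>2 + q) < 1"
    using insert by (simp add: q_def)
  have d: "d > 0"
  proof (cases "l \<le> 0")
    case True
    then have "l * (w i)\<^sup>2 \<le> 0" by (intro mult_nonpos_nonneg) auto
    then show ?thesis by (simp add: d_def)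
  next
    case False
    then have "0 \<le> l * q" using q by simp
    then show ?thesis using sum by (simp add: d_def algebra_simps)
  qed
  \<comment> \<open>The factors telescope: \<open>d\<close> times the new factor is the factor that
    belongs to the enlarged sum.\<close>
  have d_eq: "1 - 2 * (l / d) * q = (1 - 2 * l * ((w i)\<^sup>2 + q)) / d"
    using d by (simp add: field_simps) (simp add: d_def algebra_simps)
  have l': "2 * (l / d) * q < 1"
  proof -
    have "0 < (1 - 2 * l * ((w i)\<^sup>2 + q)) / d" using sum d by simp
    then show ?thesis unfolding d_eq[symmetric] by simp
  qed
  define V where "V e j = v j + (\<Sum>i\<in>I. w i * e i j)" for e :: "nat \<Rightarrow> nat \<Rightarrow> real" and j
  have upd: "v j + (\<Sum>k\<in>insert i I. w k * (e(i := y)) k j) = V e j + w i * y j" for e y j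
  proof -
    have "(\<Sum>k\<in>I. w k * (e(i := y)) k j) = (\<Sum>k\<in>I. w k * e k j)"
      using insert by (intro sum.cong) auto
    then show ?thesis using insert by (simp add: V_def)
  qed
  have "(\<integral>\<^sup>+e. ennreal (exp (l * sq p (\<lambda>j. v j + (\<Sum>k\<in>insert i I. w k * e k j)))) \<partial>noise (insert i I) p)
      = (\<integral>\<^sup>+e. (\<integral>\<^sup>+y. ennreal (exp (l * sq p (\<lambda>j. V e j + w i * y j)))
          \<partial>gauss p) \<partial>noise I p)"
  proof (subst product_nn_integral_insert[OF insert.hyps])
    show "(\<lambda>e. ennreal (exp (l * sq p (\<lambda>j. v j + (\<Sum>k\<in>insert i I. w k * e k j))))) \<in> borel_measurable (noise (insert i I) p)"
      by (intro borel_measurable_ennreal_exp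
        borel_measurable_times borel_measurable_const borel_measurable_dot borel_measurable_add
        measurable_noise_weighted_sum subset_refl)
  qed (simp only: upd)
  also have "\<dots> = (\<integral>\<^sup>+e. ennreal (1 / sqrt d ^ p) * ennreal (exp ((l / d) * sq p (V e))) \<partial>noise I p)"
    using d unfolding d_def
    by (subst nn_integral_gauss_exp_square) (simp_all add: ennreal_mult'[symmetric] mult.assoc)
  also have "\<dots> = ennreal (1 / sqrt d ^ p) *
      ennreal (exp ((l / d) * sq p v / (1 - 2 * (l / d) * q)) / sqrt (1 - 2 * (l / d) * q) ^ p)"
  proof (subst nn_integral_cmult)
    show "(\<lambda>e. ennreal (exp ((l / d) * sq p (V e)))) \<in> borel_measurable (noise I p)"
      unfolding V_def
      by (intro borel_measurable_ennreal_exp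
        borel_measurable_times borel_measurable_const borel_measurable_dot borel_measurable_add
        measurable_noise_weighted_sum) auto
  qed (use insert.IH[of "l / d"] l' in \<open>simp add: V_def[abs_def] q_def\<close>)
  also have "\<dots> = ennreal (exp (l * sq p v / (1 - 2 * l * ((w i)\<^sup>2 + q))) / sqrt (1 - 2 * l * ((w i)\<^sup>2 + q)) ^ p)"
    unfolding d_eq using d sum
    by (simp add: ennreal_mult'[symmetric] real_sqrt_divide power_divide)
  finally show ?case using insert.hyps by (simp add: q_def)
qed

lemma nn_integral_noise_exp_square:
  fixes l :: real
  assumes "finite I" "A \<subseteq> I" "2 * l * card A < 1"
  shows "(\<integral>\<^sup>+e. ennreal (exp (l * sq p (\<lambda>j. v j + (\<Sum>i\<in>A. e i j)))) \<partial>noise I p)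
    = ennreal (exp (l * sq p v / (1 - 2 * l * card A)) / sqrt (1 - 2 * l * card A) ^ p)"
proof -
  define w where "w i = (if i \<in> A then 1 else 0::real)" for i
  have 1: "(\<Sum>i\<in>I. w i * e i j) = (\<Sum>i\<in>A. e i j)" for e :: "nat \<Rightarrow> nat \<Rightarrow> real" and j
    using assms by (simp add: w_def if_distrib[of "\<lambda>x. x * _"] sum.If_cases Int_absorb1 cong: if_cong)
  have 2: "(\<Sum>i\<in>I. (w i)\<^sup>2) = card A"
    using assms by (simp add: w_def if_distrib[of "\<lambda>x. x\<^sup>2"] sum.If_cases Int_absorb1 cong: if_cong)
  show ?thesis
    using nn_integral_noise_exp_square_weighted[of I l w p v] assms(1,3) unfolding 1 2 by blast
qed

text \<open>
  Integrating out \<open>e i\<close> leaves the exponential of a multiple of a squared norm, namely that of the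
  remaining sum shifted by \<open>\<theta> / s\<close>.
\<close>

lemma nn_integral_noise_exp_pair:
  fixes s :: real and \<theta> :: "nat \<Rightarrow> real"
  assumes I: "finite I" "i \<in> I" "A \<subseteq> I - {i}" and s: "s \<noteq> 0" "s\<^sup>2 * card A < 1"
  shows "(\<integral>\<^sup>+e. ennreal (exp (s * dot p (\<lambda>j. \<theta> j + e i j) (\<lambda>j. card A * \<theta> j + (\<Sum>k\<in>A. e k j)))) \<partial>noise I p)
    = ennreal (exp (sq p \<theta> / 2 * (((s * card A)\<^sup>2 + 2 * s * card A + s\<^sup>2 * card A) / (1 - s\<^sup>2 * card A)))
        / sqrt (1 - s\<^sup>2 * card A) ^ p)"
proof -
  interpret product_sigma_finite "\<lambda>_::nat. gauss p"
    by (rule product_sigma_finite_isotropic_gaussian) simp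
  define m where "m = real (card A)"
  define V where "V e j = m * \<theta> j + (\<Sum>k\<in>A. e k j)" for e :: "nat \<Rightarrow> nat \<Rightarrow> real" and j
  define v where "v j = (m + 1 / s) * \<theta> j" for j
  have insert: "insert i (I - {i}) = I" using I by auto
  have upd: "(e(i := y)) i = y" "V (e(i := y)) = V e" for e y
  proof -
    have "(\<Sum>k\<in>A. (e(i := y)) k j) = (\<Sum>k\<in>A. e k j)" for j
      using I by (intro sum.cong) auto
    then show "V (e(i := y)) = V e" unfolding V_def[abs_def] by simp
  qed simp
  have inner: "(\<integral>\<^sup>+y. ennreal (exp (s * dot p (\<lambda>j. \<theta> j + y j) (V e))) \<partial>gauss p)
      = ennreal (exp (- sq p \<theta> / 2)) * ennreal (exp (s\<^sup>2 / 2 * sq p (\<lambda>j. v j + (\<Sum>k\<in>A. e k j))))"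
    (is "?l = ?r") for e
  proof -
    have vV: "(\<lambda>j. v j + (\<Sum>k\<in>A. e k j)) = (\<lambda>j. V e j + (1 / s) * \<theta> j)"
      by (simp add: v_def V_def algebra_simps)
    have "?l = (\<integral>\<^sup>+y. ennreal (exp (s * dot p \<theta> (V e))) * ennreal (exp (dot p (\<lambda>j. s * V e j) y)) \<partial>gauss p)"
      by (simp add: dot_simps algebra_simps exp_add ennreal_mult' dot_commute[of p _ "V e"])
    also have "\<dots> = ennreal (exp (s * dot p \<theta> (V e))) * ennreal (exp (sq p (\<lambda>j. s * V e j) / 2))"
      by (subst nn_integral_cmult, intro borel_measurable_ennreal_exp borel_measurable_dot
          measurable_isotropic_gaussian_coordinate) (auto simp: nn_integral_gauss_exp_dot)
    also have "\<dots> = ?r"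
      unfolding vV dot_simps using s(1)
      by (simp add: ennreal_mult'[symmetric] mult_exp_exp dot_commute[of p \<theta> "V e"] field_simps power2_eq_square)
    finally show ?thesis .
  qed
  have meas: "(\<lambda>e. ennreal (exp (s\<^sup>2 / 2 * sq p (\<lambda>j. v j + (\<Sum>k\<in>A. e k j)))))
      \<in> borel_measurable (noise (I - {i}) p)"
    by (intro borel_measurable_ennreal_exp
        noise_measurable_intros I)
  have "(\<integral>\<^sup>+e. ennreal (exp (s * dot p (\<lambda>j. \<theta> j + e i j) (V e))) \<partial>noise (insert i (I - {i})) p)
      = (\<integral>\<^sup>+e. (\<integral>\<^sup>+y. ennreal (exp (s * dot p (\<lambda>j. \<theta> j + y j) (V e))) \<partial>gauss p) \<partial>noise (I - {i}) p)"
  proof (subst product_nn_integral_insert)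
    show "(\<lambda>e. ennreal (exp (s * dot p (\<lambda>j. \<theta> j + e i j) (V e)))) \<in> borel_measurable (noise (insert i (I - {i})) p)"
      unfolding V_def using I
      by (intro borel_measurable_ennreal_exp
        noise_measurable_intros) auto
  qed (simp_all only: upd, use I in auto)
  also have "\<dots> = ennreal (exp (- sq p \<theta> / 2)) *
      ennreal (exp (s\<^sup>2 / 2 * sq p v / (1 - s\<^sup>2 * m)) / sqrt (1 - s\<^sup>2 * m) ^ p)"
    unfolding inner using I s meas
    by (subst nn_integral_cmult, simp, subst nn_integral_noise_exp_square) (simp_all add: m_def)
  also have "\<dots> = ennreal (exp (- sq p \<theta> / 2 + s\<^sup>2 / 2 * sq p v / (1 - s\<^sup>2 * m)) / sqrt (1 - s\<^sup>2 * m) ^ p)"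
    by (simp only: ennreal_mult'[symmetric] exp_ge_zero times_divide_eq_right mult_exp_exp)
  also have "- sq p \<theta> / 2 + s\<^sup>2 / 2 * sq p v / (1 - s\<^sup>2 * m)
      = sq p \<theta> / 2 * (((s * m)\<^sup>2 + 2 * s * m + s\<^sup>2 * m) / (1 - s\<^sup>2 * m))"
  proof -
    have vv: "s\<^sup>2 * sq p v = (s * m + 1)\<^sup>2 * sq p \<theta>"
      using s(1) unfolding v_def dot_scale_left dot_scale_right by (simp add: field_simps power2_eq_square)
    have "s\<^sup>2 / 2 * sq p v / (1 - s\<^sup>2 * m) = (s * m + 1)\<^sup>2 * sq p \<theta> / (2 * (1 - s\<^sup>2 * m))"
      by (simp add: vv)
    then show ?thesis using s(2) by (simp add: m_def divide_simps) (simp add: algebra_simps power2_eq_square)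
  qed
  finally show ?thesis unfolding insert m_def V_def[abs_def] .
qed

subsection \<open>Tail bounds\<close>

text \<open>An outer-measure bound, so that measurability of the event is never an issue.\<close>

definition unlikely :: "'a measure \<Rightarrow> ('a \<Rightarrow> bool) \<Rightarrow> real \<Rightarrow> bool" where
  "unlikely M P b \<longleftrightarrow> (\<exists>E\<in>sets M. {x \<in> space M. P x} \<subseteq> E \<and> measure M E \<le> b)"

lemma unlikely_mono:
  assumes "unlikely M Q a" "\<And>x. x \<in> space M \<Longrightarrow> P x \<Longrightarrow> Q x" "a \<le> b"
  shows "unlikely M P b"
proof -
  obtain E where "E \<in> sets M" "{x \<in> space M. Q x} \<subseteq> E" "measure M E \<le> a"
    using assms(1) by (auto simp: unlikely_def)
  then show ?thesis
    unfolding unlikely_def using assms(2,3) by (intro bexI[of _ E]) auto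
qed

lemma unlikely_measure_le:
  assumes "finite_measure M" "unlikely M P b" "{x \<in> space M. P x} \<in> sets M"
  shows "measure M {x \<in> space M. P x} \<le> b"
  using assms finite_measure.finite_measure_mono[OF assms(1)] unfolding unlikely_def
  by (meson order_trans)

lemma unlikely_disj:
  assumes "finite_measure M" "unlikely M P a" "unlikely M Q b"
  shows "unlikely M (\<lambda>x. P x \<or> Q x) (a + b)"
proof -
  interpret finite_measure M by fact
  obtain E where E: "E \<in> sets M" "{x \<in> space M. P x} \<subseteq> E" "measure M E \<le> a"
    using assms(2) by (auto simp: unlikely_def)
  obtain F where F: "F \<in> sets M" "{x \<in> space M. Q x} \<subseteq> F" "measure M F \<le> b"
    using assms(3) by (auto simp: unlikely_def)
  have "measure M (E \<union> F) \<le> a + b"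
    using measure_Un_le[of E M F] E F by simp
  then show ?thesis
    unfolding unlikely_def using E F by (intro bexI[of _ "E \<union> F"]) auto
qed

lemma unlikely_Bex:
  fixes b :: real
  assumes "finite_measure M" "finite I" "\<And>i. i \<in> I \<Longrightarrow> unlikely M (P i) b"
  shows "unlikely M (\<lambda>x. \<exists>i\<in>I. P i x) (card I * b)"
  using assms(2,3)
proof (induction I)
  case empty
  show ?case unfolding unlikely_def by (intro bexI[of _ "{}"]) auto
next
  case (insert i I)
  have "unlikely M (\<lambda>x. P i x \<or> (\<exists>i\<in>I. P i x)) (b + card I * b)"
    using insert by (intro unlikely_disj assms(1)) auto
  then show ?case
    by (rule unlikely_mono) (use insert in \<open>auto simp: algebra_simps\<close>)
qed

lemma unlikely_chernoff:
  assumes "finite_measure M" and f: "f \<in> borel_measurable M"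
    and K: "(\<integral>\<^sup>+x. ennreal (exp (f x)) \<partial>M) \<le> ennreal K" "K \<ge> 0"
  shows "unlikely M (\<lambda>x. c \<le> f x) (exp (- c) * K)"
proof -
  interpret finite_measure M by fact
  have [measurable]: "f \<in> borel_measurable M" by fact
  have "emeasure M {x \<in> space M. c \<le> f x} = (\<integral>\<^sup>+x. indicator {x \<in> space M. c \<le> f x} x \<partial>M)"
    by simp
  also have "\<dots> \<le> (\<integral>\<^sup>+x. ennreal (exp (- c)) * ennreal (exp (f x)) \<partial>M)"
    by (intro nn_integral_mono)
      (auto simp: indicator_def ennreal_mult'[symmetric] mult_exp_exp ennreal_1[symmetric] simp del: ennreal_1)
  also have "\<dots> \<le> ennreal (exp (- c)) * ennreal K"
    by (subst nn_integral_cmult) (auto intro!: mult_left_mono K)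
  also have "\<dots> = ennreal (exp (- c) * K)" using K(2) by (simp add: ennreal_mult'')
  finally have "measure M {x \<in> space M. c \<le> f x} \<le> exp (- c) * K"
    using K(2) by (simp add: emeasure_eq_measure)
  then show ?thesis
    unfolding unlikely_def by (intro bexI[of _ "{x \<in> space M. c \<le> f x}"]) auto
qed

section \<open>Projections of a Gaussian vector and the number of points that reach a
  half-space\<close>

lemma distr_isotropic_gaussian_coordinate:
  assumes "\<sigma> > 0" "j \<in> {1..p}"
  shows "distr (isotropic_gaussian p \<sigma>) borel (\<lambda>x. x j) = density lborel (normal_density 0 \<sigma>)"
proof -
  have "distr (isotropic_gaussian p \<sigma>) (density lborel (normal_density 0 \<sigma>)) (\<lambda>x. x j) = density lborel (normal_density 0 \<sigma>)"
    unfolding isotropic_gaussian_def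
    by (rule distr_PiM_component) (use assms in \<open>auto intro: prob_space_normal_density\<close>)
  moreover have "distr (isotropic_gaussian p \<sigma>) (density lborel (normal_density 0 \<sigma>)) (\<lambda>x. x j)
      = distr (isotropic_gaussian p \<sigma>) borel (\<lambda>x. x j)"
    by (rule distr_cong) simp_all
  ultimately show ?thesis by simp
qed

lemma indep_vars_isotropic_gaussian:
  assumes "\<sigma> > 0" "p \<ge> 1"
  shows "prob_space.indep_vars (isotropic_gaussian p \<sigma>) (\<lambda>_. borel) (\<lambda>j x. x j) {1..p}"
proof -
  interpret prob_space "isotropic_gaussian p \<sigma>"
    by (rule prob_space_isotropic_gaussian) fact
  have "distr (isotropic_gaussian p \<sigma>) (\<Pi>\<^sub>M j\<in>{1..p}. borel) (\<lambda>x. \<lambda>j\<in>{1..p}. x j)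
      = distr (isotropic_gaussian p \<sigma>) (isotropic_gaussian p \<sigma>) (\<lambda>x. x)"
    by (rule distr_cong)
      (auto simp: sets_isotropic_gaussian sets_eq_imp_space_eq[OF sets_isotropic_gaussian] space_PiM
        intro!: PiE_restrict)
  also have "\<dots> = (\<Pi>\<^sub>M j\<in>{1..p}. distr (isotropic_gaussian p \<sigma>) borel (\<lambda>x. x j))"
    unfolding distr_id isotropic_gaussian_def
    by (rule PiM_cong[OF refl])
      (use distr_isotropic_gaussian_coordinate[OF assms(1)] in \<open>simp add: isotropic_gaussian_def\<close>)
  finally show ?thesis
    using assms(2) measurable_isotropic_gaussian_coordinate[of _ p \<sigma>]
    by (subst indep_vars_iff_distr_eq_PiM') auto
qed

lemma distributed_dot_gauss:
  assumes w: "sq p w > 0"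
  shows "distributed (gauss p) lborel (dot p w) (normal_density 0 (sqrt (sq p w)))"
proof -
  interpret prob_space "gauss p"
    by (rule prob_space_isotropic_gaussian) simp
  \<comment> \<open>Zero weights are removed: they would contribute degenerate normal variables,
    whereas \<open>sum_indep_normal\<close> needs positive standard deviations.\<close>
  define J where "J = {j \<in> {1..p}. w j \<noteq> 0}"
  have J: "finite J" "J \<subseteq> {1..p}" by (auto simp: J_def)
  have J_ne: "J \<noteq> {}"
  proof
    assume "J = {}"
    then have "sq p w = 0" by (auto simp: J_def dot_def)
    with w show False by simp
  qed
  then have p: "p \<ge> 1" by (auto simp: J_def)
  have restrict: "dot p w x = (\<Sum>j\<in>J. w j * x j)" for x
    unfolding dot_def by (rule sum.mono_neutral_right) (auto simp: J_def)
  have indep: "indep_vars (\<lambda>_. borel) (\<lambda>j x. w j * x j) J"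
    by (rule indep_vars_compose2[OF indep_vars_subset[OF indep_vars_isotropic_gaussian J(2)]])
      (use p in auto)
  have "distributed (gauss p) lborel (\<lambda>x. w j * x j) (normal_density 0 \<bar>w j\<bar>)" if j: "j \<in> J" for j
  proof -
    have "distr (gauss p) lborel (\<lambda>x. x j) = distr (gauss p) borel (\<lambda>x. x j)"
      by (rule distr_cong) simp_all
    also have "\<dots> = density lborel (normal_density 0 1)"
      using j J by (intro distr_isotropic_gaussian_coordinate) auto
    finally have "distributed (gauss p) lborel (\<lambda>x. x j) (normal_density 0 1)"
      unfolding distributed_def using measurable_isotropic_gaussian_coordinate[of j p 1] j J by auto
    from normal_density_affine[OF this, of "w j" 0] show ?thesis using j by (simp add: J_def)
  qed
  from sum_indep_normal[OF J(1) J_ne indep _ this] show ?thesis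
    unfolding ext[of "dot p w", OF restrict] by (simp add: J_def power2_eq_square)
qed

text \<open>\<open>dot p w\<close> is normal with standard deviation
  \<open>s = sqrt (sq p w)\<close>. The interval \<open>B\<close> has length \<open>s\<close>, lies
  below \<open>- x\<close>, and carries a density at least that at its far end
  \<open>- (r + 1) * s\<close>. The loss of a factor exp (- r - 1/2) against exp (- r^2 / 2) is
  harmless at the scale used later.\<close>

lemma gauss_tail_lower:
  assumes w: "sq p w > 0" and x: "x \<le> r * sqrt (sq p w)" and r: "r \<ge> 0"
  shows "exp (- (r + 1)\<^sup>2 / 2) / sqrt (2 * pi)
    \<le> measure (gauss p) {y \<in> space (gauss p). dot p w y \<le> - x}"
proof -
  interpret prob_space "gauss p"
    by (rule prob_space_isotropic_gaussian) simp
  define s where "s = sqrt (sq p w)"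
  have s: "s > 0" using w by (simp add: s_def)
  define B where "B = {- (r + 1) * s .. - r * s}"
  define q where "q = exp (- (r + 1)\<^sup>2 / 2) / sqrt (2 * pi)"
  have [measurable]: "dot p w \<in> borel_measurable (gauss p)"
    by (intro borel_measurable_dot measurable_isotropic_gaussian_coordinate) auto
  have density: "q / s \<le> normal_density 0 s z" if z: "z \<in> B" for z
  proof -
    have "\<bar>z\<bar> \<le> (r + 1) * s"
    proof -
      have "0 \<le> r * s" using r s by simp
      moreover have "- (r * s + s) \<le> z" "z \<le> - (r * s)" using z by (simp_all add: B_def algebra_simps)
      ultimately show ?thesis unfolding distrib_right abs_le_iff using s by simp
    qed
    then have "z\<^sup>2 \<le> ((r + 1) * s)\<^sup>2"
      using r s by (intro power2_le_iff_abs_le[THEN iffD2]) auto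
    then have "z\<^sup>2 / (2 * s\<^sup>2) \<le> (r + 1)\<^sup>2 / 2"
      using s divide_right_mono[of "z\<^sup>2" "((r + 1) * s)\<^sup>2" "2 * s\<^sup>2"] by (simp add: power_mult_distrib)
    then have "exp (- (r + 1)\<^sup>2 / 2) \<le> exp (- z\<^sup>2 / (2 * s\<^sup>2))" by simp
    then show ?thesis
      using s by (simp add: q_def normal_density_def real_sqrt_mult field_simps)
  qed
  have "ennreal q = (\<integral>\<^sup>+z. ennreal (q / s) * indicator B z \<partial>lborel)"
    using s r by (subst nn_integral_cmult_indicator) (auto simp: B_def q_def ennreal_mult'[symmetric] algebra_simps)
  also have "\<dots> \<le> (\<integral>\<^sup>+z. ennreal (normal_density 0 s z) * indicator B z \<partial>lborel)"
    using density by (intro nn_integral_mono) (auto simp: indicator_def intro!: ennreal_leI)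
  also have "\<dots> = emeasure (distr (gauss p) lborel (dot p w)) B"
    using distributed_dot_gauss[OF w]
    by (simp add: distributed_def s_def emeasure_density B_def)
  also have "\<dots> = emeasure (gauss p) (dot p w -` B \<inter> space (gauss p))"
    by (subst emeasure_distr) (auto simp: B_def)
  also have "\<dots> \<le> emeasure (gauss p) {y \<in> space (gauss p). dot p w y \<le> - x}"
    using x by (intro emeasure_mono) (auto simp: B_def s_def)
  finally show ?thesis by (simp add: emeasure_eq_measure q_def)
qed

text \<open>The standard normal density at \<open>r + 1\<close>, which is below the mass of \<open>[r, r + 1]\<close>.\<close>

definition reach_prob :: "real \<Rightarrow> real" where
  "reach_prob r = exp (- (r + 1)\<^sup>2 / 2) / sqrt (2 * pi)"

text \<open>Given the noise outside \<open>S\<close>, the vector \<open>W e\<close> is fixed and the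
  points of \<open>S\<close> are independent, each reaching the half-space with probability at least
  \<open>reach_prob r\<close>. A Chernoff bound for the lower tail of the count follows. The first
  two conditions of the event are what makes \<open>gauss_tail_lower\<close> applicable to
  \<open>W e\<close>.\<close>

lemma noise_count_lower:
  fixes \<theta> v :: "nat \<Rightarrow> real"
  assumes I: "finite I" "S \<subseteq> I" "R \<subseteq> I - S" and r: "r \<ge> 0"
  defines "W e \<equiv> \<lambda>j. v j + (\<Sum>k\<in>R. e k j)"
  shows "unlikely (noise I p) (\<lambda>e. 0 < sq p (W e) \<and>
      x + dot p \<theta> (W e) \<le> r * sqrt (sq p (W e)) \<and>
      card {i \<in> S. dot p (\<lambda>j. \<theta> j + e i j) (W e) \<le> - x} \<le> t)
    (exp (t - card S * reach_prob r / 2))"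
proof -
  interpret product_sigma_finite "\<lambda>_::nat. gauss p"
    by (rule product_sigma_finite_isotropic_gaussian) simp
  interpret N: prob_space "noise I p" by (rule prob_space_noise)
  interpret G: prob_space "gauss p"
    by (rule prob_space_isotropic_gaussian) simp
  define q where "q = reach_prob r"
  define Good where "Good w \<longleftrightarrow> 0 < sq p w \<and> x + dot p \<theta> w \<le> r * sqrt (sq p w)" for w
  \<comment> \<open>\<open>h\<close> is exp (- 1) raised to the indicator of the half-space, so
    \<open>F\<close> is the exponential of minus the count, cut off where \<open>Good\<close>
    fails.\<close>
  define h where "h w y = (if dot p (\<lambda>j. \<theta> j + y j) w \<le> - x then ennreal (exp (-1)) else 1)" for w y
  define F where "F e = (if Good (W e) then (\<Prod>i\<in>S. h (W e) (e i)) else 0)" for e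
  have S: "finite S" using I finite_subset by auto
  have W_meas: "(\<lambda>e. W e j) \<in> borel_measurable (noise I p)" if "j \<in> {1..p}" for j
    unfolding W_def using I that by (intro borel_measurable_add borel_measurable_const measurable_noise_sum) auto
  have WW: "(\<lambda>e. sq p (W e)) \<in> borel_measurable (noise I p)"
    and tW: "(\<lambda>e. dot p \<theta> (W e)) \<in> borel_measurable (noise I p)"
    by (intro borel_measurable_dot W_meas borel_measurable_const; assumption)+
  have dot_meas: "(\<lambda>e. dot p (\<lambda>j. \<theta> j + e i j) (W e)) \<in> borel_measurable (noise I p)" if "i \<in> S" for i
    using that I by (intro borel_measurable_dot W_meas borel_measurable_const borel_measurable_add
        measurable_noise_coordinate) auto
  have F_meas: "F \<in> borel_measurable (noise I p)"
  proof -
    have "(\<lambda>e. h (W e) (e i)) \<in> borel_measurable (noise I p)" if "i \<in> S" for i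
      unfolding h_def using dot_meas[OF that] by measurable
    then have prod: "(\<lambda>e. \<Prod>i\<in>S. h (W e) (e i)) \<in> borel_measurable (noise I p)"
      by (rule borel_measurable_prod_ennreal)
    have "{e \<in> space (noise I p). Good (W e)} \<in> sets (noise I p)"
    proof -
      have "{e \<in> space M. 0 < f e \<and> x + g e \<le> r * sqrt (f e)} \<in> sets M"
        if [measurable]: "f \<in> borel_measurable M" "g \<in> borel_measurable M"
        for f g and M :: "(nat \<Rightarrow> nat \<Rightarrow> real) measure"
      proof -
        have "(\<lambda>e. sqrt (f e)) \<in> borel_measurable M"
          by (rule measurable_compose[OF that(1) borel_measurable_continuous_onI]) (intro continuous_intros)
        then have "{e \<in> space M. x + g e \<le> r * sqrt (f e)} \<in> sets M"
          using that(2) by (intro borel_measurable_le borel_measurable_add borel_measurable_times borel_measurable_const)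
        moreover have "{e \<in> space M. 0 < f e} \<in> sets M" by measurable
        ultimately have "{e \<in> space M. x + g e \<le> r * sqrt (f e)} \<inter> {e \<in> space M. 0 < f e} \<in> sets M"
          by (rule sets.Int)
        then show ?thesis by (rule back_subst[of "\<lambda>A. A \<in> sets M"]) auto
      qed
      from this[OF WW tW] show ?thesis unfolding Good_def .
    qed
    then show ?thesis unfolding F_def by (intro measurable_If prod borel_measurable_const)
  qed
  have h_int: "(\<integral>\<^sup>+y. h w y \<partial>gauss p) \<le> ennreal (exp (- q / 2))" if w: "Good w" for w
  proof -
    define B where "B = {y \<in> space (gauss p). dot p w y \<le> - (x + dot p \<theta> w)}"
    have [measurable]: "B \<in> sets (gauss p)"
    proof -
      have [measurable]: "(\<lambda>y. dot p w y) \<in> borel_measurable (gauss p)"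
        by (intro borel_measurable_dot measurable_isotropic_gaussian_coordinate) auto
      show ?thesis unfolding B_def by measurable
    qed
    have q_le: "q \<le> G.prob B"
      using gauss_tail_lower[of p w "x + dot p \<theta> w" r] w r by (simp add: q_def reach_prob_def B_def Good_def)
    have "(\<integral>\<^sup>+y. h w y \<partial>gauss p)
        = (\<integral>\<^sup>+y. ennreal (exp (-1)) * indicator B y + indicator (space (gauss p) - B) y \<partial>gauss p)"
      by (intro nn_integral_cong)
        (auto simp: h_def B_def indicator_def dot_add_left dot_commute[of p _ w] algebra_simps)
    also have "\<dots> = ennreal (exp (-1)) * ennreal (G.prob B) + ennreal (1 - G.prob B)"
      by (subst nn_integral_add) (simp_all add: nn_integral_cmult_indicator G.emeasure_eq_measure G.prob_compl)
    also have "\<dots> = ennreal (1 - (1 - exp (-1)) * G.prob B)"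
      by (simp add: ennreal_mult'[symmetric] ennreal_plus[symmetric] algebra_simps del: ennreal_plus)
    also have "\<dots> \<le> ennreal (exp (- q / 2))"
    proof (rule ennreal_leI)
      \<comment> \<open>The mean of \<open>h\<close> is 1 - (1 - 1/e) times a probability that is at
        least \<open>q\<close>, and 1 - 1/e is at least 1/2.\<close>
      have "exp (-1) \<le> 1 / (2::real)"
        using exp_ge_add_one_self[of "1::real"] by (simp add: exp_minus field_simps)
      then have "1/2 * q \<le> (1 - exp (-1)) * G.prob B"
        using q_le by (intro mult_mono) (auto simp: q_def reach_prob_def)
      then show "1 - (1 - exp (-1)) * G.prob B \<le> exp (- q / 2)"
        using exp_ge_add_one_self[of "- q / 2"] by linarith
    qed
    finally show ?thesis .
  qed
  have int_F: "(\<integral>\<^sup>+e. F e \<partial>noise I p) \<le> ennreal (exp (- (card S * q / 2)))"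
  proof -
    \<comment> \<open>Fubini with the noise of \<open>S\<close> integrated first: \<open>W\<close>
      does not depend on it, because \<open>R\<close> is disjoint from \<open>S\<close>.\<close>
    have IS: "(I - S) \<union> S = I" "(I - S) \<inter> S = {}" using I by auto
    have Wm: "W (merge (I - S) S (a, b)) = W a" for a b
      unfolding W_def using I by (intro ext arg_cong2[of _ _ _ _ "(+)"] refl sum.cong) auto
    have F_merge: "F (merge (I - S) S (a, b)) = (if Good (W a) then (\<Prod>i\<in>S. h (W a) (b i)) else 0)" for a b
      unfolding F_def Wm by (intro if_cong refl prod.cong) auto
    have "(\<integral>\<^sup>+e. F e \<partial>noise I p) = (\<integral>\<^sup>+a. (\<integral>\<^sup>+b. F (merge (I - S) S (a, b)) \<partial>noise S p) \<partial>noise (I - S) p)"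
      using product_nn_integral_fold[OF IS(2) _ S, of F] F_meas I unfolding IS(1) by simp
    also have "\<dots> \<le> (\<integral>\<^sup>+a. ennreal (exp (- (card S * q / 2))) \<partial>noise (I - S) p)"
    proof (rule nn_integral_mono)
      fix a
      show "(\<integral>\<^sup>+b. F (merge (I - S) S (a, b)) \<partial>noise S p) \<le> ennreal (exp (- (card S * q / 2)))"
      proof (cases "Good (W a)")
        case True
        have h_meas: "h (W a) \<in> borel_measurable (gauss p)"
        proof -
          have [measurable]: "(\<lambda>y. dot p (\<lambda>j. \<theta> j + y j) (W a)) \<in> borel_measurable (gauss p)"
            by (intro borel_measurable_dot borel_measurable_add borel_measurable_const
                measurable_isotropic_gaussian_coordinate) auto
          show ?thesis unfolding h_def by measurable
        qed
        have "(\<integral>\<^sup>+b. F (merge (I - S) S (a, b)) \<partial>noise S p) = (\<Prod>i\<in>S. integral\<^sup>N (gauss p) (h (W a)))"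
          unfolding F_merge using True by (simp add: product_nn_integral_prod[OF S h_meas])
        also have "\<dots> \<le> (\<Prod>i\<in>S. ennreal (exp (- q / 2)))"
          unfolding prod_constant by (rule power_mono) (use h_int[OF True] in auto)
        also have "\<dots> = ennreal (exp (- (card S * q / 2)))"
          by (simp add: ennreal_power exp_of_nat_mult[symmetric])
        finally show ?thesis .
      qed (simp add: F_merge)
    qed
    also have "\<dots> = ennreal (exp (- (card S * q / 2)))"
      using prob_space.emeasure_space_1[OF prob_space_noise[of "I - S" p]] by simp
    finally show ?thesis .
  qed
  define E where "E = {e \<in> space (noise I p). Good (W e) \<and> card {i \<in> S. dot p (\<lambda>j. \<theta> j + e i j) (W e) \<le> - x} \<le> t}"
  have F_ge: "ennreal (exp t) * F e \<ge> 1" if "e \<in> E" for e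
  proof -
    define C where "C = {i \<in> S. dot p (\<lambda>j. \<theta> j + e i j) (W e) \<le> - x}"
    have "F e = ennreal (exp (-1)) ^ card C"
      using that S by (simp add: E_def F_def h_def prod.If_cases C_def Int_def)
    also have "\<dots> = ennreal (exp (- real (card C)))"
      by (simp add: ennreal_power exp_of_nat_mult[symmetric])
    finally show ?thesis
      using that by (simp add: E_def C_def ennreal_mult'[symmetric] mult_exp_exp ennreal_1[symmetric] del: ennreal_1)
  qed
  define E' where "E' = {e \<in> space (noise I p). 1 \<le> ennreal (exp t) * F e}"
  have E': "E' \<in> sets (noise I p)" "E \<subseteq> E'"
    unfolding E'_def using F_meas F_ge by (measurable, auto simp: E_def)
  have "emeasure (noise I p) E' \<le> (\<integral>\<^sup>+e. ennreal (exp t) * F e \<partial>noise I p)"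
  proof -
    have "emeasure (noise I p) E' = (\<integral>\<^sup>+e. indicator E' e \<partial>noise I p)" using E' by simp
    also have "\<dots> \<le> (\<integral>\<^sup>+e. ennreal (exp t) * F e \<partial>noise I p)"
      by (intro nn_integral_mono) (auto simp: indicator_def E'_def)
    finally show ?thesis .
  qed
  also have "\<dots> \<le> ennreal (exp t) * ennreal (exp (- (card S * q / 2)))"
    using F_meas by (subst nn_integral_cmult) (auto intro!: mult_left_mono int_F)
  also have "\<dots> = ennreal (exp (t - card S * q / 2))"
    by (simp add: ennreal_mult'[symmetric] mult_exp_exp)
  finally have "measure (noise I p) E' \<le> exp (t - card S * q / 2)"
    by (simp add: N.emeasure_eq_measure)
  then show ?thesis
    unfolding unlikely_def using E' by (intro bexI[of _ E']) (auto simp: E_def Good_def q_def)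
qed

subsection \<open>The exceptional set\<close>

lemma finite_measure_noise: "finite_measure (noise I p)"
  by (rule prob_space.finite_measure[OF prob_space_noise])

lemma unlikely_noise_linear:
  assumes I: "finite I" "A \<subseteq> I" and u: "u > 0" and \<theta>: "sq p \<theta> > 0" and A: "A \<noteq> {}"
  shows "unlikely (noise I p) (\<lambda>e. u \<le> dot p \<theta> (\<lambda>j. \<Sum>i\<in>A. e i j)) (exp (- (u\<^sup>2 / (2 * card A * sq p \<theta>))))"
proof -
  define V where "V = card A * sq p \<theta>"
  have V: "V > 0" using I \<theta> A finite_subset[OF I(2,1)] by (simp add: V_def card_gt_0_iff)
  \<comment> \<open>The minimizer of \<open>- s * u + s^2 * V / 2\<close>, the exponent of the
    Chernoff bound.\<close>
  define s where "s = u / V"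
  have s: "s > 0" using u V by (simp add: s_def)
  have "unlikely (noise I p) (\<lambda>e. s * u \<le> dot p (\<lambda>j. s * \<theta> j) (\<lambda>j. \<Sum>i\<in>A. e i j))
      (exp (- (s * u)) * exp (card A * sq p (\<lambda>j. s * \<theta> j) / 2))"
    by (rule unlikely_chernoff[OF finite_measure_noise])
      (use I in \<open>auto intro!: borel_measurable_dot measurable_noise_sum simp: nn_integral_noise_exp_dot\<close>)
  then show ?thesis
  proof (rule unlikely_mono)
    show "s * u \<le> dot p (\<lambda>j. s * \<theta> j) (\<lambda>j. \<Sum>i\<in>A. e i j)" if "u \<le> dot p \<theta> (\<lambda>j. \<Sum>i\<in>A. e i j)" for e
      using that s by (simp add: dot_scale_left)
    have "- (s * u) + card A * sq p (\<lambda>j. s * \<theta> j) / 2 = - (s * u) + s\<^sup>2 * V / 2"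
      by (simp add: V_def dot_scale_left dot_scale_right power2_eq_square)
    also have "\<dots> = - (u\<^sup>2 / (2 * V))"
      using V by (simp add: s_def field_simps power2_eq_square)
    finally show "exp (- (s * u)) * exp (card A * sq p (\<lambda>j. s * \<theta> j) / 2) \<le> exp (- (u\<^sup>2 / (2 * card A * sq p \<theta>)))"
      by (simp add: mult_exp_exp V_def mult.assoc)
  qed
qed

text \<open>With the companion for \<open>1 - y\<close> below, this turns the determinant factors of
  the Laplace transforms into exponentials, through second-order lower bounds for the
  logarithm.\<close>

lemma exp_le_sqrt_one_plus_power:
  assumes "0 \<le> y" "y \<le> 1"
  shows "exp (p * (y - y\<^sup>2) / 2) \<le> sqrt (1 + y) ^ p"
proof -
  have "exp (y - y\<^sup>2) \<le> 1 + y"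
    using ln_one_plus_pos_lower_bound[OF assms] assms
    by (subst ln_ge_iff[symmetric]) auto
  then have "sqrt (exp (y - y\<^sup>2)) ^ p \<le> sqrt (1 + y) ^ p"
    by (intro power_mono) auto
  moreover have "sqrt (exp (y - y\<^sup>2)) = exp ((y - y\<^sup>2) / 2)"
    by (rule real_sqrt_unique) (simp_all add: power2_eq_square mult_exp_exp)
  ultimately show ?thesis by (simp add: exp_of_nat_mult[symmetric])
qed

lemma exp_le_sqrt_one_minus_power:
  assumes "0 \<le> y" "y \<le> 1/2"
  shows "exp (- (p * (y + 2 * y\<^sup>2) / 2)) \<le> sqrt (1 - y) ^ p"
proof -
  have "exp (- (y + 2 * y\<^sup>2)) \<le> 1 - y"
    using ln_one_minus_pos_lower_bound[OF assms] assms
    by (subst ln_ge_iff[symmetric]) auto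
  then have "sqrt (exp (- (y + 2 * y\<^sup>2))) ^ p \<le> sqrt (1 - y) ^ p"
    by (intro power_mono) auto
  moreover have "sqrt (exp (- (y + 2 * y\<^sup>2))) = exp (- ((y + 2 * y\<^sup>2) / 2))"
    by (rule real_sqrt_unique) (simp_all add: power2_eq_square mult_exp_exp)
  ultimately show ?thesis by (simp add: exp_of_nat_mult[symmetric])
qed

text \<open>\<open>p * card A + (card A)^2 * sq p \<theta>\<close> is the mean of
  \<open>sq p (W e)\<close>; the lower tail is reached by a Chernoff bound with a negative exponent
  \<open>l\<close>.\<close>

lemma unlikely_noise_square_small:
  fixes \<theta> :: "nat \<Rightarrow> real"
  assumes I: "finite I" "A \<subseteq> I" "A \<noteq> {}" and g: "0 < g" "g < 1"
  defines "W e \<equiv> \<lambda>j. card A * \<theta> j + (\<Sum>k\<in>A. e k j)"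
  shows "unlikely (noise I p) (\<lambda>e. sq p (W e) \<le> (1 - g) * (p * card A + (card A)\<^sup>2 * sq p \<theta>))
    (exp (- (g\<^sup>2 * p / 8)))"
proof -
  define N where "N = real (card A)"
  have N: "N > 0" using I finite_subset[OF I(2,1)] by (simp add: N_def card_gt_0_iff)
  \<comment> \<open>The final exponent is \<open>y * (y - g) / 2\<close> times
    \<open>p + N * sq p \<theta>\<close>, and \<open>y = g / 2\<close> minimizes it.\<close>
  define y where "y = g / 2"
  have y: "0 < y" "y \<le> 1/2" using g by (auto simp: y_def)
  define l where "l = - y / (2 * N)"
  have l: "l < 0" using y N by (simp add: l_def divide_neg_pos)
  have l2: "1 - 2 * l * N = 1 + y" using N by (simp add: l_def)
  define D where "D = p * N + N\<^sup>2 * sq p \<theta>"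
  define v where "v j = N * \<theta> j" for j
  have vv: "sq p v = N\<^sup>2 * sq p \<theta>"
    unfolding v_def dot_scale_left dot_scale_right by (simp add: power2_eq_square)
  have "unlikely (noise I p) (\<lambda>e. l * ((1 - g) * D) \<le> l * sq p (W e))
      (exp (- (l * ((1 - g) * D))) * (exp (l * sq p v / (1 + y)) / sqrt (1 + y) ^ p))"
  proof (rule unlikely_chernoff[OF finite_measure_noise])
    show "(\<lambda>e. l * sq p (W e)) \<in> borel_measurable (noise I p)"
      unfolding W_def using I
      by (intro noise_measurable_intros)
    have "2 * l * card A < 1" using l2 y by (simp add: N_def)
    from nn_integral_noise_exp_square[OF I(1,2) this, of p v]
    show "(\<integral>\<^sup>+e. ennreal (exp (l * sq p (W e))) \<partial>noise I p)
        \<le> ennreal (exp (l * sq p v / (1 + y)) / sqrt (1 + y) ^ p)"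
      by (simp add: W_def N_def[symmetric] l2 v_def)
  qed (use y in simp)
  then show ?thesis
  proof (rule unlikely_mono)
    show "l * ((1 - g) * D) \<le> l * sq p (W e)"
      if "sq p (W e) \<le> (1 - g) * (p * card A + (card A)\<^sup>2 * sq p \<theta>)" for e
      using that l by (simp add: D_def N_def)
    have "exp (- (l * ((1 - g) * D))) * (exp (l * sq p v / (1 + y)) / sqrt (1 + y) ^ p)
        \<le> exp (- (l * ((1 - g) * D))) * (exp (l * sq p v / (1 + y)) / exp (p * (y - y\<^sup>2) / 2))"
      using y by (intro mult_left_mono divide_left_mono exp_le_sqrt_one_plus_power) auto
    also have "\<dots> = exp (- (l * ((1 - g) * D)) + l * sq p v / (1 + y) - p * (y - y\<^sup>2) / 2)"
      by (simp only: exp_add exp_diff times_divide_eq_right)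
    also have "\<dots> \<le> exp (- (g\<^sup>2 * p / 8))"
    proof -
      have "1 - y \<le> 1 / (1 + y)" using y by (simp add: field_simps)
      then have "l * sq p v * (1 / (1 + y)) \<le> l * sq p v * (1 - y)"
        using l dot_self_nonneg[of p v] by (intro mult_left_mono_neg) (auto simp: mult_nonpos_nonneg)
      moreover have "l * sq p v * (1 - y) = - (y / 2) * (N * sq p \<theta>) * (1 - y)"
        using N by (simp add: vv l_def power2_eq_square)
      moreover have "- (l * ((1 - g) * D)) = (y / 2) * ((1 - g) * (p + N * sq p \<theta>))"
        using N by (simp add: D_def l_def field_simps power2_eq_square)
      ultimately have "- (l * ((1 - g) * D)) + l * sq p v / (1 + y) - p * (y - y\<^sup>2) / 2
          \<le> (y / 2) * ((1 - g) * (p + N * sq p \<theta>)) - (y / 2) * (N * sq p \<theta>) * (1 - y) - p * (y - y\<^sup>2) / 2"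
        by simp
      also have "\<dots> = - (g\<^sup>2 * p / 8) - (g\<^sup>2 / 8) * (N * sq p \<theta>)"
        by (simp add: y_def field_simps power2_eq_square)
      also have "\<dots> \<le> - (g\<^sup>2 * p / 8)" using N dot_self_nonneg[of p \<theta>] by simp
      finally show ?thesis by simp
    qed
    finally show "exp (- (l * ((1 - g) * D))) * (exp (l * sq p v / (1 + y)) / sqrt (1 + y) ^ p)
        \<le> exp (- (g\<^sup>2 * p / 8))" .
  qed
qed

text \<open>Both signs of \<open>s\<close> are needed: \<open>s = a\<close> bounds the interaction
  of a point with the rest of \<open>S\<close> from above, \<open>s = - a\<close> that of two points
  from below. The numerical conditions keep the exponential moment at most
  \<open>exp (3 * L)\<close>, so the threshold \<open>6 * L\<close> leaves
  \<open>exp (- (3 * L))\<close>, which for L = log n survives a union bound over n^2 pairs.\<close>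

lemma unlikely_noise_pair:
  fixes \<theta> :: "nat \<Rightarrow> real"
  assumes I: "finite I" "i \<in> I" "A \<subseteq> I - {i}" and m: "card A \<le> m" and a: "0 < a" "a \<le> 1" "a\<^sup>2 * m \<le> 1/2" "a * m \<le> 1"
    and L: "4 * sq p \<theta> * a * m + p * a\<^sup>2 * m \<le> 3 * L" and s: "\<bar>s\<bar> = a"
  shows "unlikely (noise I p) (\<lambda>e. 6 * L \<le> s * dot p (\<lambda>j. \<theta> j + e i j) (\<lambda>j. card A * \<theta> j + (\<Sum>k\<in>A. e k j)))
    (exp (- (3 * L)))"
proof -
  define c where "c = real (card A)"
  have c: "0 \<le> c" "c \<le> m" using m by (auto simp: c_def)
  have s2: "s\<^sup>2 = a\<^sup>2" using s by (simp flip: s)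
  have sc: "s\<^sup>2 * c \<le> 1/2"
  proof -
    have "a\<^sup>2 * c \<le> a\<^sup>2 * m" using c(2) by (rule mult_left_mono) simp
    then show ?thesis using a(3) by (simp add: s2)
  qed
  have sc0: "0 \<le> s\<^sup>2 * c" using c by simp
  define X where "X = sq p \<theta> / 2 * (((s * c)\<^sup>2 + 2 * s * c + s\<^sup>2 * c) / (1 - s\<^sup>2 * c))"
  have "unlikely (noise I p) (\<lambda>e. 6 * L \<le> s * dot p (\<lambda>j. \<theta> j + e i j) (\<lambda>j. card A * \<theta> j + (\<Sum>k\<in>A. e k j)))
      (exp (- (6 * L)) * (exp X / sqrt (1 - s\<^sup>2 * c) ^ p))"
  proof (rule unlikely_chernoff[OF finite_measure_noise])
    show "(\<lambda>e. s * dot p (\<lambda>j. \<theta> j + e i j) (\<lambda>j. card A * \<theta> j + (\<Sum>k\<in>A. e k j))) \<in> borel_measurable (noise I p)"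
      using I by (intro noise_measurable_intros) auto
    have "s\<^sup>2 * card A < 1" "s \<noteq> 0" using sc a s by (auto simp: c_def)
    from nn_integral_noise_exp_pair[OF I this(2,1), of p \<theta>]
    show "(\<integral>\<^sup>+e. ennreal (exp (s * dot p (\<lambda>j. \<theta> j + e i j) (\<lambda>j. card A * \<theta> j + (\<Sum>k\<in>A. e k j)))) \<partial>noise I p)
      \<le> ennreal (exp X / sqrt (1 - s\<^sup>2 * c) ^ p)"
      by (simp add: c_def X_def)
  qed (use sc in simp)
  then show ?thesis
  proof (rule unlikely_mono)
    have ac: "a * c \<le> a * m" using a c by (intro mult_left_mono) auto
    have X_le: "X \<le> 4 * sq p \<theta> * (a * m)"
    proof -
      have "(s * c)\<^sup>2 = (a * c) * (a * c)" by (simp add: power_mult_distrib s2) (simp add: power2_eq_square)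
      also have "\<dots> \<le> 1 * (a * c)" using a(1) c ac a(4) by (intro mult_right_mono order_trans[OF ac]) simp_all
      finally have 1: "(s * c)\<^sup>2 \<le> a * c" by simp
      have 2: "2 * s * c \<le> 2 * (a * c)" using s c mult_right_mono[of s a c] by auto
      have 3: "s\<^sup>2 * c \<le> a * c"
        unfolding s2 using a c by (intro mult_right_mono) (auto simp: power2_eq_square intro: mult_left_le)
      have "((s * c)\<^sup>2 + 2 * s * c + s\<^sup>2 * c) / (1 - s\<^sup>2 * c) \<le> (4 * (a * c)) / (1 - s\<^sup>2 * c)"
        using 1 2 3 sc by (intro divide_right_mono) auto
      also have "\<dots> \<le> (4 * (a * c)) / (1/2)"
        using sc a c by (intro divide_left_mono) auto
      also have "\<dots> \<le> 8 * (a * m)" using ac by simp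
      finally have "X \<le> sq p \<theta> / 2 * (8 * (a * m))"
        unfolding X_def using dot_self_nonneg[of p \<theta>] by (intro mult_left_mono) auto
      then show ?thesis by (simp add: mult_ac)
    qed
    have "exp (- (6 * L)) * (exp X / sqrt (1 - s\<^sup>2 * c) ^ p)
        \<le> exp (- (6 * L)) * (exp X / exp (- (p * (s\<^sup>2 * c + 2 * (s\<^sup>2 * c)\<^sup>2) / 2)))"
      using sc sc0 by (intro mult_left_mono divide_left_mono exp_le_sqrt_one_minus_power) auto
    also have "\<dots> = exp (- (6 * L) + X + p * (s\<^sup>2 * c + 2 * (s\<^sup>2 * c)\<^sup>2) / 2)"
    proof -
      have "exp x * (exp X / exp (- z)) = exp (x + X + z)" for x z :: real
        by (simp add: exp_add exp_minus field_simps)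
      then show ?thesis .
    qed
    also have "\<dots> \<le> exp (- (3 * L))"
    proof -
      have "2 * (s\<^sup>2 * c)\<^sup>2 \<le> 2 * (s\<^sup>2 * c * (1/2))"
        unfolding power2_eq_square[of "s\<^sup>2 * c"] using sc sc0 by (intro mult_left_mono) auto
      then have "s\<^sup>2 * c + 2 * (s\<^sup>2 * c)\<^sup>2 \<le> 2 * (a\<^sup>2 * c)" by (simp add: s2 mult.commute)
      also have "\<dots> \<le> 2 * (a\<^sup>2 * m)" using c by (simp add: mult_left_mono)
      finally have "p * (s\<^sup>2 * c + 2 * (s\<^sup>2 * c)\<^sup>2) / 2 \<le> p * (2 * (a\<^sup>2 * m)) / 2"
        by (intro divide_right_mono mult_left_mono) auto
      then show ?thesis using X_le L by (simp add: mult.assoc)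
    qed
    finally show "exp (- (6 * L)) * (exp X / sqrt (1 - s\<^sup>2 * c) ^ p) \<le> exp (- (3 * L))" .
  qed
qed

text \<open>For a single \<open>i\<close> in \<open>T\<close>, the sum over \<open>S - T\<close> is
  the one over \<open>S - {i}\<close>, at most \<open>u\<close>, minus the one over
  \<open>T - {i}\<close>, which has at most \<open>t\<close> terms of size at least
  \<open>- (u / t)\<close>. Together they use up the margin \<open>2 * u\<close>. The hypotheses
  concern points and pairs only, so no union bound over the subsets \<open>T\<close> is
  needed.\<close>

lemma flip_gain_nonpos:
  fixes Y :: "nat \<Rightarrow> nat \<Rightarrow> real"
  assumes S: "finite S" "G \<subseteq> S" "card G = t" "t \<ge> 1" and T: "T \<subseteq> G" and u: "u \<ge> 0"
    and 1: "\<And>i. i \<in> G \<Longrightarrow> dot p (Y i) (\<lambda>j. \<Sum>k\<in>R. Y k j) \<le> - (2 * u)"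
    and 2: "\<And>i. i \<in> G \<Longrightarrow> dot p (Y i) (\<lambda>j. \<Sum>k\<in>S-{i}. Y k j) \<le> u"
    and 3: "\<And>i k. i \<in> G \<Longrightarrow> k \<in> G \<Longrightarrow> i \<noteq> k \<Longrightarrow> - (u / t) \<le> dot p (Y i) (Y k)"
  shows "dot p (\<lambda>j. \<Sum>i\<in>T. Y i j) (\<lambda>j. (\<Sum>k\<in>R. Y k j) + (\<Sum>k\<in>S-T. Y k j)) \<le> 0"
proof -
  have fin: "finite G" "finite T" using S T finite_subset by metis+
  have "dot p (Y i) (\<lambda>j. (\<Sum>k\<in>R. Y k j) + (\<Sum>k\<in>S-T. Y k j)) \<le> 0" if i: "i \<in> T" for i
  proof -
    have iG: "i \<in> G" using i T by auto
    have "S - {i} = (S - T) \<union> (T - {i})" using i T S by auto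
    then have "(\<Sum>k\<in>S-{i}. dot p (Y i) (Y k)) = (\<Sum>k\<in>S-T. dot p (Y i) (Y k)) + (\<Sum>k\<in>T-{i}. dot p (Y i) (Y k))"
      using S fin by (simp only:) (rule sum.union_disjoint, auto)
    moreover have "(\<Sum>k\<in>T-{i}. - (u / t)) \<le> (\<Sum>k\<in>T-{i}. dot p (Y i) (Y k))"
      using T i by (intro sum_mono 3) auto
    moreover have "(\<Sum>k\<in>T-{i}. - (u / t)) \<ge> - u"
    proof -
      have "real (card (T - {i})) \<le> t"
        using card_mono[of G "T - {i}"] fin T S(3) by auto
      then have "real (card (T - {i})) * (u / t) \<le> t * (u / t)"
        using u by (intro mult_right_mono) auto
      then show ?thesis using S(4) by simp
    qed
    ultimately show ?thesis
      using 1[OF iG] 2[OF iG] by (simp add: dot_add_right dot_sum_right)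
  qed
  then show ?thesis by (simp add: dot_sum_left sum_nonpos)
qed

text \<open>The five terms of the bound belong to five exceptional events: a large noise of
  \<open>R\<close> along \<open>\<theta>\<close>, a short sum over \<open>R\<close>, a large
  interaction of a point with the rest of \<open>S\<close>, a very negative interaction of two
  points of \<open>S\<close>, and too few points of \<open>S\<close> that oppose the sum over
  \<open>R\<close>. Outside them \<open>flip_gain_nonpos\<close> applies.\<close>

lemma unlikely_not_flippable_random_center:
  fixes \<theta> :: "nat \<Rightarrow> real" and a b :: real
  assumes I: "finite I" "S \<subseteq> I" "R \<subseteq> I - S" "R \<noteq> {}" and t: "t \<ge> 1" and g: "0 < g" "g < 1"
    and u: "u > 0" and r: "r \<ge> 0" and \<theta>: "sq p \<theta> > 0"
    and reach: "card R * sq p \<theta> + 3 * u \<le> r * sqrt ((1 - g) * (p * card R + (card R)\<^sup>2 * sq p \<theta>))"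
    and a: "0 < a" "a = 6 * L / u" "a \<le> 1" "a\<^sup>2 * card S \<le> 1/2" "a * card S \<le> 1"
      "4 * sq p \<theta> * a * card S + p * a\<^sup>2 * card S \<le> 3 * L"
    and b: "b = 6 * L * t / u" "b \<le> 1/2" "4 * sq p \<theta> * b + p * b\<^sup>2 \<le> 3 * L"
  defines "Y e \<equiv> \<lambda>i j. \<theta> j + e i j"
  shows "unlikely (noise I p) (\<lambda>e. \<not> (\<exists>G\<subseteq>S. card G = t \<and> (\<forall>T\<subseteq>G.
      dot p (\<lambda>j. \<Sum>i\<in>T. Y e i j) (\<lambda>j. (\<Sum>k\<in>R. Y e k j) + (\<Sum>k\<in>S-T. Y e k j)) \<le> 0)))
    (exp (- (u\<^sup>2 / (2 * card R * sq p \<theta>))) + exp (- (g\<^sup>2 * p / 8))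
      + card S * exp (- (3 * L)) + card S * (card S * exp (- (3 * L))) + exp (t - card S * reach_prob r / 2))"
  (is "unlikely _ ?bad _")
proof -
  define W where "W e j = card R * \<theta> j + (\<Sum>k\<in>R. e k j)" for e j
  have S: "finite S" using I finite_subset by auto
  have R: "R \<subseteq> I" using I by auto
  have L: "L > 0" using a(1,2) u by (simp add: zero_less_divide_iff)
  have b0: "b > 0" using b(1) L u t by simp
  have sumY: "(\<lambda>j. \<Sum>k\<in>A. Y e k j) = (\<lambda>j. card A * \<theta> j + (\<Sum>k\<in>A. e k j))" for A e
    by (simp add: Y_def sum.distrib)
  let ?D = "(1 - g) * (p * card R + (card R)\<^sup>2 * sq p \<theta>)"
  have D: "0 < ?D"
    using g \<theta> I finite_subset[OF R] by (intro mult_pos_pos add_nonneg_pos) (auto simp: card_gt_0_iff)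
  have e1: "unlikely (noise I p) (\<lambda>e. u \<le> dot p \<theta> (\<lambda>j. \<Sum>i\<in>R. e i j)) (exp (- (u\<^sup>2 / (2 * card R * sq p \<theta>))))"
    by (rule unlikely_noise_linear) (use I u \<theta> R in auto)
  have e2: "unlikely (noise I p) (\<lambda>e. sq p (W e) \<le> ?D) (exp (- (g\<^sup>2 * p / 8)))"
    unfolding W_def by (rule unlikely_noise_square_small) (use I R g in auto)
  \<comment> \<open>By the choice of \<open>a\<close>, the event says that some product with the
    rest of \<open>S\<close> is at least \<open>u\<close>.\<close>
  have e3: "unlikely (noise I p) (\<lambda>e. \<exists>i\<in>S. 6 * L \<le> a * dot p (Y e i) (\<lambda>j. \<Sum>k\<in>S-{i}. Y e k j)) (card S * exp (- (3 * L)))"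
    unfolding sumY unfolding Y_def
    by (rule unlikely_Bex[OF finite_measure_noise S], rule unlikely_noise_pair[of _ _ _ "card S" a])
      (use I a(1) a(3-6) S in \<open>auto simp: card_Diff1_le\<close>)
  \<comment> \<open>By the choice of \<open>b\<close>, the event says that the product of two points
    is at most \<open>- (u / t)\<close>.\<close>
  have e4: "unlikely (noise I p) (\<lambda>e. \<exists>i\<in>S. \<exists>k\<in>S. k \<noteq> i \<and> 6 * L \<le> (- b) * dot p (Y e i) (Y e k))
      (card S * (card S * exp (- (3 * L))))"
  proof (intro unlikely_Bex finite_measure_noise S)
    fix i k assume ik: "i \<in> S" "k \<in> S"
    show "unlikely (noise I p) (\<lambda>e. k \<noteq> i \<and> 6 * L \<le> (- b) * dot p (Y e i) (Y e k)) (exp (- (3 * L)))"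
    proof (cases "k = i")
      case True
      then show ?thesis unfolding unlikely_def by (intro bexI[of _ "{}"]) auto
    next
      case False
      have "b\<^sup>2 \<le> (1/2)\<^sup>2" using b b0 by (intro power_mono) auto
      then have "unlikely (noise I p) (\<lambda>e. 6 * L \<le> (- b) * dot p (\<lambda>j. \<theta> j + e i j)
          (\<lambda>j. card {k} * \<theta> j + (\<Sum>k\<in>{k}. e k j))) (exp (- (3 * L)))"
        by (intro unlikely_noise_pair[of _ _ _ 1 b])
          (use I ik False b(2,3) b0 in \<open>auto simp: power2_eq_square\<close>)
      then show ?thesis by (rule unlikely_mono) (simp_all add: Y_def)
    qed
  qed
  have e5: "unlikely (noise I p) (\<lambda>e. 0 < sq p (W e) \<and>
      2 * u + dot p \<theta> (W e) \<le> r * sqrt (sq p (W e)) \<and>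
      card {i \<in> S. dot p (\<lambda>j. \<theta> j + e i j) (W e) \<le> - (2 * u)} \<le> t) (exp (t - card S * reach_prob r / 2))"
    unfolding W_def by (rule noise_count_lower) (use I r in auto)
  note union = unlikely_disj[OF finite_measure_noise unlikely_disj[OF finite_measure_noise
      unlikely_disj[OF finite_measure_noise unlikely_disj[OF finite_measure_noise e1 e2] e3] e4] e5]
  show ?thesis
  proof (rule unlikely_mono[OF union], rule ccontr)
    fix e
    assume bad: "?bad e"
    assume "\<not> ((((u \<le> dot p \<theta> (\<lambda>j. \<Sum>i\<in>R. e i j) \<or> sq p (W e) \<le> ?D)
        \<or> (\<exists>i\<in>S. 6 * L \<le> a * dot p (Y e i) (\<lambda>j. \<Sum>k\<in>S-{i}. Y e k j)))
        \<or> (\<exists>i\<in>S. \<exists>k\<in>S. k \<noteq> i \<and> 6 * L \<le> (- b) * dot p (Y e i) (Y e k)))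
        \<or> (0 < sq p (W e) \<and> 2 * u + dot p \<theta> (W e) \<le> r * sqrt (sq p (W e)) \<and>
          card {i \<in> S. dot p (\<lambda>j. \<theta> j + e i j) (W e) \<le> - (2 * u)} \<le> t))"
    note n = this[unfolded de_Morgan_disj]
    have 1: "dot p \<theta> (\<lambda>j. \<Sum>i\<in>R. e i j) < u" and 2: "?D < sq p (W e)"
      and 3: "\<And>i. i \<in> S \<Longrightarrow> a * dot p (Y e i) (\<lambda>j. \<Sum>k\<in>S-{i}. Y e k j) < 6 * L"
      and 4: "\<And>i k. i \<in> S \<Longrightarrow> k \<in> S \<Longrightarrow> k \<noteq> i \<Longrightarrow> (- b) * dot p (Y e i) (Y e k) < 6 * L"
      and 5: "0 < sq p (W e) \<Longrightarrow> 2 * u + dot p \<theta> (W e) \<le> r * sqrt (sq p (W e)) \<Longrightarrow>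
          t < card {i \<in> S. dot p (\<lambda>j. \<theta> j + e i j) (W e) \<le> - (2 * u)}"
    proof -
      show "dot p \<theta> (\<lambda>j. \<Sum>i\<in>R. e i j) < u" "?D < sq p (W e)" using n by (simp_all add: not_le)
      show "a * dot p (Y e i) (\<lambda>j. \<Sum>k\<in>S-{i}. Y e k j) < 6 * L" if "i \<in> S" for i
        using conjunct2[OF conjunct1[OF conjunct1[OF n]]] that by (meson not_le)
      show "(- b) * dot p (Y e i) (Y e k) < 6 * L" if "i \<in> S" "k \<in> S" "k \<noteq> i" for i k
        using conjunct2[OF conjunct1[OF n]] that by (meson not_le)
      show "t < card {i \<in> S. dot p (\<lambda>j. \<theta> j + e i j) (W e) \<le> - (2 * u)}"
        if "0 < sq p (W e)" "2 * u + dot p \<theta> (W e) \<le> r * sqrt (sq p (W e))"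
        using conjunct2[OF n] that by (meson not_le)
    qed
    \<comment> \<open>\<open>dot p \<theta> (W e)\<close> is \<open>card R * sq p \<theta>\<close>
      plus a noise term below \<open>u\<close>; with the margin \<open>2 * u\<close> this explains
      the \<open>3 * u\<close> in \<open>reach\<close>.\<close>
    have "2 * u + dot p \<theta> (W e) \<le> r * sqrt ?D"
      using reach 1 by (simp add: W_def[abs_def] dot_add_right dot_scale_right)
    also have "\<dots> \<le> r * sqrt (sq p (W e))" using 2 r by (intro mult_left_mono) auto
    finally have "t < card {i \<in> S. dot p (\<lambda>j. \<theta> j + e i j) (W e) \<le> - (2 * u)}"
      using 5 2 D by simp
    then obtain G where G: "G \<subseteq> {i \<in> S. dot p (\<lambda>j. \<theta> j + e i j) (W e) \<le> - (2 * u)}" "card G = t"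
      by (elim obtain_subset_with_card_n[OF less_imp_le])
    have "dot p (\<lambda>j. \<Sum>i\<in>T. Y e i j) (\<lambda>j. (\<Sum>k\<in>R. Y e k j) + (\<Sum>k\<in>S-T. Y e k j)) \<le> 0" if T: "T \<subseteq> G" for T
    proof (rule flip_gain_nonpos[OF S _ G(2) t T])
      show "G \<subseteq> S" "u \<ge> 0" using G u by auto
      show "dot p (Y e i) (\<lambda>j. \<Sum>k\<in>R. Y e k j) \<le> - (2 * u)" if "i \<in> G" for i
        using that G unfolding sumY by (auto simp: W_def[abs_def] Y_def)
      show "dot p (Y e i) (\<lambda>j. \<Sum>k\<in>S-{i}. Y e k j) \<le> u" if "i \<in> G" for i
        using 3[of i] that G u L unfolding a(2) by (auto simp: field_simps)
      show "- (u / t) \<le> dot p (Y e i) (Y e k)" if "i \<in> G" "k \<in> G" "i \<noteq> k" for i k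
      proof -
        have "i \<in> S" "k \<in> S" using that G by auto
        from 4[OF this] that(3) have "6 * L * (- (t / u * dot p (Y e i) (Y e k))) < 6 * L * 1"
          unfolding b(1) by (simp add: mult.assoc)
        then have "- (t / u * dot p (Y e i) (Y e k)) < 1"
          using L by (subst (asm) mult_less_cancel_left_pos) auto
        then show ?thesis using u t by (simp add: field_simps)
      qed
    qed
    moreover have "G \<subseteq> S" using G(1) by auto
    ultimately show False using bad G(2) by blast
  qed simp
qed

subsection \<open>Transformations of product measures\<close>

lemma distr_PiM_componentwise:
  assumes I: "finite I" and M: "\<And>i. prob_space (M i)" and f: "\<And>i. f i \<in> M i \<rightarrow>\<^sub>M N i"
  shows "distr (Pi\<^sub>M I M) (Pi\<^sub>M I N) (\<lambda>x. \<lambda>i\<in>I. f i (x i)) = Pi\<^sub>M I (\<lambda>i. distr (M i) (N i) (f i))"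
proof -
  interpret product_sigma_finite M
    using M by (simp add: product_sigma_finite_def prob_space_imp_sigma_finite)
  interpret D: product_sigma_finite "\<lambda>i. distr (M i) (N i) (f i)"
    using M f by (simp add: product_sigma_finite_def prob_space_imp_sigma_finite prob_space.prob_space_distr)
  have meas: "(\<lambda>x. \<lambda>i\<in>I. f i (x i)) \<in> Pi\<^sub>M I M \<rightarrow>\<^sub>M Pi\<^sub>M I N"
    by (rule measurable_restrict, rule measurable_compose[OF measurable_component_singleton], assumption, rule f)
  show ?thesis
  proof (rule D.PiM_eqI[OF I])
    show "sets (distr (Pi\<^sub>M I M) (Pi\<^sub>M I N) (\<lambda>x. \<lambda>i\<in>I. f i (x i))) = sets (Pi\<^sub>M I (\<lambda>i. distr (M i) (N i) (f i)))"
      by (simp cong: sets_PiM_cong)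
    fix A assume A: "\<And>i. i \<in> I \<Longrightarrow> A i \<in> sets (distr (M i) (N i) (f i))"
    have "(\<lambda>x. \<lambda>i\<in>I. f i (x i)) -` Pi\<^sub>E I A \<inter> space (Pi\<^sub>M I M) = Pi\<^sub>E I (\<lambda>i. f i -` A i \<inter> space (M i))"
      by (auto simp: space_PiM PiE_iff)
    then show "emeasure (distr (Pi\<^sub>M I M) (Pi\<^sub>M I N) (\<lambda>x. \<lambda>i\<in>I. f i (x i))) (Pi\<^sub>E I A)
        = (\<Prod>i\<in>I. emeasure (distr (M i) (N i) (f i)) (A i))"
      using A f I
      by (simp add: emeasure_distr[OF meas] sets_PiM_I_finite emeasure_PiM emeasure_distr[OF f] measurable_sets[OF f])
  qed
qed

lemma PiM_density:
  assumes I: "finite I" and M: "\<And>i. prob_space (M i)" and f: "\<And>i. f i \<in> borel_measurable (M i)"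
    and D: "\<And>i. prob_space (density (M i) (f i))"
  shows "Pi\<^sub>M I (\<lambda>i. density (M i) (f i)) = density (Pi\<^sub>M I M) (\<lambda>x. \<Prod>i\<in>I. f i (x i))"
proof -
  interpret product_sigma_finite M
    using M by (simp add: product_sigma_finite_def prob_space_imp_sigma_finite)
  interpret D: product_sigma_finite "\<lambda>i. density (M i) (f i)"
    using D by (simp add: product_sigma_finite_def prob_space_imp_sigma_finite)
  have meas: "(\<lambda>x. \<Prod>i\<in>I. f i (x i)) \<in> borel_measurable (Pi\<^sub>M I M)"
    by (rule borel_measurable_prod_ennreal, rule measurable_compose[OF measurable_component_singleton], assumption, rule f)
  show ?thesis
  proof (rule D.PiM_eqI[OF I, symmetric])
    show "sets (density (Pi\<^sub>M I M) (\<lambda>x. \<Prod>i\<in>I. f i (x i))) = sets (Pi\<^sub>M I (\<lambda>i. density (M i) (f i)))"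
      by (simp cong: sets_PiM_cong)
    fix A assume "\<And>i. i \<in> I \<Longrightarrow> A i \<in> sets (density (M i) (f i))"
    then have A: "\<And>i. i \<in> I \<Longrightarrow> A i \<in> sets (M i)" by simp
    have "emeasure (density (Pi\<^sub>M I M) (\<lambda>x. \<Prod>i\<in>I. f i (x i))) (Pi\<^sub>E I A)
        = (\<integral>\<^sup>+x. (\<Prod>i\<in>I. f i (x i)) * indicator (Pi\<^sub>E I A) x \<partial>Pi\<^sub>M I M)"
      using A I by (intro emeasure_density meas sets_PiM_I_finite)
    also have "\<dots> = (\<integral>\<^sup>+x. (\<Prod>i\<in>I. f i (x i) * indicator (A i) (x i)) \<partial>Pi\<^sub>M I M)"
    proof (rule nn_integral_cong)
      fix x assume x: "x \<in> space (Pi\<^sub>M I M)"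
      have "indicator (Pi\<^sub>E I A) x = (\<Prod>i\<in>I. indicator (A i) (x i) :: ennreal)"
      proof (cases "x \<in> Pi\<^sub>E I A")
        case False
        then obtain i where "i \<in> I" "x i \<notin> A i" using x by (auto simp: PiE_iff space_PiM)
        then show ?thesis using I False by (auto intro!: prod_zero[symmetric] bexI[of _ i])
      qed (auto simp: PiE_iff)
      then show "(\<Prod>i\<in>I. f i (x i)) * indicator (Pi\<^sub>E I A) x = (\<Prod>i\<in>I. f i (x i) * indicator (A i) (x i))"
        by (simp add: prod.distrib)
    qed
    also have "\<dots> = (\<Prod>i\<in>I. \<integral>\<^sup>+x. f i x * indicator (A i) x \<partial>M i)"
      using A by (intro product_nn_integral_prod I borel_measurable_times_ennreal f borel_measurable_indicator)
    also have "\<dots> = (\<Prod>i\<in>I. emeasure (density (M i) (f i)) (A i))"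
      using A by (intro prod.cong refl emeasure_density[symmetric] f)
    finally show "emeasure (density (Pi\<^sub>M I M) (\<lambda>x. \<Prod>i\<in>I. f i (x i))) (Pi\<^sub>E I A)
        = (\<Prod>i\<in>I. emeasure (density (M i) (f i)) (A i))" .
  qed
qed

lemma distr_std_normal_scale:
  assumes "a \<noteq> 0"
  shows "distr (density lborel (normal_density 0 1)) borel (\<lambda>x. a * x) = density lborel (normal_density 0 \<bar>a\<bar>)"
proof -
  interpret prob_space "density lborel (normal_density 0 1)" by (rule prob_space_std_normal)
  have "distributed (density lborel (normal_density 0 1)) lborel (\<lambda>x. x) (normal_density 0 1)"
    unfolding distributed_def by (auto intro!: distr_id2)
  from normal_density_affine[OF this, of a 0] assms
  have "distr (density lborel (normal_density 0 1)) lborel (\<lambda>x. a * x) = density lborel (normal_density 0 \<bar>a\<bar>)"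
    by (simp add: distributed_def)
  moreover have "distr (density lborel (normal_density 0 1)) lborel (\<lambda>x. a * x)
      = distr (density lborel (normal_density 0 1)) borel (\<lambda>x. a * x)"
    by (rule distr_cong) simp_all
  ultimately show ?thesis by simp
qed

text \<open>Cameron-Martin formula in one dimension. All likelihoods below are densities with
  respect to the law of pure noise.\<close>

lemma distr_std_normal_shift:
  "distr (density lborel (normal_density 0 1)) borel (\<lambda>x. c + x)
    = density (density lborel (normal_density 0 1)) (\<lambda>x. ennreal (exp (c * x - c\<^sup>2 / 2)))"
proof -
  interpret prob_space "density lborel (normal_density 0 1)" by (rule prob_space_std_normal)
  have "distributed (density lborel (normal_density 0 1)) lborel (\<lambda>x. x) (normal_density 0 1)"
    unfolding distributed_def by (auto intro!: distr_id2)
  from normal_density_affine[OF this, of 1 c]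
  have "distr (density lborel (normal_density 0 1)) lborel (\<lambda>x. c + x) = density lborel (normal_density c 1)"
    by (simp add: distributed_def)
  moreover have "distr (density lborel (normal_density 0 1)) lborel (\<lambda>x. c + x)
      = distr (density lborel (normal_density 0 1)) borel (\<lambda>x. c + x)"
    by (rule distr_cong) simp_all
  moreover have "normal_density c 1 x = normal_density 0 1 x * exp (c * x - c\<^sup>2 / 2)" for x
  proof -
    have "- (x - c)\<^sup>2 / 2 = - x\<^sup>2 / 2 + (c * x - c\<^sup>2 / 2)"
      by (simp add: power2_eq_square field_simps)
    then show ?thesis by (simp add: normal_density_def mult_exp_exp)
  qed
  ultimately show ?thesis
    by (simp add: density_density_eq ennreal_mult')
qed

lemma distr_gauss_scale:
  assumes "\<bar>a\<bar> = \<sigma>" "\<sigma> > 0"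
  shows "distr (gauss p) (vectors p) (\<lambda>x. \<lambda>j\<in>{1..p}. a * x j) = isotropic_gaussian p \<sigma>"
  unfolding isotropic_gaussian_def
  using distr_PiM_componentwise[of "{1..p}" "\<lambda>_. density lborel (normal_density 0 1)" "\<lambda>_ x. a * x" "\<lambda>_. borel"]
    distr_std_normal_scale[of a] assms
  by (auto simp: prob_space_std_normal)

lemma distr_gauss_shift:
  "distr (gauss p) (vectors p) (\<lambda>x. \<lambda>j\<in>{1..p}. v j + x j)
    = density (gauss p) (\<lambda>x. ennreal (exp (dot p v x - sq p v / 2)))"
proof -
  let ?N = "density lborel (normal_density 0 1)"
  have D: "prob_space (density ?N (\<lambda>x. ennreal (exp (c * x - c\<^sup>2 / 2))))" for c
    unfolding distr_std_normal_shift[symmetric]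
    by (rule prob_space.prob_space_distr[OF prob_space_std_normal]) simp
  have "distr (gauss p) (vectors p) (\<lambda>x. \<lambda>j\<in>{1..p}. v j + x j)
      = Pi\<^sub>M {1..p} (\<lambda>j. density ?N (\<lambda>x. ennreal (exp (v j * x - (v j)\<^sup>2 / 2))))"
    unfolding isotropic_gaussian_def distr_std_normal_shift[symmetric]
    by (rule distr_PiM_componentwise) (auto simp: prob_space_std_normal)
  also have "\<dots> = density (gauss p) (\<lambda>x. \<Prod>j\<in>{1..p}. ennreal (exp (v j * x j - (v j)\<^sup>2 / 2)))"
    unfolding isotropic_gaussian_def by (rule PiM_density) (auto simp: prob_space_std_normal D)
  also have "(\<lambda>x. \<Prod>j\<in>{1..p}. ennreal (exp (v j * x j - (v j)\<^sup>2 / 2))) = (\<lambda>x. ennreal (exp (dot p v x - sq p v / 2)))"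
    by (simp add: prod_ennreal exp_sum[symmetric] dot_def sum_subtractf sum_divide_distrib power2_eq_square)
  finally show ?thesis .
qed

text \<open>Prescribing only the absolute value of \<open>a i\<close> covers both the change of
  units by \<open>\<sigma>\<close> and the sign changes of the noise, by symmetry of the normal
  law.\<close>

lemma distr_noise_scale:
  assumes "finite I" and a: "\<And>i. \<bar>a i\<bar> = \<sigma>" "\<sigma> > 0"
  shows "distr (noise I p) (Pi\<^sub>M I (\<lambda>_. vectors p)) (\<lambda>e. \<lambda>i\<in>I. \<lambda>j\<in>{1..p}. a i * e i j)
    = Pi\<^sub>M I (\<lambda>_. isotropic_gaussian p \<sigma>)"
proof -
  have "distr (noise I p) (Pi\<^sub>M I (\<lambda>_. vectors p)) (\<lambda>e. \<lambda>i\<in>I. (\<lambda>x. \<lambda>j\<in>{1..p}. a i * x j) (e i))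
    = Pi\<^sub>M I (\<lambda>i. distr (gauss p) (vectors p) (\<lambda>x. \<lambda>j\<in>{1..p}. a i * x j))"
    by (rule distr_PiM_componentwise[OF assms(1)], rule prob_space_isotropic_gaussian, simp)
      (intro measurable_restrict borel_measurable_times borel_measurable_const
        measurable_isotropic_gaussian_coordinate)
  then show ?thesis unfolding distr_gauss_scale[OF a] by simp
qed

lemma distr_noise_shift:
  assumes "finite I"
  shows "distr (noise I p) (Pi\<^sub>M I (\<lambda>_. vectors p)) (\<lambda>e. \<lambda>i\<in>I. \<lambda>j\<in>{1..p}. v i j + e i j)
    = density (noise I p) (\<lambda>x. ennreal (exp (\<Sum>i\<in>I. dot p (v i) (x i) - sq p (v i) / 2)))"
proof -
  have meas: "(\<lambda>x. \<lambda>j\<in>{1..p}. v i j + x j) \<in> gauss p \<rightarrow>\<^sub>M vectors p" for i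
    by (auto intro!: measurable_restrict borel_measurable_add borel_measurable_const
        measurable_isotropic_gaussian_coordinate)
  have D: "prob_space (density (gauss p) (\<lambda>x. ennreal (exp (dot p (v i) x - sq p (v i) / 2))))" for i
    unfolding distr_gauss_shift[symmetric]
    by (rule prob_space.prob_space_distr[OF prob_space_isotropic_gaussian meas]) simp
  have "distr (noise I p) (Pi\<^sub>M I (\<lambda>_. vectors p)) (\<lambda>e. \<lambda>i\<in>I. (\<lambda>x. \<lambda>j\<in>{1..p}. v i j + x j) (e i))
    = Pi\<^sub>M I (\<lambda>i. density (gauss p) (\<lambda>x. ennreal (exp (dot p (v i) x - sq p (v i) / 2))))"
    unfolding distr_gauss_shift[symmetric]
    by (rule distr_PiM_componentwise[OF assms], rule prob_space_isotropic_gaussian, simp, rule meas)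
  also have "\<dots> = density (noise I p) (\<lambda>x. \<Prod>i\<in>I. ennreal (exp (dot p (v i) (x i) - sq p (v i) / 2)))"
    by (rule PiM_density[OF assms])
      (auto intro!: prob_space_isotropic_gaussian D measurable_compose[OF _ measurable_ennreal] measurable_compose[OF _ borel_measurable_exp] borel_measurable_diff borel_measurable_dot
        borel_measurable_const measurable_isotropic_gaussian_coordinate)
  also have "(\<lambda>x. \<Prod>i\<in>I. ennreal (exp (dot p (v i) (x i) - sq p (v i) / 2)))
      = (\<lambda>x. ennreal (exp (\<Sum>i\<in>I. dot p (v i) (x i) - sq p (v i) / 2)))"
    using assms by (simp add: prod_ennreal exp_sum)
  finally show ?thesis .
qed

lemma sets_noise: "sets (Pi\<^sub>M I (\<lambda>_. isotropic_gaussian p \<sigma>)) = sets (Pi\<^sub>M I (\<lambda>_. vectors p))"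
  by (intro sets_PiM_cong refl sets_isotropic_gaussian)

lemma measurable_noise_affine:
  "(\<lambda>e. \<lambda>i\<in>I. \<lambda>j\<in>{1..p}. v i j + a i * e i j) \<in> noise I p \<rightarrow>\<^sub>M Pi\<^sub>M I (\<lambda>_. vectors p)"
  by (intro measurable_restrict borel_measurable_add borel_measurable_times borel_measurable_const
      measurable_noise_coordinate)

lemma nn_integral_noise_shift:
  assumes I: "finite I" and F: "F \<in> borel_measurable (noise I p)"
  shows "(\<integral>\<^sup>+e. F (\<lambda>i\<in>I. \<lambda>j\<in>{1..p}. v i j + e i j) \<partial>noise I p)
    = (\<integral>\<^sup>+x. ennreal (exp (\<Sum>i\<in>I. dot p (v i) (x i) - sq p (v i) / 2)) * F x \<partial>noise I p)"
proof -
  let ?B = "Pi\<^sub>M I (\<lambda>_. vectors p) :: (nat \<Rightarrow> nat \<Rightarrow> real) measure"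
  have F': "F \<in> borel_measurable ?B"
    using F by (simp add: measurable_cong_sets[OF sets_noise refl])
  have "(\<integral>\<^sup>+e. F (\<lambda>i\<in>I. \<lambda>j\<in>{1..p}. v i j + e i j) \<partial>noise I p)
      = (\<integral>\<^sup>+x. F x \<partial>distr (noise I p) ?B (\<lambda>e. \<lambda>i\<in>I. \<lambda>j\<in>{1..p}. v i j + e i j))"
    using measurable_noise_affine[where v = v and a = "\<lambda>_. 1" and I = I and p = p] F' by (subst nn_integral_distr) simp_all
  also have "\<dots> = (\<integral>\<^sup>+x. ennreal (exp (\<Sum>i\<in>I. dot p (v i) (x i) - sq p (v i) / 2)) * F x \<partial>noise I p)"
    unfolding distr_noise_shift[OF I]
    by (rule nn_integral_density)
      (auto intro!: F measurable_compose[OF _ measurable_ennreal] measurable_compose[OF _ borel_measurable_exp] borel_measurable_diff borel_measurable_dot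
        borel_measurable_sum borel_measurable_const measurable_noise_coordinate)
  finally show ?thesis .
qed

text \<open>This reduces the analysis under an arbitrary labeling to the case where all signs are
  positive.\<close>

lemma nn_integral_noise_sign_flip:
  assumes I: "finite I" and a: "\<And>i. \<bar>a i\<bar> = 1" and F: "F \<in> borel_measurable (noise I p)"
  shows "(\<integral>\<^sup>+e. F (\<lambda>i\<in>I. \<lambda>j\<in>{1..p}. a i * e i j) \<partial>noise I p) = (\<integral>\<^sup>+e. F e \<partial>noise I p)"
proof -
  let ?B = "Pi\<^sub>M I (\<lambda>_. vectors p) :: (nat \<Rightarrow> nat \<Rightarrow> real) measure"
  have F': "F \<in> borel_measurable ?B"
    using F by (simp add: measurable_cong_sets[OF sets_noise refl])
  have "(\<integral>\<^sup>+e. F (\<lambda>i\<in>I. \<lambda>j\<in>{1..p}. a i * e i j) \<partial>noise I p)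
      = (\<integral>\<^sup>+x. F x \<partial>distr (noise I p) ?B (\<lambda>e. \<lambda>i\<in>I. \<lambda>j\<in>{1..p}. a i * e i j))"
    using measurable_noise_affine[where v = "\<lambda>_ _. 0" and a = a and I = I and p = p] F' by (subst nn_integral_distr) simp_all
  also have "\<dots> = (\<integral>\<^sup>+e. F e \<partial>noise I p)"
    using a by (subst distr_noise_scale[OF I]) auto
  finally show ?thesis .
qed

subsection \<open>Bayes risk under a random center\<close>

text \<open>
  The points of \<open>P\<close> have mean \<open>\<theta>\<close> or \<open>- \<theta>\<close>, with \<open>\<theta>\<close> drawn from \<open>\<pi>\<close>; the signs on \<open>S\<close> are unknown and
  those on \<open>P - S\<close> are known. The other points have known means.
\<close>

locale sign_mixture =
  fixes I P S :: "nat set" and p t :: nat and \<pi> :: "(nat \<Rightarrow> real) measure"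
    and s0 :: "nat \<Rightarrow> real" and m0 :: "nat \<Rightarrow> nat \<Rightarrow> real"
  assumes fin_I: "finite I" and P_I: "P \<subseteq> I" and S_P: "S \<subseteq> P"
    and prob_prior: "prob_space \<pi>" and sets_prior: "sets \<pi> = sets (vectors p)"
    and s0: "\<And>i. \<bar>s0 i\<bar> = 1"
begin

definition sgn_of :: "nat set \<Rightarrow> nat \<Rightarrow> real" where
  "sgn_of A i = (if i \<in> S then (if i \<in> A then 1 else -1) else s0 i)"

definition mean :: "nat set \<Rightarrow> (nat \<Rightarrow> real) \<Rightarrow> nat \<Rightarrow> nat \<Rightarrow> real" where
  "mean A \<theta> i j = (if i \<in> P then sgn_of A i * \<theta> j else m0 i j)"

definition obs :: "nat set \<Rightarrow> (nat \<Rightarrow> real) \<Rightarrow> (nat \<Rightarrow> nat \<Rightarrow> real) \<Rightarrow> nat \<Rightarrow> nat \<Rightarrow> real" where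
  "obs A \<theta> e = (\<lambda>i\<in>I. \<lambda>j\<in>{1..p}. mean A \<theta> i j + e i j)"

definition W :: "nat set \<Rightarrow> (nat \<Rightarrow> nat \<Rightarrow> real) \<Rightarrow> nat \<Rightarrow> real" where
  "W A x j = (\<Sum>i\<in>P. sgn_of A i * x i j)"

text \<open>The likelihood ratio against pure noise, averaged over the prior and stripped of the
  factor \<open>exp (C x)\<close>, which is common to all labelings.\<close>

definition marginal :: "(nat \<Rightarrow> real) \<Rightarrow> ennreal" where
  "marginal w = (\<integral>\<^sup>+\<theta>. ennreal (exp (dot p \<theta> w - card P * sq p \<theta> / 2)) \<partial>\<pi>)"

definition C :: "(nat \<Rightarrow> nat \<Rightarrow> real) \<Rightarrow> real" where
  "C x = (\<Sum>i\<in>I-P. dot p (m0 i) (x i) - sq p (m0 i) / 2)"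

definition lik :: "nat set \<Rightarrow> (nat \<Rightarrow> nat \<Rightarrow> real) \<Rightarrow> ennreal" where
  "lik A x = ennreal (exp (C x)) * marginal (W A x)"

text \<open>Here \<open>y\<close> is the data multiplied by the true signs, that is, center plus
  noise. In these coordinates the true labeling no longer appears, and switching \<open>T\<close>
  subtracts twice the sum over \<open>T\<close>.\<close>

definition flippable :: "(nat \<Rightarrow> nat \<Rightarrow> real) \<Rightarrow> bool" where
  "flippable y \<longleftrightarrow> (\<exists>G\<subseteq>S. card G = t \<and> (\<forall>T\<subseteq>G.
     marginal (\<lambda>j. \<Sum>i\<in>P. y i j) \<le> marginal (\<lambda>j. (\<Sum>i\<in>P. y i j) - 2 * (\<Sum>i\<in>T. y i j))))"

text \<open>The counterpart of \<open>flippable\<close> for raw data under the labeling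
  \<open>A\<close>. The quantifiers range over finite sets so that measurability is
  immediate.\<close>

definition Good :: "nat set \<Rightarrow> (nat \<Rightarrow> nat \<Rightarrow> real) set" where
  "Good A = {x \<in> space (noise I p). \<exists>G\<in>{G. G \<subseteq> S \<and> card G = t}. \<forall>T\<in>Pow G.
     marginal (W A x) \<le> marginal (W (sym_diff A T) x)}"

lemma fin_P: "finite P" and fin_S: "finite S"
  using fin_I P_I S_P finite_subset by metis+

lemma sgn_of_abs: "\<bar>sgn_of A i\<bar> = 1"
  by (simp add: sgn_of_def s0)

lemma sgn_of_square: "sgn_of A i * sgn_of A i = 1"
  using sgn_of_abs[of A i] by (metis abs_mult_self_eq mult.right_neutral)

lemma sgn_of_flip: "T \<subseteq> S \<Longrightarrow> sgn_of (sym_diff A T) i = (if i \<in> T then - sgn_of A i else sgn_of A i)"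
  by (auto simp: sgn_of_def)

text \<open>Signs square to 1, so the norms of the means do not depend on the labeling; the labels
  enter only through \<open>W A x\<close>.\<close>

lemma log_likelihood:
  "(\<Sum>i\<in>I. dot p (mean A \<theta> i) (x i) - sq p (mean A \<theta> i) / 2)
    = C x + (dot p \<theta> (W A x) - card P * sq p \<theta> / 2)"
proof -
  have 1: "dot p (mean A \<theta> i) (x i) - sq p (mean A \<theta> i) / 2
      = sgn_of A i * dot p \<theta> (x i) - sq p \<theta> / 2" if "i \<in> P" for i
  proof -
    have m: "mean A \<theta> i = (\<lambda>j. sgn_of A i * \<theta> j)" using that by (simp add: mean_def[abs_def])
    have "sq p (mean A \<theta> i) = sgn_of A i * sgn_of A i * sq p \<theta>"
      unfolding m dot_scale_left dot_scale_right by simp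
    then show ?thesis unfolding sgn_of_square by (simp add: m dot_scale_left)
  qed
  have "(\<Sum>i\<in>P. dot p (mean A \<theta> i) (x i) - sq p (mean A \<theta> i) / 2)
      = dot p \<theta> (W A x) - card P * sq p \<theta> / 2"
    by (simp add: 1 sum_subtractf W_def[abs_def] dot_sum_right dot_scale_right)
  moreover have "(\<Sum>i\<in>I-P. dot p (mean A \<theta> i) (x i) - sq p (mean A \<theta> i) / 2) = C x"
    unfolding C_def by (intro sum.cong refl) (simp add: mean_def[abs_def])
  ultimately show ?thesis
    using sum.subset_diff[OF P_I fin_I, of "\<lambda>i. dot p (mean A \<theta> i) (x i) - sq p (mean A \<theta> i) / 2"]
    by linarith
qed

lemma prior_coordinate: "j \<in> {1..p} \<Longrightarrow> (\<lambda>\<theta>. \<theta> j) \<in> borel_measurable \<pi>"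
  using measurable_component_singleton[of j "{1..p}" "\<lambda>_. borel"]
  by (simp add: measurable_cong_sets[OF sets_prior refl])

lemma W_measurable: "j \<in> {1..p} \<Longrightarrow> (\<lambda>x. W A x j) \<in> borel_measurable (noise I p)"
  unfolding W_def using P_I by (rule measurable_noise_weighted_sum)

lemma C_measurable: "C \<in> borel_measurable (noise I p)"
  unfolding C_def[abs_def]
  by (intro borel_measurable_sum borel_measurable_diff borel_measurable_dot borel_measurable_const
      measurable_noise_coordinate) auto

lemma joint_measurable:
  "(\<lambda>(\<theta>, x). ennreal (exp (dot p \<theta> (W A x) - card P * sq p \<theta> / 2))) \<in> borel_measurable (\<pi> \<Otimes>\<^sub>M noise I p)"
  unfolding split_beta
  by (intro borel_measurable_ennreal_exp
      borel_measurable_diff borel_measurable_times borel_measurable_divide borel_measurable_const borel_measurable_dot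
      measurable_compose[OF measurable_fst prior_coordinate] measurable_compose[OF measurable_snd W_measurable])

lemma marginal_measurable: "(\<lambda>x. marginal (W A x)) \<in> borel_measurable (noise I p)"
proof -
  interpret sigma_finite_measure \<pi> by (rule prob_space_imp_sigma_finite[OF prob_prior])
  have "(\<lambda>(x, \<theta>). ennreal (exp (dot p \<theta> (W A x) - card P * sq p \<theta> / 2))) \<in> borel_measurable (noise I p \<Otimes>\<^sub>M \<pi>)"
    using measurable_compose[OF measurable_pair_swap' joint_measurable[of A]] by (simp add: split_beta)
  then show ?thesis unfolding marginal_def by (rule borel_measurable_nn_integral)
qed

lemma lik_measurable: "lik A \<in> borel_measurable (noise I p)"
  unfolding lik_def[abs_def]
  by (intro borel_measurable_times_ennreal marginal_measurable borel_measurable_ennreal_exp C_measurable)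

lemma Good_measurable: "Good A \<in> sets (noise I p)"
  unfolding Good_def
  by (intro sets.sets_Collect_finite_Ex sets.sets_Collect_finite_All borel_measurable_le marginal_measurable)
    (auto simp: fin_S intro: finite_subset)

text \<open>\<open>lik A\<close> is the density, against pure noise, of the data whose center is
  drawn from \<open>\<pi>\<close>: the shift formula for a fixed center, then Tonelli.\<close>

lemma nn_integral_lik:
  assumes h: "h \<in> borel_measurable (noise I p)"
  shows "(\<integral>\<^sup>+x. h x * lik A x \<partial>noise I p) = (\<integral>\<^sup>+\<theta>. (\<integral>\<^sup>+e. h (obs A \<theta> e) \<partial>noise I p) \<partial>\<pi>)"
proof -
  interpret Q: pair_sigma_finite \<pi> "noise I p"
    by (simp add: pair_sigma_finite_def prob_space_imp_sigma_finite prob_prior prob_space_noise)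
  let ?k = "\<lambda>\<theta> x. ennreal (exp (dot p \<theta> (W A x) - card P * sq p \<theta> / 2))"
  have "(\<integral>\<^sup>+\<theta>. (\<integral>\<^sup>+e. h (obs A \<theta> e) \<partial>noise I p) \<partial>\<pi>)
      = (\<integral>\<^sup>+\<theta>. (\<integral>\<^sup>+x. ennreal (exp (C x)) * h x * ?k \<theta> x \<partial>noise I p) \<partial>\<pi>)"
    unfolding obs_def nn_integral_noise_shift[OF fin_I h] log_likelihood
    by (simp add: exp_add ennreal_mult' mult_ac)
  also have "\<dots> = (\<integral>\<^sup>+x. (\<integral>\<^sup>+\<theta>. ennreal (exp (C x)) * h x * ?k \<theta> x \<partial>\<pi>) \<partial>noise I p)"
  proof (rule Q.Fubini'[symmetric])
    show "(\<lambda>(\<theta>, x). ennreal (exp (C x)) * h x * ?k \<theta> x) \<in> borel_measurable (\<pi> \<Otimes>\<^sub>M noise I p)"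
      unfolding split_beta
    proof (intro borel_measurable_times_ennreal)
      show "(\<lambda>z. ennreal (exp (C (snd z)))) \<in> borel_measurable (\<pi> \<Otimes>\<^sub>M noise I p)"
        by (intro borel_measurable_ennreal_exp
          measurable_compose[OF measurable_snd C_measurable])
      show "(\<lambda>z. h (snd z)) \<in> borel_measurable (\<pi> \<Otimes>\<^sub>M noise I p)"
        by (rule measurable_compose[OF measurable_snd h])
      show "(\<lambda>z. ?k (fst z) (snd z)) \<in> borel_measurable (\<pi> \<Otimes>\<^sub>M noise I p)"
        using joint_measurable[of A] unfolding split_beta .
    qed
  qed
  also have "\<dots> = (\<integral>\<^sup>+x. h x * lik A x \<partial>noise I p)"
  proof (rule nn_integral_cong)
    fix x assume x: "x \<in> space (noise I p)"
    have "(\<integral>\<^sup>+\<theta>. ennreal (exp (C x)) * h x * ?k \<theta> x \<partial>\<pi>) = ennreal (exp (C x)) * h x * (\<integral>\<^sup>+\<theta>. ?k \<theta> x \<partial>\<pi>)"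
      by (intro nn_integral_cmult borel_measurable_ennreal_exp borel_measurable_diff borel_measurable_times
          borel_measurable_divide borel_measurable_const borel_measurable_dot prior_coordinate)
    then show "(\<integral>\<^sup>+\<theta>. ennreal (exp (C x)) * h x * ?k \<theta> x \<partial>\<pi>) = h x * lik A x"
      by (simp add: lik_def marginal_def mult_ac)
  qed
  finally show ?thesis ..
qed

lemma nn_integral_lik_eq_1: "(\<integral>\<^sup>+x. lik A x \<partial>noise I p) = 1"
  using nn_integral_lik[of "\<lambda>_. 1" A] prob_space.emeasure_space_1[OF prob_space_noise[of I p]]
    prob_space.emeasure_space_1[OF prob_prior] by simp

text \<open>\<open>T \<mapsto> sym_diff A T\<close> is injective, so the subsets of \<open>G\<close>
  yield \<open>2 ^ t\<close> distinct labelings, each at least as likely as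
  \<open>A\<close>.\<close>

lemma good_imp_lik_le:
  assumes "x \<in> Good A" "A \<subseteq> S"
  shows "2 ^ t * lik A x \<le> (\<Sum>B\<in>Pow S. lik B x)"
proof -
  obtain G where G: "G \<subseteq> S" "card G = t" and le: "\<And>T. T \<subseteq> G \<Longrightarrow> marginal (W A x) \<le> marginal (W (sym_diff A T) x)"
    using assms(1) by (auto simp: Good_def)
  have "finite G" using G fin_S finite_subset by metis
  then have "2 ^ t * lik A x = (\<Sum>T\<in>Pow G. lik A x)"
    by (simp add: card_Pow G)
  also have "\<dots> \<le> (\<Sum>T\<in>Pow G. lik (sym_diff A T) x)"
    unfolding lik_def using le by (intro sum_mono mult_left_mono) auto
  also have "\<dots> = (\<Sum>B\<in>(\<lambda>T. sym_diff A T) ` Pow G. lik B x)"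
    by (subst sum.reindex) (auto simp: inj_on_def)
  also have "\<dots> \<le> (\<Sum>B\<in>Pow S. lik B x)"
    using G assms(2) fin_S by (intro sum_mono2) auto
  finally show ?thesis .
qed

text \<open>When the noise is multiplied by the signs of \<open>A\<close>, which preserves its law,
  the signed data of \<open>P\<close> become \<open>\<theta> + e\<close> and \<open>A\<close>
  disappears. Hence the bad event has the same probability under every labeling.\<close>

lemma flip_obs:
  assumes "A \<subseteq> S" and e: "e \<in> space (noise I p)"
  shows "obs A \<theta> (\<lambda>i\<in>I. \<lambda>j\<in>{1..p}. sgn_of A i * e i j) \<in> Good A \<longleftrightarrow> flippable (\<lambda>i j. \<theta> j + e i j)"
proof -
  let ?x = "obs A \<theta> (\<lambda>i\<in>I. \<lambda>j\<in>{1..p}. sgn_of A i * e i j)"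
  have sp: "?x \<in> space (noise I p)"
    by (auto simp: obs_def sets_eq_imp_space_eq[OF sets_noise] space_PiM)
  have mcong: "marginal w = marginal w'" if "\<And>j. j \<in> {1..p} \<Longrightarrow> w j = w' j" for w w'
  proof -
    have "dot p \<theta> w = dot p \<theta> w'" for \<theta> by (rule dot_cong[OF refl that])
    then show ?thesis by (simp add: marginal_def)
  qed
  have x: "?x i j = sgn_of A i * (\<theta> j + e i j)" if "i \<in> P" "j \<in> {1..p}" for i j
    using that P_I by (auto simp: obs_def mean_def algebra_simps)
  have W_flip: "marginal (W (sym_diff A T) ?x) = marginal (\<lambda>j. (\<Sum>i\<in>P. \<theta> j + e i j) - 2 * (\<Sum>i\<in>T. \<theta> j + e i j))"
    if T: "T \<subseteq> S" for T
  proof (rule mcong)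
    fix j assume j: "j \<in> {1..p}"
    have "W (sym_diff A T) ?x j = (\<Sum>i\<in>P. (\<theta> j + e i j) - (if i \<in> T then 2 * (\<theta> j + e i j) else 0))"
      unfolding W_def
    proof (rule sum.cong[OF refl])
      fix i assume i: "i \<in> P"
      have "sgn_of A i * (sgn_of A i * (\<theta> j + e i j)) = \<theta> j + e i j"
        by (simp add: mult.assoc[symmetric] sgn_of_square)
      then show "sgn_of (sym_diff A T) i * ?x i j = (\<theta> j + e i j) - (if i \<in> T then 2 * (\<theta> j + e i j) else 0)"
        unfolding x[OF i j] sgn_of_flip[OF T] by (cases "i \<in> T") (simp_all only: if_True if_False mult_minus_left, simp_all)
    qed
    also have "\<dots> = (\<Sum>i\<in>P. \<theta> j + e i j) - (\<Sum>i\<in>P. if i \<in> T then 2 * (\<theta> j + e i j) else 0)"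
      by (rule sum_subtractf)
    also have "(\<Sum>i\<in>P. if i \<in> T then 2 * (\<theta> j + e i j) else 0) = (\<Sum>i\<in>T. 2 * (\<theta> j + e i j))"
      using T S_P fin_P by (simp add: sum.If_cases Int_absorb1)
    finally show "W (sym_diff A T) ?x j = (\<Sum>i\<in>P. \<theta> j + e i j) - 2 * (\<Sum>i\<in>T. \<theta> j + e i j)"
      unfolding sum_distrib_left .
  qed
  have "marginal (W A ?x) = marginal (\<lambda>j. \<Sum>i\<in>P. \<theta> j + e i j)"
    using W_flip[of "{}"] by simp
  then have iff: "(marginal (W A ?x) \<le> marginal (W (sym_diff A T) ?x)) \<longleftrightarrow>
      (marginal (\<lambda>j. \<Sum>i\<in>P. \<theta> j + e i j) \<le> marginal (\<lambda>j. (\<Sum>i\<in>P. \<theta> j + e i j) - 2 * (\<Sum>i\<in>T. \<theta> j + e i j)))"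
    if "T \<subseteq> S" for T
    using W_flip[OF that] by simp
  have "?x \<in> Good A \<longleftrightarrow> (\<exists>G. G \<subseteq> S \<and> (card G = t \<and> (\<forall>T. T \<subseteq> G \<longrightarrow> marginal (W A ?x) \<le> marginal (W (sym_diff A T) ?x))))"
    using sp by (simp add: Good_def Bex_def Ball_def conj_assoc)
  also have "\<dots> \<longleftrightarrow> flippable (\<lambda>i j. \<theta> j + e i j)"
    unfolding flippable_def by (intro ex_cong conj_cong refl all_cong iff) auto
  finally show ?thesis .
qed

text \<open>Under the uniform law on \<open>Pow S\<close>, the success probability of the estimator
  that answers \<open>A\<close> on \<open>Z A\<close> is an average of posterior probabilities. On
  \<open>Good\<close> data these are at most \<open>1 / 2 ^ t\<close>; all other data are counted in
  full.\<close>

theorem bayes_success_le: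
  assumes Z: "\<And>A. A \<in> Pow S \<Longrightarrow> Z A \<in> sets (noise I p)" and disj: "disjoint_family_on Z (Pow S)"
  shows "(\<Sum>A\<in>Pow S. \<integral>\<^sup>+\<theta>. (\<integral>\<^sup>+e. indicator (Z A) (obs A \<theta> e) \<partial>noise I p) \<partial>\<pi>)
    \<le> 2 ^ card S * (ennreal (1 / 2 ^ t)
        + (\<integral>\<^sup>+\<theta>. (\<integral>\<^sup>+e. indicator {e. \<not> flippable (\<lambda>i j. \<theta> j + e i j)} e \<partial>noise I p) \<partial>\<pi>))"
proof -
  define bad where "bad = (\<integral>\<^sup>+\<theta>. (\<integral>\<^sup>+e. indicator {e. \<not> flippable (\<lambda>i j. \<theta> j + e i j)} e \<partial>noise I p) \<partial>\<pi>)"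
  let ?B = "\<lambda>A. space (noise I p) - Good A"
  have meas: "(\<lambda>x. indicator (Z A) x * lik A x) \<in> borel_measurable (noise I p)"
    "(\<lambda>x. indicator (?B A) x * lik A x) \<in> borel_measurable (noise I p)" if "A \<in> Pow S" for A
    using Z[OF that] Good_measurable[of A] by (auto intro!: borel_measurable_times_ennreal lik_measurable borel_measurable_indicator)
  have bad_eq: "(\<integral>\<^sup>+x. indicator (?B A) x * lik A x \<partial>noise I p) = bad" if A: "A \<in> Pow S" for A
  proof -
    have "(\<integral>\<^sup>+x. indicator (?B A) x * lik A x \<partial>noise I p)
        = (\<integral>\<^sup>+\<theta>. (\<integral>\<^sup>+e. indicator (?B A) (obs A \<theta> e) \<partial>noise I p) \<partial>\<pi>)"
      using Good_measurable[of A] by (intro nn_integral_lik) auto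
    also have "\<dots> = bad"
      unfolding bad_def
    proof (rule nn_integral_cong)
      fix \<theta>
      have "obs A \<theta> \<in> noise I p \<rightarrow>\<^sub>M noise I p"
        using measurable_noise_affine[where v = "mean A \<theta>" and a = "\<lambda>_. 1" and I = I and p = p]
        unfolding obs_def[abs_def] by (simp add: measurable_cong_sets[OF refl sets_noise])
      then have m: "(\<lambda>e. indicator (?B A) (obs A \<theta> e) :: ennreal) \<in> borel_measurable (noise I p)"
        using Good_measurable[of A] by (intro measurable_compose[OF _ borel_measurable_indicator]) auto
      have "(\<integral>\<^sup>+e. indicator (?B A) (obs A \<theta> e) \<partial>noise I p)
          = (\<integral>\<^sup>+e. indicator (?B A) (obs A \<theta> (\<lambda>i\<in>I. \<lambda>j\<in>{1..p}. sgn_of A i * e i j)) \<partial>noise I p)"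
        by (rule nn_integral_noise_sign_flip[OF fin_I sgn_of_abs m, symmetric])
      also have "\<dots> = (\<integral>\<^sup>+e. indicator {e. \<not> flippable (\<lambda>i j. \<theta> j + e i j)} e \<partial>noise I p)"
      proof (rule nn_integral_cong)
        fix e assume e: "e \<in> space (noise I p)"
        have "obs A \<theta> e' \<in> space (noise I p)" for e'
          by (auto simp: obs_def sets_eq_imp_space_eq[OF sets_noise] space_PiM)
        then show "indicator (?B A) (obs A \<theta> (\<lambda>i\<in>I. \<lambda>j\<in>{1..p}. sgn_of A i * e i j))
            = (indicator {e. \<not> flippable (\<lambda>i j. \<theta> j + e i j)} e :: ennreal)"
          using flip_obs[OF _ e, of A \<theta>] A by (simp add: indicator_def)
      qed
      finally show "(\<integral>\<^sup>+e. indicator (?B A) (obs A \<theta> e) \<partial>noise I p)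
          = (\<integral>\<^sup>+e. indicator {e. \<not> flippable (\<lambda>i j. \<theta> j + e i j)} e \<partial>noise I p)" .
    qed
    finally show ?thesis .
  qed
  \<comment> \<open>At most one \<open>Z A\<close> contains \<open>x\<close>, so the left side is a
    single likelihood \<open>lik A x\<close>. If \<open>x\<close> is in \<open>Good A\<close>, the
    first summand dominates it; otherwise it occurs in the second sum.\<close>
  have pointwise: "(\<Sum>A\<in>Pow S. indicator (Z A) x * lik A x)
      \<le> ennreal (1 / 2 ^ t) * (\<Sum>B\<in>Pow S. lik B x) + (\<Sum>A\<in>Pow S. indicator (?B A) x * lik A x)"
    if x: "x \<in> space (noise I p)" for x
  proof (cases "\<exists>A\<in>Pow S. x \<in> Z A")
    case False
    then have "(\<Sum>A\<in>Pow S. indicator (Z A) x * lik A x) = 0" by (intro sum.neutral) (auto simp: indicator_def)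
    then show ?thesis by simp
  next
    case True
    then obtain A where A: "A \<in> Pow S" "x \<in> Z A" by blast
    have "indicator (Z B) x * lik B x = (if B = A then lik A x else 0)" if "B \<in> Pow S" for B
      using disj A that by (auto simp: disjoint_family_on_def indicator_def)
    then have "(\<Sum>B\<in>Pow S. indicator (Z B) x * lik B x) = (\<Sum>B\<in>Pow S. if B = A then lik A x else 0)"
      by (rule sum.cong[OF refl])
    also have "\<dots> = lik A x" using A fin_S by simp
    also have "\<dots> \<le> ennreal (1 / 2 ^ t) * (\<Sum>B\<in>Pow S. lik B x) + (\<Sum>A\<in>Pow S. indicator (?B A) x * lik A x)"
    proof (cases "x \<in> Good A")
      case True
      have "lik A x = ennreal (1 / 2 ^ t) * (2 ^ t * lik A x)"
      proof -
        have "ennreal (1 / 2 ^ t) * 2 ^ t = ennreal (1 / 2 ^ t) * ennreal (2 ^ t)"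
          by (simp flip: ennreal_power)
        also have "\<dots> = 1" by (simp add: ennreal_mult'[symmetric])
        finally show ?thesis by (simp add: mult.assoc[symmetric])
      qed
      also have "\<dots> \<le> ennreal (1 / 2 ^ t) * (\<Sum>B\<in>Pow S. lik B x)"
        using good_imp_lik_le[OF True] A by (intro mult_left_mono) auto
      finally show ?thesis by (rule order_trans) simp
    next
      case False
      then have "lik A x = indicator (?B A) x * lik A x" using x by simp
      also have "\<dots> \<le> (\<Sum>A\<in>Pow S. indicator (?B A) x * lik A x)"
        using A fin_S by (intro member_le_sum) auto
      finally show ?thesis by (rule order_trans) simp
    qed
    finally show ?thesis .
  qed
  have "(\<Sum>A\<in>Pow S. \<integral>\<^sup>+\<theta>. (\<integral>\<^sup>+e. indicator (Z A) (obs A \<theta> e) \<partial>noise I p) \<partial>\<pi>)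
      = (\<Sum>A\<in>Pow S. \<integral>\<^sup>+x. indicator (Z A) x * lik A x \<partial>noise I p)"
    using Z by (intro sum.cong refl nn_integral_lik[symmetric]) auto
  also have "\<dots> = (\<integral>\<^sup>+x. (\<Sum>A\<in>Pow S. indicator (Z A) x * lik A x) \<partial>noise I p)"
    using meas(1) by (rule nn_integral_sum[symmetric])
  also have "\<dots> \<le> (\<integral>\<^sup>+x. ennreal (1 / 2 ^ t) * (\<Sum>B\<in>Pow S. lik B x) + (\<Sum>A\<in>Pow S. indicator (?B A) x * lik A x) \<partial>noise I p)"
    by (intro nn_integral_mono pointwise)
  also have "\<dots> = ennreal (1 / 2 ^ t) * (\<Sum>B\<in>Pow S. \<integral>\<^sup>+x. lik B x \<partial>noise I p)
      + (\<Sum>A\<in>Pow S. \<integral>\<^sup>+x. indicator (?B A) x * lik A x \<partial>noise I p)"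
  proof -
    have lik_sum: "(\<lambda>x. \<Sum>B\<in>Pow S. lik B x) \<in> borel_measurable (noise I p)"
      by (intro borel_measurable_sum lik_measurable)
    have bad_sum: "(\<lambda>x. \<Sum>A\<in>Pow S. indicator (?B A) x * lik A x) \<in> borel_measurable (noise I p)"
      by (rule borel_measurable_sum) (rule meas(2))
    have split: "(\<integral>\<^sup>+x. (\<Sum>A\<in>Pow S. indicator (?B A) x * lik A x) \<partial>noise I p)
        = (\<Sum>A\<in>Pow S. \<integral>\<^sup>+x. indicator (?B A) x * lik A x \<partial>noise I p)"
      by (rule nn_integral_sum) (rule meas(2))
    show ?thesis
      unfolding nn_integral_add[OF borel_measurable_times_ennreal[OF borel_measurable_const lik_sum] bad_sum]
        nn_integral_cmult[OF lik_sum] nn_integral_sum[OF lik_measurable] split ..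
  qed
  also have "(\<Sum>B\<in>Pow S. \<integral>\<^sup>+x. lik B x \<partial>noise I p) = 2 ^ card S"
    unfolding nn_integral_lik_eq_1 using fin_S by (simp add: card_Pow)
  also have "(\<Sum>A\<in>Pow S. \<integral>\<^sup>+x. indicator (?B A) x * lik A x \<partial>noise I p) = (\<Sum>A\<in>Pow S. bad)"
    by (rule sum.cong[OF refl bad_eq])
  also have "\<dots> = 2 ^ card S * bad"
    using fin_S by (simp add: card_Pow)
  also have "ennreal (1 / 2 ^ t) * 2 ^ card S + 2 ^ card S * bad = 2 ^ card S * (ennreal (1 / 2 ^ t) + bad)"
    by (simp add: distrib_left mult.commute)
  finally show ?thesis by (simp add: bad_def)
qed

end

section \<open>Success on a large part of the labelings, and flippability under the two
  priors\<close>

context sign_mixture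
begin

text \<open>Success is assumed only for labelings in \<open>\<A>\<close> and centers in
  \<open>T0\<close>, since only these parameters are meant to lie in the parameter space. Having at
  least half of \<open>Pow S\<close> in \<open>\<A>\<close> gives the factor 2; the centers outside
  \<open>T0\<close> give \<open>\<beta>'\<close>.\<close>

lemma success_le:
  fixes Hc :: "nat set \<Rightarrow> 'h" and \<epsilon> \<beta> \<beta>' :: real
  assumes Z: "\<And>A. A \<subseteq> S \<Longrightarrow> {x \<in> space (noise I p). est x = Hc A} \<in> sets (noise I p)"
    and inj: "inj_on Hc (Pow S)"
    and AA: "\<A> \<subseteq> Pow S" "2 ^ card S \<le> 2 * card \<A>"
    and T0: "T0 \<in> sets \<pi>" "measure \<pi> T0 \<ge> 1 - \<beta>'" and pos: "0 \<le> \<epsilon>" "0 \<le> \<beta>" "0 \<le> \<beta>'"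
    and bad: "\<And>\<theta>. \<theta> \<in> T0 \<Longrightarrow> unlikely (noise I p) (\<lambda>e. \<not> flippable (\<lambda>i j. \<theta> j + e i j)) \<beta>"
    and succ: "\<And>A \<theta>. A \<in> \<A> \<Longrightarrow> \<theta> \<in> T0 \<Longrightarrow> \<epsilon> \<le> measure (noise I p) {e \<in> space (noise I p). est (obs A \<theta> e) = Hc A}"
  shows "\<epsilon> * (1 - \<beta>') \<le> 2 * (1 / 2 ^ t + \<beta> + \<beta>')"
proof -
  interpret N: prob_space "noise I p" by (rule prob_space_noise)
  interpret Pr: prob_space \<pi> by (rule prob_prior)
  define Z where "Z A = {x \<in> space (noise I p). est x = Hc A}" for A
  define bd where "bd = (\<integral>\<^sup>+\<theta>. (\<integral>\<^sup>+e. indicator {e. \<not> flippable (\<lambda>i j. \<theta> j + e i j)} e \<partial>noise I p) \<partial>\<pi>)"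
  have disj: "disjoint_family_on Z (Pow S)"
    using inj_on_eq_iff[OF inj] by (auto simp: disjoint_family_on_def Z_def)
  have obs_space: "obs A \<theta> e \<in> space (noise I p)" for A \<theta> e
    by (auto simp: obs_def sets_eq_imp_space_eq[OF sets_noise] space_PiM)
  have obs_meas: "obs A \<theta> \<in> noise I p \<rightarrow>\<^sub>M noise I p" for A \<theta>
    using measurable_noise_affine[where v = "mean A \<theta>" and a = "\<lambda>_. 1" and I = I and p = p]
    unfolding obs_def[abs_def] by (simp add: measurable_cong_sets[OF refl sets_noise])
  have bd_le: "bd \<le> ennreal (\<beta> + \<beta>')"
  proof -
    \<comment> \<open>A center outside \<open>T0\<close> is charged the trivial bound 1.\<close>
    have "(\<integral>\<^sup>+e. indicator {e. \<not> flippable (\<lambda>i j. \<theta> j + e i j)} e \<partial>noise I p)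
        \<le> ennreal \<beta> + indicator (space \<pi> - T0) \<theta>" if \<theta>: "\<theta> \<in> space \<pi>" for \<theta>
    proof (cases "\<theta> \<in> T0")
      case True
      obtain E where E: "E \<in> sets (noise I p)" "measure (noise I p) E \<le> \<beta>"
        "{e \<in> space (noise I p). \<not> flippable (\<lambda>i j. \<theta> j + e i j)} \<subseteq> E"
        using bad[OF True] by (auto simp: unlikely_def)
      have "(\<integral>\<^sup>+e. indicator {e. \<not> flippable (\<lambda>i j. \<theta> j + e i j)} e \<partial>noise I p) \<le> (\<integral>\<^sup>+e. indicator E e \<partial>noise I p)"
        using E(3) by (intro nn_integral_mono) (auto simp: indicator_def)
      also have "\<dots> \<le> ennreal \<beta>"
        using E by (simp add: N.emeasure_eq_measure ennreal_leI)
      finally show ?thesis by (simp add: True)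
    next
      case False
      have "(\<integral>\<^sup>+e. indicator {e. \<not> flippable (\<lambda>i j. \<theta> j + e i j)} e \<partial>noise I p) \<le> (\<integral>\<^sup>+e. 1 \<partial>noise I p)"
        by (intro nn_integral_mono) (auto simp: indicator_def)
      also have "\<dots> = 1" by (simp add: N.emeasure_space_1)
      finally show ?thesis using False \<theta> by (simp add: add_increasing)
    qed
    then have "bd \<le> (\<integral>\<^sup>+\<theta>. ennreal \<beta> + indicator (space \<pi> - T0) \<theta> \<partial>\<pi>)"
      unfolding bd_def by (rule nn_integral_mono)
    also have "\<dots> = ennreal \<beta> + emeasure \<pi> (space \<pi> - T0)"
      using T0 by (subst nn_integral_add) (auto simp: Pr.emeasure_space_1)
    also have "\<dots> \<le> ennreal \<beta> + ennreal \<beta>'"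
      using T0 by (intro add_left_mono) (auto simp: Pr.emeasure_eq_measure Pr.prob_compl intro!: ennreal_leI)
    also have "\<dots> = ennreal (\<beta> + \<beta>')" using pos by simp
    finally show ?thesis .
  qed
  have "ennreal (card \<A> * (\<epsilon> * (1 - \<beta>'))) \<le> (\<Sum>A\<in>\<A>. \<integral>\<^sup>+\<theta>. (\<integral>\<^sup>+e. indicator (Z A) (obs A \<theta> e) \<partial>noise I p) \<partial>\<pi>)"
  proof -
    have one: "ennreal (\<epsilon> * (1 - \<beta>')) \<le> (\<integral>\<^sup>+\<theta>. (\<integral>\<^sup>+e. indicator (Z A) (obs A \<theta> e) \<partial>noise I p) \<partial>\<pi>)" if A: "A \<in> \<A>" for A
    proof -
      have "\<epsilon> * (1 - \<beta>') \<le> \<epsilon> * measure \<pi> T0" using T0 pos by (intro mult_left_mono) auto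
      then have "ennreal (\<epsilon> * (1 - \<beta>')) \<le> ennreal (\<epsilon> * measure \<pi> T0)" by (rule ennreal_leI)
      also have "\<dots> = (\<integral>\<^sup>+\<theta>. ennreal \<epsilon> * indicator T0 \<theta> \<partial>\<pi>)"
        using T0 pos by (simp add: nn_integral_cmult_indicator Pr.emeasure_eq_measure ennreal_mult')
      also have "\<dots> \<le> (\<integral>\<^sup>+\<theta>. (\<integral>\<^sup>+e. indicator (Z A) (obs A \<theta> e) \<partial>noise I p) \<partial>\<pi>)"
      proof (rule nn_integral_mono)
        fix \<theta>
        show "ennreal \<epsilon> * indicator T0 \<theta> \<le> (\<integral>\<^sup>+e. indicator (Z A) (obs A \<theta> e) \<partial>noise I p)"
        proof (cases "\<theta> \<in> T0")
          case True
          have ZA: "Z A \<in> sets (noise I p)" using Z A AA unfolding Z_def by auto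
          have "obs A \<theta> -` Z A \<inter> space (noise I p) \<in> sets (noise I p)"
            by (rule measurable_sets[OF obs_meas ZA])
          moreover have eq: "obs A \<theta> -` Z A \<inter> space (noise I p) = {e \<in> space (noise I p). est (obs A \<theta> e) = Hc A}"
            using obs_space by (auto simp: Z_def)
          ultimately have m: "{e \<in> space (noise I p). est (obs A \<theta> e) = Hc A} \<in> sets (noise I p)" by simp
          have "(\<integral>\<^sup>+e. indicator (Z A) (obs A \<theta> e) \<partial>noise I p)
              = (\<integral>\<^sup>+e. indicator {e \<in> space (noise I p). est (obs A \<theta> e) = Hc A} e \<partial>noise I p)"
            using obs_space by (intro nn_integral_cong) (auto simp: Z_def indicator_def)
          also have "\<dots> = ennreal (measure (noise I p) {e \<in> space (noise I p). est (obs A \<theta> e) = Hc A})"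
            using m by (simp add: N.emeasure_eq_measure)
          finally show ?thesis using succ[OF A True] True by (simp add: ennreal_leI)
        qed simp
      qed
      finally show ?thesis .
    qed
    have "ennreal (card \<A> * (\<epsilon> * (1 - \<beta>'))) = (\<Sum>A\<in>\<A>. ennreal (\<epsilon> * (1 - \<beta>')))"
      by (simp add: ennreal_mult' ennreal_of_nat_eq_real_of_nat)
    also have "\<dots> \<le> (\<Sum>A\<in>\<A>. \<integral>\<^sup>+\<theta>. (\<integral>\<^sup>+e. indicator (Z A) (obs A \<theta> e) \<partial>noise I p) \<partial>\<pi>)"
      by (rule sum_mono) (rule one)
    finally show ?thesis .
  qed
  also have "\<dots> \<le> (\<Sum>A\<in>Pow S. \<integral>\<^sup>+\<theta>. (\<integral>\<^sup>+e. indicator (Z A) (obs A \<theta> e) \<partial>noise I p) \<partial>\<pi>)"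
    using AA fin_S by (intro sum_mono2) auto
  also have "\<dots> \<le> 2 ^ card S * (ennreal (1 / 2 ^ t) + bd)"
    unfolding bd_def by (rule bayes_success_le[OF _ disj]) (use Z in \<open>auto simp: Z_def\<close>)
  also have "\<dots> \<le> 2 ^ card S * (ennreal (1 / 2 ^ t) + ennreal (\<beta> + \<beta>'))"
    by (intro mult_left_mono add_left_mono bd_le) simp
  also have "\<dots> = ennreal (2 ^ card S * (1 / 2 ^ t + (\<beta> + \<beta>')))"
    using pos by (simp add: ennreal_mult'' ennreal_power[symmetric] flip: ennreal_plus)
  finally have le: "card \<A> * (\<epsilon> * (1 - \<beta>')) \<le> 2 ^ card S * (1 / 2 ^ t + (\<beta> + \<beta>'))"
    using pos by (subst (asm) ennreal_le_iff) auto
  show ?thesis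
  \<comment> \<open>The lower bound on \<open>card \<A>\<close> can be inserted only in front of a
    nonnegative factor; for a negative one the claim is trivial.\<close>
  proof (cases "\<epsilon> * (1 - \<beta>') \<ge> 0")
    case True
    have c2: "2 ^ card S \<le> 2 * real (card \<A>)"
      using AA(2) by (metis of_nat_le_iff of_nat_mult of_nat_numeral of_nat_power)
    have "2 ^ card S * (\<epsilon> * (1 - \<beta>')) \<le> 2 * real (card \<A>) * (\<epsilon> * (1 - \<beta>'))"
      using True c2 by (rule mult_right_mono[rotated])
    also have "\<dots> \<le> 2 ^ card S * (2 * (1 / 2 ^ t + \<beta> + \<beta>'))" using le by (simp add: algebra_simps)
    finally show ?thesis by (subst (asm) mult_le_cancel_left_pos) auto
  next
    case False
    moreover have "0 \<le> 2 * (1 / 2 ^ t + \<beta> + \<beta>')" using pos by simp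
    ultimately show ?thesis by linarith
  qed
qed

text \<open>For a known center the log-likelihood is linear in the data. The effects of several
  switches add up without interaction, and a condition on each point of \<open>G\<close>
  suffices.\<close>

lemma flippable_point_prior:
  assumes prior: "\<pi> = return (vectors p) \<theta>" and \<theta>: "\<theta> \<in> extensional {1..p}"
    and G: "G \<subseteq> S" "card G = t" and le: "\<And>i. i \<in> G \<Longrightarrow> dot p (y i) \<theta> \<le> 0"
  shows "flippable y"
proof -
  have marginal: "marginal w = ennreal (exp (dot p \<theta> w - card P * sq p \<theta> / 2))" for w
  proof -
    have "(\<lambda>\<theta>. ennreal (exp (dot p \<theta> w - card P * sq p \<theta> / 2))) \<in> borel_measurable \<pi>"
      by (intro borel_measurable_ennreal_exp borel_measurable_diff borel_measurable_times
          borel_measurable_divide borel_measurable_const borel_measurable_dot prior_coordinate)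
    moreover have "\<theta> \<in> space (Pi\<^sub>M {1..p} (\<lambda>_. borel :: real measure))" using \<theta> by (simp add: space_PiM PiE_def)
    ultimately show ?thesis
      unfolding marginal_def unfolding prior by (intro nn_integral_return) simp_all
  qed
  have "dot p \<theta> (\<lambda>j. \<Sum>i\<in>P. y i j) \<le> dot p \<theta> (\<lambda>j. (\<Sum>i\<in>P. y i j) - 2 * (\<Sum>i\<in>T. y i j))" if "T \<subseteq> G" for T
  proof -
    have "(\<Sum>i\<in>T. dot p \<theta> (y i)) \<le> 0"
      using that le by (intro sum_nonpos) (auto simp: dot_commute)
    then show ?thesis unfolding dot_diff_right dot_scale_right dot_sum_right by simp
  qed
  then show ?thesis
    unfolding flippable_def marginal using G by (intro exI[of _ G]) (auto intro!: ennreal_leI)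
qed

text \<open>The marginal likelihood is an increasing function of the quadratic
  \<open>sq p w\<close>. Switches therefore interact, and the hypothesis has to range over the
  subsets \<open>T\<close> of \<open>G\<close>.\<close>

lemma flippable_gaussian_prior:
  assumes prior: "\<pi> = isotropic_gaussian p \<tau>" and \<tau>: "\<tau> > 0" and R: "R = P - S"
    and G: "G \<subseteq> S" "card G = t"
    and le: "\<And>T. T \<subseteq> G \<Longrightarrow> dot p (\<lambda>j. \<Sum>i\<in>T. y i j) (\<lambda>j. (\<Sum>k\<in>R. y k j) + (\<Sum>k\<in>S-T. y k j)) \<le> 0"
  shows "flippable y"
proof -
  define c where "c = card P * \<tau>\<^sup>2"
  have c: "c \<ge> 0" by (simp add: c_def)
  have marginal: "marginal w = ennreal (exp (\<tau>\<^sup>2 / (2 * (1 + c)) * sq p w) / sqrt (1 + c) ^ p)" for w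
  proof -
    let ?f = "\<lambda>\<theta>. ennreal (exp (dot p \<theta> w - card P * sq p \<theta> / 2))"
    let ?B = "vectors p"
    have f: "?f \<in> borel_measurable ?B"
      by (intro borel_measurable_ennreal_exp borel_measurable_diff borel_measurable_times
          borel_measurable_divide borel_measurable_const borel_measurable_dot measurable_component_singleton)
    have g: "(\<lambda>x. \<lambda>j\<in>{1..p}. \<tau> * x j) \<in> gauss p \<rightarrow>\<^sub>M ?B"
      by (intro measurable_restrict borel_measurable_times borel_measurable_const measurable_isotropic_gaussian_coordinate)
    have "marginal w = integral\<^sup>N (distr (gauss p) ?B (\<lambda>x. \<lambda>j\<in>{1..p}. \<tau> * x j)) ?f"
      unfolding marginal_def unfolding prior using distr_gauss_scale[of \<tau> \<tau> p] \<tau> by simp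
    also have "\<dots> = (\<integral>\<^sup>+x. ?f (\<lambda>j\<in>{1..p}. \<tau> * x j) \<partial>gauss p)"
      by (subst nn_integral_distr[OF g]) (use f in simp_all)
    \<comment> \<open>In terms of a standard normal \<open>x\<close> with
      \<open>\<theta> = \<tau> * x\<close>, the exponent has quadratic coefficient
      \<open>- c / 2\<close>, and the one-coordinate formula applies.\<close>
    also have "\<dots> = (\<integral>\<^sup>+x. ennreal (exp (\<Sum>j\<in>{1..p}. 0 + (\<tau> * w j) * x j + (- c / 2) * (x j)\<^sup>2)) \<partial>gauss p)"
    proof (intro nn_integral_cong arg_cong[where f = "\<lambda>x. ennreal (exp x)"])
      fix x :: "nat \<Rightarrow> real"
      have "dot p (\<lambda>j\<in>{1..p}. \<tau> * x j) w = (\<Sum>j\<in>{1..p}. (\<tau> * w j) * x j)"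
        "card P * sq p (\<lambda>j\<in>{1..p}. \<tau> * x j) / 2 = (\<Sum>j\<in>{1..p}. (c / 2) * (x j)\<^sup>2)"
        unfolding dot_def sum_distrib_left sum_divide_distrib
        by (auto intro!: sum.cong simp: c_def power2_eq_square)
      then show "dot p (\<lambda>j\<in>{1..p}. \<tau> * x j) w - card P * sq p (\<lambda>j\<in>{1..p}. \<tau> * x j) / 2
        = (\<Sum>j\<in>{1..p}. 0 + (\<tau> * w j) * x j + (- c / 2) * (x j)\<^sup>2)"
        by (simp only:) (simp add: sum_subtractf)
    qed
    also have "\<dots> = ennreal (exp (\<Sum>j\<in>{1..p}. 0 + (\<tau> * w j)\<^sup>2 / (2 * (1 - 2 * (- c / 2)))) / sqrt (1 - 2 * (- c / 2)) ^ p)"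
      by (rule nn_integral_gauss_exp_quadratic) (use c in simp)
    also have "(\<Sum>j\<in>{1..p}. 0 + (\<tau> * w j)\<^sup>2 / (2 * (1 - 2 * (- c / 2)))) = \<tau>\<^sup>2 / (2 * (1 + c)) * sq p w"
      unfolding dot_def sum_distrib_left by (intro sum.cong refl) (simp add: power2_eq_square)
    finally show ?thesis by simp
  qed
  have mono: "marginal w \<le> marginal w'" if "sq p w \<le> sq p w'" for w w'
  proof -
    have "\<tau>\<^sup>2 / (2 * (1 + c)) * sq p w \<le> \<tau>\<^sup>2 / (2 * (1 + c)) * sq p w'"
      using c by (intro mult_left_mono that) simp
    then show ?thesis
      unfolding marginal using c by (intro ennreal_leI divide_right_mono) (simp_all only: exp_le_cancel_iff, simp)
  qed
  \<comment> \<open>\<open>\<bar>z - v\<bar>\<^sup>2 - \<bar>z + v\<bar>\<^sup>2 = - 4 z\<cdot>v\<close>, where \<open>v\<close> is the sum over \<open>T\<close> and \<open>z\<close> that over the rest of \<open>P\<close>\<close>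
  have "sq p (\<lambda>j. \<Sum>i\<in>P. y i j)
      \<le> sq p (\<lambda>j. (\<Sum>i\<in>P. y i j) - 2 * (\<Sum>i\<in>T. y i j))"
    (is "sq p ?w \<le> sq p ?w'") if T: "T \<subseteq> G" for T
  proof -
    define v where "v j = (\<Sum>i\<in>T. y i j)" for j
    define z where "z j = (\<Sum>k\<in>R. y k j) + (\<Sum>k\<in>S-T. y k j)" for j
    have w: "?w = (\<lambda>j. z j + v j)"
    proof
      fix j
      have "(\<Sum>i\<in>P. y i j) = (\<Sum>i\<in>R. y i j) + (\<Sum>i\<in>S. y i j)"
        unfolding R using sum.subset_diff[OF S_P fin_P] by simp
      moreover have "(\<Sum>i\<in>S. y i j) = (\<Sum>i\<in>S-T. y i j) + (\<Sum>i\<in>T. y i j)"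
        using T G fin_S by (intro sum.subset_diff) auto
      ultimately show "?w j = z j + v j" by (simp add: z_def v_def)
    qed
    have w': "?w' = (\<lambda>j. z j - v j)"
      using fun_cong[OF w] by (intro ext) (simp add: v_def)
    have "dot p v z \<le> 0" using le[OF T] by (simp add: v_def[abs_def] z_def[abs_def])
    then show ?thesis unfolding w w' by (simp add: dot_simps dot_commute[of p z v])
  qed
  then show ?thesis
    unfolding flippable_def using G by (intro exI[of _ G]) (auto intro!: mono)
qed

end

section \<open>Concentration of the norm of the Gaussian prior\<close>

lemma unlikely_gauss_norm:
  assumes g: "0 < g" "g < 1"
  shows "unlikely (gauss p) (\<lambda>x. sq p x < (1 - g) * p \<or> (1 + g) * p < sq p x) (2 * exp (- (g\<^sup>2 * p / 16)))"
proof -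
  have fin: "finite_measure (gauss p)"
    by (rule prob_space.finite_measure, rule prob_space_isotropic_gaussian) simp
  have int: "(\<integral>\<^sup>+x. ennreal (exp (l * sq p x)) \<partial>gauss p) = ennreal (1 / sqrt (1 - 2 * l) ^ p)"
    if "2 * l < 1" for l :: real
    using nn_integral_gauss_exp_square[of l 1 p "\<lambda>_. 0"] that by (simp add: dot_def)
  have meas: "(\<lambda>x. l * sq p x) \<in> borel_measurable (gauss p)" for l
    by (intro borel_measurable_times borel_measurable_const borel_measurable_dot measurable_isotropic_gaussian_coordinate)
  \<comment> \<open>Minimizes \<open>2 * y^2 - g * y\<close>, which governs the upper tail. The
    lower tail then has the exponent 3/32 instead of 1/16, more than enough.\<close>
  define y where "y = g / 4"
  have y: "0 < y" "y \<le> 1/2" using g by (auto simp: y_def)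
  have upper: "unlikely (gauss p) (\<lambda>x. (1 + g) * p < sq p x) (exp (- (g\<^sup>2 * p / 16)))"
  proof -
    have "unlikely (gauss p) (\<lambda>x. (y / 2) * ((1 + g) * p) \<le> (y / 2) * sq p x)
        (exp (- ((y / 2) * ((1 + g) * p))) * (1 / sqrt (1 - y) ^ p))"
      by (rule unlikely_chernoff[OF fin meas]) (use int[of "y / 2"] y in auto)
    then show ?thesis
    proof (rule unlikely_mono)
      have "1 / sqrt (1 - y) ^ p \<le> 1 / exp (- (p * (y + 2 * y\<^sup>2) / 2))"
        using y by (intro divide_left_mono exp_le_sqrt_one_minus_power) auto
      then have "exp (- ((y / 2) * ((1 + g) * p))) * (1 / sqrt (1 - y) ^ p)
          \<le> exp (- ((y / 2) * ((1 + g) * p))) * exp (p * (y + 2 * y\<^sup>2) / 2)"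
        by (intro mult_left_mono) (auto simp: exp_minus field_simps)
      also have "\<dots> = exp (- (g\<^sup>2 * p / 16))"
        by (simp add: mult_exp_exp y_def power2_eq_square field_simps)
      finally show "exp (- ((y / 2) * ((1 + g) * p))) * (1 / sqrt (1 - y) ^ p) \<le> exp (- (g\<^sup>2 * p / 16))" .
    qed (use y in auto)
  qed
  have lower: "unlikely (gauss p) (\<lambda>x. sq p x < (1 - g) * p) (exp (- (g\<^sup>2 * p / 16)))"
  proof -
    have "unlikely (gauss p) (\<lambda>x. (- y / 2) * ((1 - g) * p) \<le> (- y / 2) * sq p x)
        (exp (- ((- y / 2) * ((1 - g) * p))) * (1 / sqrt (1 + y) ^ p))"
      by (rule unlikely_chernoff[OF fin meas]) (use int[of "- y / 2"] y in auto)
    then show ?thesis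
    proof (rule unlikely_mono)
      have "1 / sqrt (1 + y) ^ p \<le> 1 / exp (p * (y - y\<^sup>2) / 2)"
        using y by (intro divide_left_mono exp_le_sqrt_one_plus_power) auto
      then have "exp (- ((- y / 2) * ((1 - g) * p))) * (1 / sqrt (1 + y) ^ p)
          \<le> exp (- ((- y / 2) * ((1 - g) * p))) * exp (- (p * (y - y\<^sup>2) / 2))"
        by (intro mult_left_mono) (auto simp: exp_minus field_simps)
      also have "\<dots> = exp (- (3 * g\<^sup>2 * p / 32))"
        by (simp add: mult_exp_exp y_def power2_eq_square field_simps)
      also have "\<dots> \<le> exp (- (g\<^sup>2 * p / 16))" by simp
      finally show "exp (- ((- y / 2) * ((1 - g) * p))) * (1 / sqrt (1 + y) ^ p) \<le> exp (- (g\<^sup>2 * p / 16))" .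
    qed (use y in auto)
  qed
  show ?thesis
    by (rule unlikely_mono[OF unlikely_disj[OF fin lower upper]]) auto
qed

lemma isotropic_gaussian_norm:
  fixes p :: nat and g \<tau> :: real
  assumes g: "0 < g" "g < 1" and \<tau>: "\<tau> > 0"
  defines "T0 \<equiv> {\<theta> \<in> space (isotropic_gaussian p \<tau>). (1 - g) * (\<tau>\<^sup>2 * p) \<le> sq p \<theta> \<and> sq p \<theta> \<le> (1 + g) * (\<tau>\<^sup>2 * p)}"
  shows "T0 \<in> sets (isotropic_gaussian p \<tau>)"
    and "1 - 2 * exp (- (g\<^sup>2 * p / 16)) \<le> measure (isotropic_gaussian p \<tau>) T0"
proof -
  let ?G = "gauss p" and ?B = "vectors p"
  interpret G: prob_space ?G by (rule prob_space_isotropic_gaussian) simp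
  have m1: "(\<lambda>\<theta>. sq p \<theta>) \<in> borel_measurable (isotropic_gaussian p s)" for s
    by (intro borel_measurable_dot measurable_isotropic_gaussian_coordinate)
  show T0: "T0 \<in> sets (isotropic_gaussian p \<tau>)"
    unfolding T0_def using m1[of \<tau>] by measurable
  define E where "E = {x \<in> space ?G. sq p x < (1 - g) * p \<or> (1 + g) * p < sq p x}"
  have E: "E \<in> sets ?G" unfolding E_def using m1[of 1] by measurable
  have sp: "space (isotropic_gaussian p s) = space ?B" for s
    by (rule sets_eq_imp_space_eq[OF sets_isotropic_gaussian])
  have meas: "(\<lambda>x. \<lambda>j\<in>{1..p}. \<tau> * x j) \<in> ?G \<rightarrow>\<^sub>M ?B"
    by (intro measurable_restrict borel_measurable_times borel_measurable_const measurable_isotropic_gaussian_coordinate)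
  have eq: "sq p (\<lambda>j\<in>{1..p}. \<tau> * x j) = \<tau>\<^sup>2 * sq p x" for x
    unfolding dot_def sum_distrib_left by (intro sum.cong refl) (simp add: power2_eq_square)
  have "measure (isotropic_gaussian p \<tau>) T0 = measure (distr ?G ?B (\<lambda>x. \<lambda>j\<in>{1..p}. \<tau> * x j)) T0"
    using distr_gauss_scale[of \<tau> \<tau> p] \<tau> by simp
  also have "\<dots> = measure ?G ((\<lambda>x. \<lambda>j\<in>{1..p}. \<tau> * x j) -` T0 \<inter> space ?G)"
    using T0 by (intro measure_distr meas) (simp add: sets_isotropic_gaussian)
  also have "(\<lambda>x. \<lambda>j\<in>{1..p}. \<tau> * x j) -` T0 \<inter> space ?G = space ?G - E"
  proof -
    have "(1 - g) * (\<tau>\<^sup>2 * p) = \<tau>\<^sup>2 * ((1 - g) * p)" "(1 + g) * (\<tau>\<^sup>2 * p) = \<tau>\<^sup>2 * ((1 + g) * p)" by simp_all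
    then have "(\<lambda>j\<in>{1..p}. \<tau> * x j) \<in> T0 \<longleftrightarrow> (1 - g) * p \<le> sq p x \<and> sq p x \<le> (1 + g) * p" for x
      unfolding T0_def mem_Collect_eq eq sp using \<tau> by (simp only: mult_le_cancel_left_pos zero_less_power) (simp add: space_PiM)
    then show ?thesis by (auto simp: E_def)
  qed
  also have "measure ?G (space ?G - E) = 1 - measure ?G E" using E by (rule G.prob_compl)
  finally show "1 - 2 * exp (- (g\<^sup>2 * p / 16)) \<le> measure (isotropic_gaussian p \<tau>) T0"
    using unlikely_measure_le[OF G.finite_measure unlikely_gauss_norm[OF g]] E by (simp add: E_def)
qed

subsection \<open>Label configurations in the parameter space\<close>

definition label_matrix :: "nat \<Rightarrow> nat \<Rightarrow> (nat \<Rightarrow> nat) \<Rightarrow> nat \<Rightarrow> nat \<Rightarrow> nat" where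
  "label_matrix n K lab = (\<lambda>i\<in>{1..n}. \<lambda>k\<in>{1..K}. if lab i = k then 1 else 0)"

text \<open>The centers \<open>c\<close> are measured in units of \<open>\<sigma>\<close>, so that
  the analysis can be done with standard normal noise.\<close>

definition scaled_centers :: "nat \<Rightarrow> nat \<Rightarrow> real \<Rightarrow> (nat \<Rightarrow> nat \<Rightarrow> real) \<Rightarrow> nat \<Rightarrow> nat \<Rightarrow> real" where
  "scaled_centers K p \<sigma> c = (\<lambda>k\<in>{1..K}. \<lambda>j\<in>{1..p}. \<sigma> * c k j)"

lemma label_matrix_binary: "label_matrix n K lab \<in> binary_matrices n K"
  by (auto simp: label_matrix_def binary_matrices_def)

lemma sum_label_matrix:
  fixes f :: "nat \<Rightarrow> real"
  assumes "i \<in> {1..n}" "lab i \<in> {1..K}"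
  shows "(\<Sum>k\<in>{1..K}. real (label_matrix n K lab i k) * f k) = f (lab i)"
proof -
  have "(\<Sum>k\<in>{1..K}. real (label_matrix n K lab i k) * f k) = (\<Sum>k\<in>{1..K}. if lab i = k then f k else 0)"
    using assms by (intro sum.cong refl) (simp add: label_matrix_def)
  also have "\<dots> = f (lab i)" using assms by simp
  finally show ?thesis .
qed

lemma L2_set_eq_sqrt_dot: "L2_set v {1..p} = sqrt (sq p v)"
  by (simp add: L2_set_def dot_def power2_eq_square)

lemma label_matrix_in_Theta:
  assumes lab: "\<And>i. i \<in> {1..n} \<Longrightarrow> lab i \<in> {1..K}" and \<sigma>: "\<sigma> > 0"
    and size: "\<And>k. k \<in> {1..K} \<Longrightarrow> \<bar>real (card {i\<in>{1..n}. lab i = k}) - n / K\<bar> \<le> delta_n C n K * (n / K)"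
    and sep: "\<And>k l. k \<in> {1..K} \<Longrightarrow> l \<in> {1..K} \<Longrightarrow> k \<noteq> l \<Longrightarrow> \<Delta> / \<sigma> \<le> L2_set (\<lambda>j. c k j - c l j) {1..p}"
  shows "(label_matrix n K lab, scaled_centers K p \<sigma> c) \<in> Theta C n K p \<Delta>"
proof -
  have row: "(\<Sum>k\<in>{1..K}. label_matrix n K lab i k) = 1" if "i \<in> {1..n}" for i
  proof -
    have "real (\<Sum>k\<in>{1..K}. label_matrix n K lab i k) = 1"
      using sum_label_matrix[of i n lab K "\<lambda>_. 1"] that lab by simp
    then show ?thesis by (simp only: of_nat_eq_1_iff)
  qed
  have sz: "cluster_size n (label_matrix n K lab) k = card {i\<in>{1..n}. lab i = k}" if "k \<in> {1..K}" for k
  proof -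
    have "cluster_size n (label_matrix n K lab) k = (\<Sum>i\<in>{1..n}. if lab i = k then 1 else 0)"
      unfolding cluster_size_def using that by (intro sum.cong refl) (simp add: label_matrix_def)
    also have "\<dots> = card {i\<in>{1..n}. lab i = k}" by (simp add: sum.If_cases Int_def)
    finally show ?thesis .
  qed
  have "\<Delta> \<le> L2_set (\<lambda>j. scaled_centers K p \<sigma> c k j - scaled_centers K p \<sigma> c l j) {1..p}"
    if "k \<in> {1..K}" "l \<in> {1..K}" "k \<noteq> l" for k l
  proof -
    have "L2_set (\<lambda>j. scaled_centers K p \<sigma> c k j - scaled_centers K p \<sigma> c l j) {1..p}
        = L2_set (\<lambda>j. \<sigma> * (c k j - c l j)) {1..p}"
      using that by (intro L2_set_cong refl) (simp add: scaled_centers_def algebra_simps)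
    also have "\<dots> = \<sigma> * L2_set (\<lambda>j. c k j - c l j) {1..p}"
      using \<sigma> by (simp add: L2_set_right_distrib)
    finally show ?thesis using sep[OF that] \<sigma> by (simp add: field_simps)
  qed
  moreover have "real (cluster_size n (label_matrix n K lab) k) \<in>
      {(1 - delta_n C n K) * (n / K) .. (1 + delta_n C n K) * (n / K)}" if "k \<in> {1..K}" for k
    using size[OF that] unfolding sz[OF that] abs_le_iff atLeastAtMost_iff left_diff_distrib distrib_right by linarith
  moreover have "scaled_centers K p \<sigma> c \<in> ({1..K} \<rightarrow>\<^sub>E {1..p} \<rightarrow>\<^sub>E UNIV)"
    by (auto simp: scaled_centers_def)
  ultimately show ?thesis
    unfolding Theta_def using label_matrix_binary row by simp
qed

lemma measurable_rescale:
  "(\<lambda>x. \<lambda>i\<in>{1..n}. \<lambda>j\<in>{1..p}. \<sigma> * x i j) \<in> noise {1..n} p \<rightarrow>\<^sub>M data_space n p"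
  using measurable_noise_affine[where v = "\<lambda>_ _. 0" and a = "\<lambda>_. \<sigma>" and I = "{1..n}" and p = p]
  by (simp add: data_space_def)

text \<open>Change of units: scaling is moved from the data into the estimator, and the observations
  become centers plus standard noise, the form required by \<open>sign_mixture\<close>.\<close>

lemma error_prob_label_matrix:
  assumes lab: "\<And>i. i \<in> {1..n} \<Longrightarrow> lab i \<in> {1..K}" and \<sigma>: "\<sigma> > 0"
    and Hhat: "Hhat \<in> estimators n K p"
  defines "est x \<equiv> Hhat (\<lambda>i\<in>{1..n}. \<lambda>j\<in>{1..p}. \<sigma> * x i j)"
  shows "error_prob n K p \<sigma> Hhat (label_matrix n K lab) (scaled_centers K p \<sigma> c)
    = 1 - measure (noise {1..n} p) {e \<in> space (noise {1..n} p).
        est (\<lambda>i\<in>{1..n}. \<lambda>j\<in>{1..p}. c (lab i) j + e i j) = label_matrix n K lab}"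
proof -
  let ?H = "label_matrix n K lab" and ?N = "noise {1..n} p"
  let ?f = "\<lambda>\<epsilon>. \<lambda>i\<in>{1..n}. \<lambda>j\<in>{1..p}. (\<Sum>k\<in>{1..K}. real (?H i k) * scaled_centers K p \<sigma> c k j) + \<epsilon> i j"
  let ?s = "\<lambda>e. \<lambda>i\<in>{1..n}. \<lambda>j\<in>{1..p}. \<sigma> * e i j :: real"
  let ?g = "\<lambda>e. \<lambda>i\<in>{1..n}. \<lambda>j\<in>{1..p}. \<sigma> * c (lab i) j + \<sigma> * e i j"
  interpret N: prob_space ?N by (rule prob_space_noise)
  have s: "?s \<in> ?N \<rightarrow>\<^sub>M data_space n p" by (rule measurable_rescale)
  have g: "?g \<in> ?N \<rightarrow>\<^sub>M data_space n p"
    using measurable_noise_affine[where v = "\<lambda>i j. \<sigma> * c (lab i) j" and a = "\<lambda>_. \<sigma>" and I = "{1..n}" and p = p]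
    by (simp add: data_space_def)
  have f: "?f \<in> data_space n p \<rightarrow>\<^sub>M data_space n p"
    unfolding data_space_def
  proof (intro measurable_restrict borel_measurable_add borel_measurable_const)
    fix i j assume "i \<in> {1..n}" "j \<in> {1..p}"
    then show "(\<lambda>x. x i j :: real) \<in> borel_measurable (Pi\<^sub>M {1..n} (\<lambda>_. vectors p))"
      using measurable_noise_coordinate[of i "{1..n}" j p] by (simp add: measurable_cong_sets[OF sets_noise refl])
  qed
  have fs: "?f (?s e) = ?g e" for e
  proof (intro ext)
    fix i j
    have "(\<Sum>k\<in>{1..K}. real (?H i k) * scaled_centers K p \<sigma> c k j) = \<sigma> * c (lab i) j" if "i \<in> {1..n}" "j \<in> {1..p}"
      using sum_label_matrix[of i n lab K "\<lambda>k. scaled_centers K p \<sigma> c k j"] lab[OF that(1)] that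
      by (simp add: scaled_centers_def)
    then show "?f (?s e) i j = ?g e i j" by (simp add: restrict_def)
  qed
  have law: "observation_law n K p \<sigma> ?H (scaled_centers K p \<sigma> c) = distr ?N (data_space n p) ?g"
  proof -
    have scale: "Pi\<^sub>M {1..n} (\<lambda>_. isotropic_gaussian p \<sigma>) = distr ?N (data_space n p) ?s"
      using distr_noise_scale[of "{1..n}" "\<lambda>_. \<sigma>" \<sigma> p] \<sigma> by (simp add: data_space_def)
    show ?thesis
      unfolding observation_law_def scale distr_distr[OF f s] comp_def fs ..
  qed
  have sp: "?g e \<in> space (data_space n p)" for e by (auto simp: data_space_def space_PiM)
  have est: "est (\<lambda>i\<in>{1..n}. \<lambda>j\<in>{1..p}. c (lab i) j + e i j) = Hhat (?g e)" for e
  proof -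
    have "(\<lambda>i\<in>{1..n}. \<lambda>j\<in>{1..p}. \<sigma> * (\<lambda>i\<in>{1..n}. \<lambda>j\<in>{1..p}. c (lab i) j + e i j) i j) = ?g e"
      by (intro ext) (simp add: restrict_def algebra_simps)
    then show ?thesis by (simp add: est_def)
  qed
  have E: "{X \<in> space (data_space n p). Hhat X \<noteq> ?H} \<in> sets (data_space n p)"
    using error_event_measurable[OF Hhat, of ?H \<sigma> ?H] by (simp add: observation_law_def)
  have pre: "?g -` {X \<in> space (data_space n p). Hhat X \<noteq> ?H} \<inter> space ?N = space ?N - {e \<in> space ?N. Hhat (?g e) = ?H}"
    using sp by auto
  have "?g -` {X \<in> space (data_space n p). Hhat X \<noteq> ?H} \<inter> space ?N \<in> sets ?N"
    by (rule measurable_sets[OF g E])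
  then have "space ?N - (?g -` {X \<in> space (data_space n p). Hhat X \<noteq> ?H} \<inter> space ?N) \<in> sets ?N" by auto
  moreover have "space ?N - (?g -` {X \<in> space (data_space n p). Hhat X \<noteq> ?H} \<inter> space ?N) = {e \<in> space ?N. Hhat (?g e) = ?H}"
    unfolding pre by auto
  ultimately have m: "{e \<in> space ?N. Hhat (?g e) = ?H} \<in> sets ?N" by simp
  have "error_prob n K p \<sigma> Hhat ?H (scaled_centers K p \<sigma> c)
      = measure ?N (?g -` {X \<in> space (data_space n p). Hhat X \<noteq> ?H} \<inter> space ?N)"
    unfolding error_prob_def law by (rule measure_distr[OF g E])
  also have "\<dots> = 1 - measure ?N {e \<in> space ?N. Hhat (?g e) = ?H}"
    unfolding pre by (rule N.prob_compl[OF m])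
  finally show ?thesis unfolding est .
qed

text \<open>Variance of a sum of independent random signs: for uniform \<open>A\<close>, the number
  \<open>2 * card A - card S\<close> is such a sum. The induction step is (d - 1)^2 + (d + 1)^2 = 2
  d^2 + 2.\<close>

lemma sum_Pow_deviation:
  assumes "finite S"
  shows "(\<Sum>A\<in>Pow S. (2 * real (card A) - card S)\<^sup>2) = card S * 2 ^ card S"
  using assms
proof (induction S)
  case (insert x S)
  have inj: "inj_on (insert x) (Pow S)" using insert by (auto simp: inj_on_def)
  have dis: "Pow S \<inter> insert x ` Pow S = {}" using insert by auto
  have "(\<Sum>A\<in>Pow (insert x S). (2 * real (card A) - card (insert x S))\<^sup>2)
      = (\<Sum>A\<in>Pow S. (2 * real (card A) - (card S + 1))\<^sup>2) + (\<Sum>A\<in>Pow S. (2 * real (card (insert x A)) - (card S + 1))\<^sup>2)"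
    unfolding Pow_insert using insert dis by (simp add: sum.union_disjoint sum.reindex[OF inj] add.commute)
  also have "(\<Sum>A\<in>Pow S. (2 * real (card (insert x A)) - (card S + 1))\<^sup>2) = (\<Sum>A\<in>Pow S. (2 * (real (card A) + 1) - (card S + 1))\<^sup>2)"
  proof (rule sum.cong[OF refl])
    fix A assume "A \<in> Pow S"
    then have "finite A" "x \<notin> A" using insert finite_subset by auto
    then show "(2 * real (card (insert x A)) - (card S + 1))\<^sup>2 = (2 * (real (card A) + 1) - (card S + 1))\<^sup>2" by simp
  qed
  also have "(\<Sum>A\<in>Pow S. (2 * real (card A) - (card S + 1))\<^sup>2) + (\<Sum>A\<in>Pow S. (2 * (real (card A) + 1) - (card S + 1))\<^sup>2)
      = (\<Sum>A\<in>Pow S. 2 * (2 * real (card A) - card S)\<^sup>2 + 2)"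
    unfolding sum.distrib[symmetric] by (intro sum.cong refl) (simp add: power2_eq_square algebra_simps)
  also have "\<dots> = card (insert x S) * 2 ^ card (insert x S)"
    using insert by (simp add: sum.distrib sum_distrib_left[symmetric] card_Pow algebra_simps)
  finally show ?case .
qed simp

text \<open>Chebyshev's inequality: deviations beyond twice the variance have probability at most
  1/2.\<close>

lemma card_balanced_subsets:
  assumes S: "finite S"
  shows "2 ^ card S \<le> 2 * card {A \<in> Pow S. (2 * real (card A) - card S)\<^sup>2 \<le> 2 * card S}"
proof (cases "card S = 0")
  case True
  then have "S = {}" using S by simp
  then have "{A \<in> Pow S. (2 * real (card A) - card S)\<^sup>2 \<le> 2 * card S} = {{}}" by auto
  then show ?thesis using True by simp
next
  case False
  define G where "G = {A \<in> Pow S. (2 * real (card A) - card S)\<^sup>2 \<le> 2 * card S}"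
  have G: "G \<subseteq> Pow S" "finite (Pow S)" using S by (auto simp: G_def)
  have "card (Pow S - G) * (2 * real (card S)) = (\<Sum>A\<in>Pow S - G. 2 * real (card S))" by simp
  also have "\<dots> \<le> (\<Sum>A\<in>Pow S - G. (2 * real (card A) - card S)\<^sup>2)"
    by (intro sum_mono) (auto simp: G_def)
  also have "\<dots> \<le> (\<Sum>A\<in>Pow S. (2 * real (card A) - card S)\<^sup>2)"
    using G by (intro sum_mono2) auto
  also have "\<dots> = card S * 2 ^ card S" by (rule sum_Pow_deviation[OF S])
  finally have "2 * real (card (Pow S - G)) \<le> 2 ^ card S"
    using False by (simp add: field_simps)
  then have 1: "2 * card (Pow S - G) \<le> 2 ^ card S"
    by (metis of_nat_le_iff of_nat_mult of_nat_numeral of_nat_power)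
  have "card (Pow S - G) = 2 ^ card S - card G"
    using G card_Diff_subset[of G "Pow S"] finite_subset[of G] by (simp add: card_Pow S)
  then show ?thesis using 1 unfolding G_def[symmetric] by linarith
qed

subsection \<open>From the Bayes risk to the minimax risk\<close>

text \<open>Consecutive blocks of length \<open>n div K\<close>; \<open>min\<close> puts the
  remainder, fewer than \<open>K\<close> points, into the last cluster.\<close>

definition base_label :: "nat \<Rightarrow> nat \<Rightarrow> nat \<Rightarrow> nat" where
  "base_label n K i = min K ((i - 1) div (n div K) + 1)"

text \<open>Equally many points of the first two blocks, so that a relabeling with
  \<open>card A = h\<close> restores the original cluster sizes.\<close>

definition switch_set :: "nat \<Rightarrow> nat \<Rightarrow> nat \<Rightarrow> nat set" where
  "switch_set n K h = {1..h} \<union> {n div K + 1..n div K + h}"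

definition switched_label :: "nat \<Rightarrow> nat \<Rightarrow> nat \<Rightarrow> nat set \<Rightarrow> nat \<Rightarrow> nat" where
  "switched_label n K h A i = (if i \<in> switch_set n K h then (if i \<in> A then 1 else 2) else base_label n K i)"

lemma base_label_range: "1 \<le> K \<Longrightarrow> base_label n K i \<in> {1..K}"
  by (auto simp: base_label_def)

lemma base_label_fibre:
  assumes K: "1 \<le> k" "k < K" "K \<le> n"
  shows "{i \<in> {1..n}. base_label n K i = k} = {(k - 1) * (n div K) + 1..k * (n div K)}"
proof -
  define q where "q = n div K"
  have q: "q \<ge> 1" using K by (simp add: q_def div_greater_zero_iff Suc_le_eq)
  have "k * q \<le> K * q" using K by (intro mult_right_mono) auto
  also have "\<dots> \<le> n" by (simp add: q_def)
  finally have kq: "k * q \<le> n" .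
  have "base_label n K i = k \<longleftrightarrow> (k - 1) * q + 1 \<le> i \<and> i \<le> k * q" if i: "1 \<le> i" for i
  proof -
    have "base_label n K i = k \<longleftrightarrow> (i - 1) div q = k - 1"
      using K by (auto simp: base_label_def q_def min_def)
    also have "\<dots> \<longleftrightarrow> k - 1 \<le> (i - 1) div q \<and> (i - 1) div q < k"
      using K by auto
    also have "\<dots> \<longleftrightarrow> (k - 1) * q \<le> i - 1 \<and> i - 1 < k * q"
      using q by (simp add: less_eq_div_iff_mult_less_eq div_less_iff_less_mult)
    finally show ?thesis using i by auto
  qed
  then show ?thesis using kq unfolding q_def[symmetric] by force
qed

lemma base_label_last_fibre:
  assumes K: "1 \<le> K" "K \<le> n"
  shows "{i \<in> {1..n}. base_label n K i = K} = {(K - 1) * (n div K) + 1..n}"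
proof -
  define q where "q = n div K"
  have q: "q \<ge> 1" using K by (simp add: q_def div_greater_zero_iff Suc_le_eq)
  have "base_label n K i = K \<longleftrightarrow> (K - 1) * q + 1 \<le> i" if i: "1 \<le> i" for i
  proof -
    have "base_label n K i = K \<longleftrightarrow> K - 1 \<le> (i - 1) div q"
      using K by (auto simp: base_label_def q_def min_def)
    also have "\<dots> \<longleftrightarrow> (K - 1) * q \<le> i - 1"
      using q by (subst less_eq_div_iff_mult_less_eq) auto
    finally show ?thesis using i by auto
  qed
  then show ?thesis unfolding q_def[symmetric] by auto
qed

lemma card_base_label_fibre:
  assumes K: "1 \<le> K" "K \<le> n" and k: "k \<in> {1..K}"
  shows "\<bar>real (card {i \<in> {1..n}. base_label n K i = k}) - n / K\<bar> \<le> K"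
proof -
  define q r where "q = n div K" and "r = n mod K"
  have n: "n = K * q + r" "r < K" using K by (simp_all add: q_def r_def)
  have nK: "real n / K = q + r / K" using K by (simp add: n field_simps)
  have rK: "0 \<le> real r / K" "real r / K \<le> 1" using n(2) by auto
  show ?thesis
  proof (cases "k = K")
    case True
    have "n - (K - 1) * q = q + r" using K by (simp add: n(1) algebra_simps diff_mult_distrib)
    then have "card {i \<in> {1..n}. base_label n K i = k} = q + r"
      unfolding True base_label_last_fibre[OF K] by (simp add: q_def[symmetric])
    then have "real (card {i \<in> {1..n}. base_label n K i = k}) = real q + real r" by simp
    moreover have "real r < K" "0 \<le> real r" "1 \<le> real K" using n(2) K by simp_all
    ultimately show ?thesis using rK unfolding nK by linarith
  next
    case False
    then have "card {i \<in> {1..n}. base_label n K i = k} = q"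
      using base_label_fibre[of k K n] k K by (simp add: q_def[symmetric] diff_mult_distrib)
    moreover have "1 \<le> real K" using K by simp
    ultimately show ?thesis using rK unfolding nK by linarith
  qed
qed

lemma switch_set_base_label:
  assumes K: "2 \<le> K" "K \<le> n" and h: "h \<le> n div K"
  shows "{i \<in> switch_set n K h. base_label n K i = 1} = {1..h}"
    and "{i \<in> switch_set n K h. base_label n K i = 2} = {n div K + 1..n div K + h}"
    and "switch_set n K h \<subseteq> {i \<in> {1..n}. base_label n K i \<le> 2}"
    and "finite (switch_set n K h)" "card (switch_set n K h) = 2 * h"
proof -
  define q where "q = n div K"
  have q: "q \<ge> 1" using K by (simp add: q_def div_greater_zero_iff Suc_le_eq)
  have "2 * q \<le> K * q" using K by (intro mult_right_mono) auto
  also have "\<dots> \<le> n" by (simp add: q_def)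
  finally have q2: "2 * q \<le> n" .
  have 1: "base_label n K i = 1" if "i \<in> {1..h}" for i
  proof -
    have "i - 1 < q" using that h by (auto simp: q_def)
    then show ?thesis using K by (simp add: base_label_def q_def[symmetric])
  qed
  have 2: "base_label n K i = 2" if "i \<in> {q + 1..q + h}" for i
  proof -
    note i = that
    obtain d where d: "i = q + d + 1" "d < q"
    proof
      show "i = q + (i - 1 - q) + 1" "i - 1 - q < q" using i h by (auto simp: q_def)
    qed
    then have "(i - 1) div q = 1" using q by simp
    then show ?thesis using K by (simp add: base_label_def q_def[symmetric])
  qed
  show "{i \<in> switch_set n K h. base_label n K i = 1} = {1..h}"
    "{i \<in> switch_set n K h. base_label n K i = 2} = {n div K + 1..n div K + h}"
    using 1 2 unfolding switch_set_def q_def[symmetric] by force+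
  show "switch_set n K h \<subseteq> {i \<in> {1..n}. base_label n K i \<le> 2}"
  proof
    fix i assume "i \<in> switch_set n K h"
    then consider "i \<in> {1..h}" | "i \<in> {q + 1..q + h}" by (auto simp: switch_set_def q_def)
    then show "i \<in> {i \<in> {1..n}. base_label n K i \<le> 2}"
      using 1 2 h q2 unfolding q_def[symmetric] by cases auto
  qed
  show "finite (switch_set n K h)" by (simp add: switch_set_def)
  have "{1..h} \<inter> {q + 1..q + h} = {}" using h by (auto simp: q_def)
  then show "card (switch_set n K h) = 2 * h"
    unfolding switch_set_def q_def[symmetric] by (subst card_Un_disjoint) auto
qed

text \<open>The first cluster gives up \<open>h\<close> points and receives \<open>card A\<close>,
  the second gives up \<open>h\<close> and receives \<open>2 * h - card A\<close>; both change by
  \<open>card A - h\<close> in absolute value, the others not at all.\<close>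

lemma card_switched_label_fibre:
  assumes K: "2 \<le> K" "K \<le> n" and h: "h \<le> n div K" and A: "A \<subseteq> switch_set n K h" and k: "k \<in> {1..K}"
  shows "\<bar>real (card {i \<in> {1..n}. switched_label n K h A i = k}) - n / K\<bar> \<le> K + \<bar>real (card A) - h\<bar>"
proof -
  let ?S = "switch_set n K h"
  note S = switch_set_base_label[OF K h]
  have S_n: "?S \<subseteq> {1..n}" and S_lab: "\<And>i. i \<in> ?S \<Longrightarrow> base_label n K i \<le> 2" using S(3) by auto
  have S_lab1: "base_label n K i \<ge> 1" for i using base_label_range[of K n i] K by simp
  have fin_A: "finite A" using A S(4) finite_subset by metis
  have base: "\<bar>real (card {i \<in> {1..n}. base_label n K i = k}) - n / K\<bar> \<le> K"
    by (rule card_base_label_fibre) (use K k in auto)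
  have keep: "real (card {i \<in> {1..n} - ?S. base_label n K i = k})
      = real (card {i \<in> {1..n}. base_label n K i = k}) - real (card {i \<in> ?S. base_label n K i = k})"
  proof -
    have "{i \<in> {1..n} - ?S. base_label n K i = k} = {i \<in> {1..n}. base_label n K i = k} - {i \<in> ?S. base_label n K i = k}" by auto
    moreover have sub: "{i \<in> ?S. base_label n K i = k} \<subseteq> {i \<in> {1..n}. base_label n K i = k}" using S_n by auto
    ultimately show ?thesis
      using card_Diff_subset[OF finite_subset[OF sub] sub] card_mono[OF _ sub] by simp
  qed
  consider "k = 1" | "k = 2" | "k \<ge> 3" using k by fastforce
  then show ?thesis
  proof cases
    case 1
    have "{i \<in> {1..n}. switched_label n K h A i = k} = {i \<in> {1..n} - ?S. base_label n K i = k} \<union> A"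
      using A S_n 1 by (auto simp: switched_label_def)
    moreover have "{i \<in> {1..n} - ?S. base_label n K i = k} \<inter> A = {}" using A by auto
    ultimately have "real (card {i \<in> {1..n}. switched_label n K h A i = k})
        = real (card {i \<in> {1..n}. base_label n K i = k}) - real h + real (card A)"
      using fin_A keep S(1) 1 by (simp add: card_Un_disjoint)
    then show ?thesis using base by linarith
  next
    case 2
    have "{i \<in> {1..n}. switched_label n K h A i = k} = {i \<in> {1..n} - ?S. base_label n K i = k} \<union> (?S - A)"
      using A S_n 2 by (auto simp: switched_label_def)
    moreover have "{i \<in> {1..n} - ?S. base_label n K i = k} \<inter> (?S - A) = {}" by auto
    moreover have "real (card (?S - A)) = 2 * real h - real (card A)"
      using card_Diff_subset[OF fin_A A] card_mono[OF S(4) A] S(5) by simp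
    ultimately have "real (card {i \<in> {1..n}. switched_label n K h A i = k})
        = real (card {i \<in> {1..n}. base_label n K i = k}) - real h + (2 * real h - real (card A))"
      using S(4) keep S(2) 2 by (simp add: card_Un_disjoint)
    then show ?thesis using base by linarith
  next
    case 3
    then have "{i \<in> {1..n}. switched_label n K h A i = k} = {i \<in> {1..n}. base_label n K i = k}"
      using S_lab by (fastforce simp: switched_label_def)
    then show ?thesis using base by simp
  qed
qed

text \<open>The centers of the other clusters are known and lie far out on the first axis.\<close>

definition center :: "(nat \<Rightarrow> real) \<Rightarrow> real \<Rightarrow> nat \<Rightarrow> nat \<Rightarrow> real" where
  "center \<theta> D k j = (if k = 1 then \<theta> j else if k = 2 then - \<theta> j else if j = 1 then k * D else 0)"

text \<open>For the pair of clusters 1 and 2 the distance is twice the norm of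
  \<open>\<theta>\<close>; for every other pair the first coordinate alone suffices. The scale is
  \<open>d + B\<close> with a bound \<open>B\<close> on the first coordinate of
  \<open>\<theta>\<close>, and not that coordinate itself, because the other centers must be the
  same for all \<open>\<theta>\<close> drawn from the prior.\<close>

lemma center_separated:
  assumes p: "p \<ge> 1" and d: "d \<le> 2 * sqrt (sq p \<theta>)" and B: "\<bar>\<theta> 1\<bar> \<le> B" and d0: "d \<ge> 0"
    and kl: "1 \<le> k" "1 \<le> l" "k \<noteq> l"
  shows "d \<le> L2_set (\<lambda>j. center \<theta> (d + B) k j - center \<theta> (d + B) l j) {1..p}"
proof -
  have first: "d \<le> L2_set f {1..p}" if "d \<le> \<bar>f 1\<bar>" for f :: "nat \<Rightarrow> real"
  proof -
    have "\<bar>f 1\<bar> \<le> L2_set (\<lambda>j. \<bar>f j\<bar>) {1..p}" using p by (intro member_le_L2_set) auto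
    also have "L2_set (\<lambda>j. \<bar>f j\<bar>) {1..p} = L2_set f {1..p}" by (simp add: L2_set_def)
    finally show ?thesis using that by simp
  qed
  have B0: "B \<ge> 0" using B by linarith
  have two: "L2_set (\<lambda>j. 2 * \<theta> j) {1..p} = 2 * sqrt (sq p \<theta>)"
  proof -
    have "L2_set (\<lambda>j. 2 * \<theta> j) {1..p} = 2 * L2_set \<theta> {1..p}"
      using L2_set_right_distrib[of 2 \<theta> "{1..p}"] by simp
    then show ?thesis by (simp only: L2_set_eq_sqrt_dot)
  qed
  have two': "L2_set (\<lambda>j. - (2 * \<theta> j)) {1..p} = 2 * sqrt (sq p \<theta>)"
    using two by (simp add: L2_set_def)
  have big: "d + B \<le> real k * (d + B)" if "1 \<le> k" for k :: nat
    using mult_right_mono[of 1 "real k" "d + B"] that d0 B0 by simp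
  have diff: "d + B \<le> \<bar>real k * (d + B) - real l * (d + B)\<bar>"
  proof -
    have "1 \<le> \<bar>real k - real l\<bar>" using kl by linarith
    then have "1 * (d + B) \<le> \<bar>real k - real l\<bar> * (d + B)" using d0 B0 by (intro mult_right_mono) auto
    also have "\<dots> = \<bar>(real k - real l) * (d + B)\<bar>" using d0 B0 by (simp add: abs_mult)
    finally show ?thesis by (simp add: left_diff_distrib)
  qed
  consider "k = 1" "l = 2" | "k = 2" "l = 1" | "k \<le> 2" "l \<ge> 3" | "k \<ge> 3" "l \<le> 2" | "k \<ge> 3" "l \<ge> 3"
    using kl by linarith
  then show ?thesis
  proof cases
    case 1
    then show ?thesis using d two by (simp add: center_def)
  next
    case 2
    then show ?thesis using d two' by (simp add: center_def)
  next
    case 3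
    then show ?thesis using big[of l] B kl by (intro first) (auto simp: center_def)
  next
    case 4
    then show ?thesis using big[of k] B kl by (intro first) (auto simp: center_def)
  next
    case 5
    then show ?thesis using diff B0 by (intro first) (auto simp: center_def)
  qed
qed

text \<open>The origin of the constant 3. As \<open>K \<le> ln n \<le> 2 * sqrt n\<close>, the left
  side is at most \<open>3 * sqrt n\<close>, while the admissible deviation is 3 sqrt (n log n / K),
  which is at least \<open>3 * sqrt n\<close> by \<open>K \<le> ln n\<close>.\<close>

lemma delta_n_bound:
  assumes K: "2 \<le> K" "K \<le> n" "real K \<le> ln n" and x: "x \<le> sqrt n"
  shows "K + x \<le> delta_n 3 n K * (n / K)"
proof -
  have n: "n > 0" using K by simp
  have "ln (sqrt n) \<le> sqrt n" using ln_le_minus_one[of "sqrt n"] n by simp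
  then have "ln n \<le> 2 * sqrt n" using n by (simp add: ln_sqrt)
  then have 1: "K + x \<le> 3 * sqrt n" using K x by linarith
  have "sqrt n \<le> sqrt (n * (ln n / K))"
    using K n by (intro real_sqrt_le_mono) (simp add: field_simps)
  also have "n * (ln n / K) = (K * ln n / n) * (n / K)\<^sup>2"
    using K n by (simp add: power2_eq_square field_simps)
  also have "sqrt \<dots> = sqrt (K * ln n / n) * (n / K)"
    by (simp only: real_sqrt_mult real_sqrt_abs) simp
  finally show ?thesis using 1 by (simp add: delta_n_def)
qed

lemma switched_in_Theta:
  assumes K: "2 \<le> K" "K \<le> n" "real K \<le> ln n" and p: "p \<ge> 1" and \<sigma>: "\<sigma> > 0" "\<Delta> > 0"
    and h: "h \<le> n div K" and A: "A \<subseteq> switch_set n K h" "(2 * real (card A) - card (switch_set n K h))\<^sup>2 \<le> 2 * card (switch_set n K h)"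
    and \<theta>: "\<Delta> / \<sigma> \<le> 2 * sqrt (sq p \<theta>)" "\<bar>\<theta> 1\<bar> \<le> B"
  shows "(label_matrix n K (switched_label n K h A), scaled_centers K p \<sigma> (center \<theta> (\<Delta> / \<sigma> + B))) \<in> Theta 3 n K p \<Delta>"
proof (rule label_matrix_in_Theta)
  show "switched_label n K h A i \<in> {1..K}" if "i \<in> {1..n}" for i
    using base_label_range[of K n i] K by (auto simp: switched_label_def)
  have "(real (card A) - h)\<^sup>2 \<le> h"
    using A(2) unfolding switch_set_base_label(5)[OF K(1,2) h] by (simp add: power2_eq_square algebra_simps)
  then have "\<bar>real (card A) - h\<bar> \<le> sqrt h" by (metis real_le_rsqrt power2_abs)
  also have "\<dots> \<le> sqrt n" using h div_le_dividend[of n K] by (intro real_sqrt_le_mono) linarith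
  finally have dev: "\<bar>real (card A) - h\<bar> \<le> sqrt n" .
  show "\<bar>real (card {i \<in> {1..n}. switched_label n K h A i = k}) - n / K\<bar> \<le> delta_n 3 n K * (n / K)" if "k \<in> {1..K}" for k
    using card_switched_label_fibre[OF K(1,2) h A(1) that] delta_n_bound[OF K dev] by linarith
  show "\<Delta> / \<sigma> \<le> L2_set (\<lambda>j. center \<theta> (\<Delta> / \<sigma> + B) k j - center \<theta> (\<Delta> / \<sigma> + B) l j) {1..p}"
    if "k \<in> {1..K}" "l \<in> {1..K}" "k \<noteq> l" for k l
    using that \<sigma> by (intro center_separated[OF p \<theta>]) auto
qed (rule \<sigma>)

text \<open>In \<open>ereal\<close> a supremum over the empty set is minus infinity, so a member of
  the parameter space must be exhibited: the base labels with a center on the first axis. This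
  settles small \<open>n\<close>.\<close>

lemma minimax_risk_nonneg:
  assumes K: "2 \<le> K" "K \<le> n" "real K \<le> ln n" and p: "p \<ge> 1" and \<sigma>: "\<sigma> > 0" "\<Delta> > 0"
  shows "0 \<le> minimax_risk 3 n K p \<sigma> \<Delta>"
proof -
  define \<theta> where "\<theta> j = (if j = 1 then \<Delta> / (2 * \<sigma>) else 0)" for j :: nat
  have "sq p \<theta> = (\<Sum>j\<in>{1..p}. if j = 1 then (\<Delta> / (2 * \<sigma>))\<^sup>2 else 0)"
    unfolding dot_def by (intro sum.cong refl) (simp add: \<theta>_def power2_eq_square)
  also have "\<dots> = (\<Delta> / (2 * \<sigma>))\<^sup>2" using p by simp
  finally have dot: "2 * sqrt (sq p \<theta>) = \<Delta> / \<sigma>" using \<sigma> by simp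
  have "(label_matrix n K (switched_label n K 0 {}), scaled_centers K p \<sigma> (center \<theta> (\<Delta> / \<sigma> + \<bar>\<theta> 1\<bar>))) \<in> Theta 3 n K p \<Delta>"
    by (rule switched_in_Theta[OF K p \<sigma>]) (auto simp: dot switch_set_def)
  then have "0 \<le> (SUP (H, \<mu>)\<in>Theta 3 n K p \<Delta>. ereal (error_prob n K p \<sigma> Hhat H \<mu>))" for Hhat
    by (rule SUP_upper2) (simp add: error_prob_def)
  then show ?thesis unfolding minimax_risk_def by (intro INF_greatest)
qed

text \<open>An estimator of risk below \<open>1 - \<epsilon>\<close> succeeds with probability at
  least \<open>\<epsilon>\<close> at every parameter, in particular for all balanced
  \<open>A\<close> and all centers in \<open>T0\<close>, against \<open>success_le\<close>. The
  factor 4 is 2 for the balanced labelings times 2 from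
  \<open>1 - \<beta>' \<ge> 1/2\<close>.\<close>

lemma minimax_risk_ge_bayes:
  fixes \<epsilon> \<beta> \<beta>' :: real and n K h :: nat
  defines "S \<equiv> switch_set n K h" and "P \<equiv> {i \<in> {1..n}. base_label n K i \<le> 2}"
  assumes K: "2 \<le> K" "K \<le> n" "real K \<le> ln n" and p: "p \<ge> 1" and \<sigma>: "\<sigma> > 0" "\<Delta> > 0"
    and h: "h \<le> n div K"
    and prior: "prob_space \<pi>" "sets \<pi> = sets (vectors p)"
    and T0: "T0 \<in> sets \<pi>" "measure \<pi> T0 \<ge> 1 - \<beta>'"
    and \<theta>: "\<And>\<theta>. \<theta> \<in> T0 \<Longrightarrow> \<Delta> / \<sigma> \<le> 2 * sqrt (sq p \<theta>)" "\<And>\<theta>. \<theta> \<in> T0 \<Longrightarrow> \<bar>\<theta> 1\<bar> \<le> B"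
    and bad: "\<And>\<theta>. \<theta> \<in> T0 \<Longrightarrow> unlikely (noise {1..n} p) (\<lambda>e. \<not> sign_mixture.flippable P S p t \<pi> (\<lambda>i j. \<theta> j + e i j)) \<beta>"
    and pos: "0 \<le> \<beta>" "0 \<le> \<beta>'" "\<beta>' \<le> 1/2" and \<epsilon>: "4 * (1 / 2 ^ t + \<beta> + \<beta>') < \<epsilon>"
  shows "ereal (1 - \<epsilon>) \<le> minimax_risk 3 n K p \<sigma> \<Delta>"
proof -
  define s0 where "s0 i = (if base_label n K i = 1 then 1 else -1 :: real)" for i
  define D where "D = \<Delta> / \<sigma> + B"
  \<comment> \<open>Outside \<open>P\<close> the labels are at least 3, where \<open>center\<close>
    does not depend on its first argument; the zero function stands in for it.\<close>
  define m0 where "m0 i = center (\<lambda>_. 0) D (base_label n K i)" for i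
  define Hc where "Hc A = label_matrix n K (switched_label n K h A)" for A
  note S = switch_set_base_label[OF K(1,2) h, folded S_def P_def]
  interpret M: sign_mixture "{1..n}" P S p t \<pi> s0 m0
  proof (rule sign_mixture.intro)
    show "finite {1..n}" "P \<subseteq> {1..n}" by (auto simp: P_def)
    show "\<bar>s0 i\<bar> = 1" for i by (simp add: s0_def)
  qed (rule S(3) prior)+
  have lab_range: "switched_label n K h A i \<in> {1..K}" for A i
    using base_label_range[of K n i] K by (auto simp: switched_label_def)
  have base1: "base_label n K i \<ge> 1" for i using base_label_range[of K n i] K by simp
  have mean: "M.mean A \<theta> i j = center \<theta> D (switched_label n K h A i) j" if "i \<in> {1..n}" for A \<theta> i j
  proof (cases "i \<in> S")
    case True
    then have "i \<in> P" using S(3) by auto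
    with True show ?thesis
      unfolding M.mean_def M.sgn_of_def center_def switched_label_def S_def[symmetric] by simp
  next
    case False
    then have lab: "switched_label n K h A i = base_label n K i" by (simp add: switched_label_def S_def)
    show ?thesis
    proof (cases "i \<in> P")
      case True
      then have "base_label n K i = 1 \<or> base_label n K i = 2" using base1[of i] by (auto simp: P_def)
      then show ?thesis using False True by (auto simp: M.mean_def M.sgn_of_def lab s0_def center_def)
    next
      case P: False
      then have "base_label n K i > 2" using that by (auto simp: P_def)
      then show ?thesis using P by (simp add: M.mean_def lab m0_def center_def)
    qed
  qed
  have obs: "M.obs A \<theta> e = (\<lambda>i\<in>{1..n}. \<lambda>j\<in>{1..p}. center \<theta> D (switched_label n K h A i) j + e i j)" for A \<theta> e
    unfolding M.obs_def by (intro ext) (simp add: restrict_def mean)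
  have inj: "inj_on Hc (Pow S)"
  proof (rule inj_onI)
    fix A A' assume A: "A \<in> Pow S" "A' \<in> Pow S" and eq: "Hc A = Hc A'"
    \<comment> \<open>Column 1 of the label matrix, restricted to \<open>S\<close>, is the indicator
      of \<open>A\<close>.\<close>
    have "Hc A i 1 = (if i \<in> A then 1 else 0)" if "i \<in> S" for A i
    proof -
      have "i \<in> {1..n}" using that S(3) by (auto simp: P_def)
      then show ?thesis using that K by (simp add: Hc_def label_matrix_def switched_label_def S_def[symmetric])
    qed
    then have "i \<in> A \<longleftrightarrow> i \<in> A'" if "i \<in> S" for i
      using that eq by (metis zero_neq_one)
    then show "A = A'" using A by auto
  qed
  show ?thesis
    unfolding minimax_risk_def
  proof (rule INF_greatest)
    fix Hhat assume Hhat: "Hhat \<in> estimators n K p"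
    define est where "est x = Hhat (\<lambda>i\<in>{1..n}. \<lambda>j\<in>{1..p}. \<sigma> * x i j)" for x
    have est_meas: "{x \<in> space (noise {1..n} p). est x = Hc A} \<in> sets (noise {1..n} p)" for A
    proof -
      have "est \<in> noise {1..n} p \<rightarrow>\<^sub>M count_space (binary_matrices n K)"
        unfolding est_def[abs_def]
        by (rule measurable_compose[OF measurable_rescale]) (use Hhat in \<open>simp add: estimators_def\<close>)
      from measurable_sets[OF this, of "{Hc A}"]
      have "est -` {Hc A} \<inter> space (noise {1..n} p) \<in> sets (noise {1..n} p)"
        by (simp add: Hc_def label_matrix_binary)
      moreover have "est -` {Hc A} \<inter> space (noise {1..n} p) = {x \<in> space (noise {1..n} p). est x = Hc A}" by auto
      ultimately show ?thesis by simp
    qed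
    define AA where "AA = {A \<in> Pow S. (2 * real (card A) - card S)\<^sup>2 \<le> 2 * card S}"
    show "ereal (1 - \<epsilon>) \<le> (SUP (H, \<mu>)\<in>Theta 3 n K p \<Delta>. ereal (error_prob n K p \<sigma> Hhat H \<mu>))" (is "_ \<le> ?risk")
    proof (rule ccontr)
      assume "\<not> ereal (1 - \<epsilon>) \<le> ?risk"
      then have less: "?risk < ereal (1 - \<epsilon>)" by simp
      have succ: "\<epsilon> \<le> measure (noise {1..n} p) {e \<in> space (noise {1..n} p). est (M.obs A \<theta> e) = Hc A}"
        if A: "A \<in> AA" and th: "\<theta> \<in> T0" for A \<theta>
      proof -
        have mem: "(Hc A, scaled_centers K p \<sigma> (center \<theta> D)) \<in> Theta 3 n K p \<Delta>"
          unfolding Hc_def D_def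
          by (rule switched_in_Theta[OF K p \<sigma> h]) (use A \<theta>[OF th] in \<open>auto simp: AA_def S_def\<close>)
        have "ereal (error_prob n K p \<sigma> Hhat (Hc A) (scaled_centers K p \<sigma> (center \<theta> D)))
            \<le> ?risk"
          by (rule SUP_upper2[OF mem]) simp
        from order_le_less_trans[OF this less]
        have "error_prob n K p \<sigma> Hhat (Hc A) (scaled_centers K p \<sigma> (center \<theta> D)) < 1 - \<epsilon>" by simp
        moreover have "error_prob n K p \<sigma> Hhat (Hc A) (scaled_centers K p \<sigma> (center \<theta> D))
            = 1 - measure (noise {1..n} p) {e \<in> space (noise {1..n} p). est (M.obs A \<theta> e) = Hc A}"
          using error_prob_label_matrix[of n "switched_label n K h A" K \<sigma> Hhat p "center \<theta> D", OF lab_range \<sigma>(1) Hhat]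
          unfolding obs est_def Hc_def .
        ultimately show ?thesis by linarith
      qed
      define s where "s = 1 / 2 ^ t + \<beta> + \<beta>'"
      have s: "0 \<le> s" "4 * s < \<epsilon>" unfolding s_def using pos \<epsilon> by simp_all
      then have eps0: "\<epsilon> \<ge> 0" by linarith
      have "\<epsilon> * (1 - \<beta>') \<le> 2 * s"
        unfolding s_def
      proof (rule M.success_le[OF est_meas inj _ _ T0 eps0 pos(1) pos(2) bad succ])
        show "AA \<subseteq> Pow S" by (auto simp: AA_def)
        show "2 ^ card S \<le> 2 * card AA" unfolding AA_def by (rule card_balanced_subsets[OF M.fin_S])
      qed
      moreover have "\<epsilon> * (1/2) \<le> \<epsilon> * (1 - \<beta>')" using eps0 pos by (intro mult_left_mono) auto
      ultimately show False using s by linarith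
    qed
  qed
qed

subsection \<open>Choice of the parameters\<close>

text \<open>Only the last condition is delicate. With L = log n and r^2 = 2 L (1 -
  \<open>\<alpha>\<close> / 4), the number (r + 1)^2 / 2 is at most (1 - \<open>\<alpha>\<close> /
  4) L + sqrt (2 L) + 1/2. So n times \<open>reach_prob r\<close> is at least of order exp
  (\<open>\<alpha>\<close> L / 4 - sqrt (2 L)) and beats every power of L. This provides enough
  points of \<open>S\<close> that contradict their labels; the second condition makes clusters large
  against L^2, and the third makes the Gaussian prior concentrate.\<close>

lemma growth_conditions:
  fixes \<alpha> g :: real
  assumes \<alpha>: "0 < \<alpha>" "\<alpha> < 1" and g: "0 < g"
  shows "\<forall>\<^sub>F n :: nat in sequentially. 2 \<le> ln n \<and> 1300 * (ln n)\<^sup>2 / g\<^sup>2 \<le> n / ln n \<and> 16 * ln n / g\<^sup>2 \<le> \<alpha> * n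
    \<and> 4 * ln n \<le> g\<^sup>2 / 2000 * (n / ln n) * reach_prob (sqrt (2 * ln n * (1 - \<alpha> / 4)))"
proof -
  define c where "c = g\<^sup>2 / (2000 * sqrt (2 * pi))"
  have c: "c > 0" using g by (simp add: c_def)
  have ln: "filterlim (\<lambda>n::nat. ln (real n)) at_top sequentially"
    by (rule filterlim_compose[OF ln_at_top filterlim_real_sequentially])
  have "\<forall>\<^sub>F L :: real in at_top. 4 * L \<le> c / L * exp (\<alpha> / 4 * L - sqrt (2 * L) - 1 / 2)"
    using c \<alpha> by real_asymp
  then have ev: "\<forall>\<^sub>F n :: nat in sequentially. 4 * ln n \<le> c / ln n * exp (\<alpha> / 4 * ln n - sqrt (2 * ln n) - 1 / 2)"
    using ln by (rule eventually_compose_filterlim)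
  have e1: "\<forall>\<^sub>F n :: nat in sequentially. 2 \<le> ln n" by real_asymp
  have e2: "\<forall>\<^sub>F n :: nat in sequentially. 1300 * (ln n)\<^sup>2 / g\<^sup>2 \<le> n / ln n" using g by real_asymp
  have e3: "\<forall>\<^sub>F n :: nat in sequentially. 16 * ln n / g\<^sup>2 \<le> \<alpha> * n" using g \<alpha> by real_asymp
  show ?thesis
    using ev e1 e2 e3 eventually_gt_at_top[of 1]
  proof eventually_elim
    case (elim n)
    define L where "L = ln (real n)"
    have L: "L \<ge> 2" "real n = exp L" using elim by (simp_all add: L_def)
    define r where "r = sqrt (2 * L * (1 - \<alpha> / 4))"
    have r2: "r\<^sup>2 = 2 * L * (1 - \<alpha> / 4)" using L \<alpha> by (simp add: r_def)
    have rL: "r \<le> sqrt (2 * L)"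
      unfolding r_def using L \<alpha> by (intro real_sqrt_le_mono) (simp add: mult_le_cancel_left1)
    have "\<alpha> / 4 * L - sqrt (2 * L) - 1 / 2 \<le> L - (r + 1)\<^sup>2 / 2"
    proof -
      have "r\<^sup>2 = 2 * L - L * \<alpha> / 2" unfolding r2 by (simp add: algebra_simps)
      moreover have "(r + 1)\<^sup>2 = r\<^sup>2 + 2 * r + 1" by (simp add: power2_sum)
      moreover have "\<alpha> / 4 * L = L * \<alpha> / 4" by simp
      ultimately show ?thesis using rL by linarith
    qed
    then have "c / L * exp (\<alpha> / 4 * L - sqrt (2 * L) - 1 / 2) \<le> c / L * exp (L - (r + 1)\<^sup>2 / 2)"
      using c L by (intro mult_left_mono) auto
    also have "exp (L - (r + 1)\<^sup>2 / 2) = exp L * exp (- (r + 1)\<^sup>2 / 2)"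
      by (simp add: mult_exp_exp)
    also have "c / L * (exp L * exp (- (r + 1)\<^sup>2 / 2)) = g\<^sup>2 / 2000 * (n / L) * reach_prob r"
      unfolding L(2) reach_prob_def c_def by (simp add: mult_ac)
    finally show ?case using elim unfolding L_def[symmetric] r_def[symmetric] by auto
  qed
qed

text \<open>\<open>S\<close> must be of order n / K to contain enough contradicting points, but a
  share of order \<open>g^2\<close> of the two clusters keeps the interactions inside
  \<open>S\<close> below the margin. The large constant 1300 absorbs roundings and the deviations of
  order \<open>K\<close> in the cluster sizes.\<close>

lemma switch_sizes:
  fixes n K :: nat and g :: real
  defines "x \<equiv> real n / real K" and "h \<equiv> nat \<lfloor>g\<^sup>2 / 1000 * (real n / real K)\<rfloor>"
  assumes K: "2 \<le> K" "K \<le> n" "real K \<le> ln n" and g: "0 < g" "g < 1"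
    and L: "2 \<le> ln n" "1300 * (ln n)\<^sup>2 / g\<^sup>2 \<le> n / ln n"
  defines "S \<equiv> switch_set n K h" and "N \<equiv> real (card ({i \<in> {1..n}. base_label n K i \<le> 2} - switch_set n K h))"
  shows "h \<le> n div K" and "card S = 2 * h" and "g\<^sup>2 / 1000 * x \<le> card S" and "card S \<le> g\<^sup>2 / 500 * x"
    and "x \<le> N" and "N \<le> 2 * x * (1 + g)" and "1300 * (ln n)\<^sup>2 / g\<^sup>2 \<le> x" and "n / ln n \<le> x"
proof -
  have n: "n > 0" using K by simp
  show nx: "n / ln n \<le> x"
    unfolding x_def using K L n by (intro divide_left_mono) auto
  show xL: "1300 * (ln n)\<^sup>2 / g\<^sup>2 \<le> x" using nx L by linarith
  have g2: "0 < g\<^sup>2" "g\<^sup>2 \<le> g" "g\<^sup>2 < 1"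
    using g mult_left_mono[of g 1 g] by (auto simp: power2_eq_square intro: mult_strict_mono[of g 1 g 1, simplified])
  have L2: "ln n * 2 \<le> (ln n)\<^sup>2" using L(1) mult_left_mono[of 2 "ln n" "ln n"] by (simp add: power2_eq_square)
  have gx: "1300 * (ln n)\<^sup>2 \<le> g\<^sup>2 * x" using xL g2 by (simp add: field_simps)
  have gxK: "2600 * real K \<le> g\<^sup>2 * x" using gx L2 K(3) by linarith
  have big: "2000 \<le> g\<^sup>2 * x" using gxK K(1) by linarith
  have x0: "x > 0" unfolding x_def using K by simp
  have gx_x: "g\<^sup>2 * x \<le> x" using g2 x0 by (simp add: mult_le_cancel_right1)
  have h_le: "real h \<le> g\<^sup>2 / 1000 * x" and h_ge: "g\<^sup>2 / 1000 * x - 1 \<le> real h"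
    unfolding h_def x_def[symmetric] using big by (simp_all add: of_nat_nat) linarith+
  have "real h \<le> x / 1000" using h_le gx_x by linarith
  also have "\<dots> \<le> x - 1" using big gx_x by linarith
  also have "\<dots> \<le> real (n div K)"   proof -
    have "real_of_int \<lfloor>x\<rfloor> = real (n div K)" unfolding x_def floor_divide_of_nat_eq by simp
    then show ?thesis by linarith
  qed
  finally show h: "h \<le> n div K" by simp
  note sw = switch_set_base_label[OF K(1,2) h]
  show S: "card S = 2 * h" unfolding S_def by (rule sw(5))
  show "g\<^sup>2 / 1000 * x \<le> card S" using h_ge big unfolding S by simp
  show S_le: "card S \<le> g\<^sup>2 / 500 * x" using h_le unfolding S by simp
  have P: "{i \<in> {1..n}. base_label n K i \<le> 2} = {i \<in> {1..n}. base_label n K i = 1} \<union> {i \<in> {1..n}. base_label n K i = 2}"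
  proof -
    have "base_label n K i \<le> 2 \<longleftrightarrow> base_label n K i = 1 \<or> base_label n K i = 2" for i
      using base_label_range[of K n i] K by auto
    then show ?thesis by auto
  qed
  have cP: "card {i \<in> {1..n}. base_label n K i \<le> 2} = card {i \<in> {1..n}. base_label n K i = 1} + card {i \<in> {1..n}. base_label n K i = 2}"
    unfolding P by (rule card_Un_disjoint) auto
  have c1: "\<bar>real (card {i \<in> {1..n}. base_label n K i = 1}) - x\<bar> \<le> K"
    and c2: "\<bar>real (card {i \<in> {1..n}. base_label n K i = 2}) - x\<bar> \<le> K"
    unfolding x_def using K by (intro card_base_label_fibre; simp)+
  have N: "N = real (card {i \<in> {1..n}. base_label n K i \<le> 2}) - real (card S)"
    unfolding N_def S_def using card_Diff_subset[OF sw(4,3)] card_mono[OF _ sw(3)] by simp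
  show "x \<le> N" using c1 c2 cP S_le gxK gx_x unfolding N by linarith
  have "real K \<le> g * x"
    using gxK mult_right_mono[OF g2(2), of x] x0 by linarith
  then show "N \<le> 2 * x * (1 + g)" using c1 c2 cP unfolding N by (simp add: algebra_simps)
qed

lemma flip_count_bounds:
  fixes n :: nat
  assumes L: "2 \<le> ln n"
  defines "t \<equiv> nat \<lceil>2 * ln (real n)\<rceil>"
  shows "1 \<le> t" "t \<le> 3 * ln n" "1 / 2 ^ t \<le> 1 / real n"
proof -
  have n: "n > 0" using L by (cases n) auto
  have t: "2 * ln n \<le> t" "t \<le> 2 * ln n + 1"
    unfolding t_def using L by (simp_all add: of_nat_nat)
  show "1 \<le> t" "t \<le> 3 * ln n" using t L by linarith+
  \<comment> \<open>This is why t = 2 log n suffices: \<open>2 ^ t\<close> is at least exp (t /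
    2).\<close>
  have "exp (1/2) \<le> (2::real)"
    by (rule power2_le_imp_le) (use exp_le in \<open>simp_all add: power2_eq_square mult_exp_exp\<close>)
  have "real n = exp (1/2 * (2 * ln n))" using n by simp
  also have "\<dots> \<le> exp (1/2 * t)" using t by simp
  also have "\<dots> = exp (1/2) ^ t" by (simp add: exp_of_nat_mult[symmetric] mult.commute)
  also have "\<dots> \<le> 2 ^ t" using \<open>exp (1/2) \<le> (2::real)\<close> by (intro power_mono) auto
  finally show "1 / 2 ^ t \<le> 1 / real n" using n by (intro divide_left_mono) auto
qed

text \<open>Provides the hypothesis \<open>reach\<close> of
  \<open>unlikely_not_flippable_random_center\<close> for the margin \<open>u = g * N * b\<close>.
  After squaring, the gap between 1 - \<open>\<alpha>\<close> / 2 in \<open>b\<close> and 1 -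
  \<open>\<alpha>\<close> / 4 in the first square root pays for all relative errors:
  \<open>g\<close> from the norm of the center, \<open>3 * g\<close> from the margin, and two
  factors \<open>1 - g\<close> on the right.\<close>

lemma reach_inequality:
  fixes \<alpha> L \<rho> p N b \<theta> :: real
  assumes \<alpha>: "0 < \<alpha>" "\<alpha> < 1" and L: "L > 0" and \<rho>: "\<rho> \<ge> 0" and N: "N > 0"
  defines "g \<equiv> \<alpha> / 100"
  assumes b: "b = (1 - \<alpha> / 2) * (1 + sqrt (1 + \<rho>)) * L"
    and \<theta>: "(1 - g) * b \<le> \<theta>" "\<theta> \<le> (1 + g) * b" and p: "N * (\<rho> * L / 2) * (1 - g) \<le> p"
  shows "N * \<theta> + 3 * (g * N * b) \<le> sqrt (2 * L * (1 - \<alpha> / 4)) * sqrt ((1 - g) * (p * N + N\<^sup>2 * \<theta>))"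
proof -
  define k where "k = 1 - \<alpha> / 2"
  define b0 where "b0 = (1 + sqrt (1 + \<rho>)) * L"
  have k: "0 < k" "k < 1" using \<alpha> by (simp_all add: k_def)
  have g: "0 < g" "g < 1" using \<alpha> by (simp_all add: g_def)
  have b0: "b0 > 0" unfolding b0_def using L \<rho> by (intro mult_pos_pos add_pos_nonneg) auto
  have bk: "b = k * b0" by (simp add: b k_def b0_def)
  have bpos: "b > 0" using k b0 by (simp add: bk)
  define z where "z = b + \<rho> * L / 2"
  have z: "z > 0" using bpos \<rho> L by (simp add: z_def add_pos_nonneg)
  \<comment> \<open>The threshold \<open>b0\<close> solves \<open>b0\<^sup>2 / (b0 + p/N) = 2L\<close> for \<open>N = 2n/K\<close>: there a given point
    contradicts its label with probability about \<open>1/n\<close>.\<close>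
  have "b0\<^sup>2 = 2 * L * (b0 + \<rho> * L / 2)"
  proof -
    have s: "sqrt (1 + \<rho>) * sqrt (1 + \<rho>) = 1 + \<rho>" using \<rho> by simp
    show ?thesis unfolding b0_def power2_eq_square using s by algebra
  qed
  then have "b\<^sup>2 = 2 * L * k * (b + k * (\<rho> * L / 2))" unfolding bk by (simp add: power_mult_distrib algebra_simps power2_eq_square[of k])
  also have "\<dots> \<le> 2 * L * k * z"
    unfolding z_def using L k \<rho> by (intro mult_left_mono add_left_mono mult_left_le_one_le) auto
  finally have b2: "b\<^sup>2 \<le> 2 * L * k * z" .
  \<comment> \<open>To first order in \<open>\<alpha>\<close> the sides are 1 - 42/100
    \<open>\<alpha>\<close> and 1 - 27/100 \<open>\<alpha>\<close>; here \<open>g\<close> has to be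
    a small multiple of \<open>\<alpha>\<close>.\<close>
  have poly: "(1 + 4 * g)\<^sup>2 * k \<le> (1 - \<alpha> / 4) * (1 - g)\<^sup>2"
  proof -
    have a2: "0 \<le> \<alpha>\<^sup>2" "\<alpha>\<^sup>2 \<le> \<alpha>" using \<alpha> by (auto simp: power2_eq_square mult_le_cancel_left1)
    have "(1 + 4 * g)\<^sup>2 = 1 + 8/100 * \<alpha> + 16/10000 * \<alpha>\<^sup>2" by (simp add: g_def power2_eq_square field_simps)
    then have "(1 + 4 * g)\<^sup>2 \<le> 1 + 9/100 * \<alpha>" using a2 by linarith
    then have "(1 + 4 * g)\<^sup>2 * k \<le> (1 + 9/100 * \<alpha>) * k" using k by (intro mult_right_mono) auto
    also have "\<dots> = 1 - 41/100 * \<alpha> - 45/1000 * \<alpha>\<^sup>2" by (simp add: k_def power2_eq_square field_simps)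
    also have "\<dots> \<le> 1 - 27/100 * \<alpha> + 5/1000 * \<alpha>\<^sup>2" using a2 \<alpha> by linarith
    also have "\<dots> = (1 - \<alpha> / 4) * (1 - 2/100 * \<alpha>)" by (simp add: power2_eq_square field_simps)
    also have "\<dots> \<le> (1 - \<alpha> / 4) * (1 - g)\<^sup>2" using \<alpha> by (intro mult_left_mono) (simp_all add: g_def power2_eq_square algebra_simps)
    finally show ?thesis .
  qed
  have "N * \<theta> + 3 * (g * N * b) \<le> N * ((1 + g) * b) + 3 * (g * N * b)"
    using \<theta>(2) N by (intro add_right_mono mult_left_mono) auto
  also have "\<dots> = N * b * (1 + 4 * g)" by (simp add: algebra_simps)
  finally have lhs: "N * \<theta> + 3 * (g * N * b) \<le> N * b * (1 + 4 * g)" .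
  have "(N * b * (1 + 4 * g))\<^sup>2 = N\<^sup>2 * (b\<^sup>2 * (1 + 4 * g)\<^sup>2)" by (simp add: power_mult_distrib)
  also have "\<dots> \<le> N\<^sup>2 * (2 * L * k * z * (1 + 4 * g)\<^sup>2)" by (intro mult_left_mono mult_right_mono b2) auto
  also have "\<dots> = N\<^sup>2 * (2 * L * z * ((1 + 4 * g)\<^sup>2 * k))" by (simp add: algebra_simps)
  also have "\<dots> \<le> N\<^sup>2 * (2 * L * z * ((1 - \<alpha> / 4) * (1 - g)\<^sup>2))" using L z by (intro mult_left_mono poly) auto
  also have "\<dots> = (2 * L * (1 - \<alpha> / 4)) * ((1 - g) * (N * (\<rho> * L / 2) * (1 - g) * N + N\<^sup>2 * ((1 - g) * b)))"
  proof -
    have "(1 - g) * (N * w * (1 - g) * N + N\<^sup>2 * ((1 - g) * b)) = N\<^sup>2 * (b + w) * (1 - g)\<^sup>2" for w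
      by algebra
    note eq = this[of "\<rho> * L / 2"]
    show ?thesis unfolding z_def eq by (simp only: mult_ac)
  qed
  also have "\<dots> \<le> (2 * L * (1 - \<alpha> / 4)) * ((1 - g) * (p * N + N\<^sup>2 * \<theta>))"
    using L \<alpha> g N p \<theta>(1) by (intro mult_left_mono add_mono mult_right_mono) auto
  finally have "sqrt ((N * b * (1 + 4 * g))\<^sup>2) \<le> sqrt ((2 * L * (1 - \<alpha> / 4)) * ((1 - g) * (p * N + N\<^sup>2 * \<theta>)))"
    by (rule real_sqrt_le_mono)
  then have "N * b * (1 + 4 * g) \<le> sqrt (2 * L * (1 - \<alpha> / 4)) * sqrt ((1 - g) * (p * N + N\<^sup>2 * \<theta>))"
    using N bpos g by (simp add: real_sqrt_mult[of "2 * L * (1 - \<alpha> / 4)"] abs_of_nonneg)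
  then show ?thesis using lhs by linarith
qed

subsection \<open>The lower bound\<close>

text \<open>By \<open>growth_conditions\<close>, the assumptions \<open>growth\<close> hold for all
  \<open>n\<close> beyond a bound that depends on \<open>\<alpha>\<close> only.\<close>

locale below_threshold =
  fixes \<alpha> \<sigma> \<Delta> :: real and n K p :: nat
  assumes \<alpha>: "0 < \<alpha>" "\<alpha> < 1" and K: "2 \<le> K" "K \<le> n" "real K \<le> ln n" and p: "p \<ge> 1"
    and \<sigma>: "\<sigma> > 0" "\<Delta> > 0" and gap: "\<Delta>\<^sup>2 \<le> (1 - \<alpha>) * Delta_bar_sq n K p \<sigma>"
    and growth: "2 \<le> ln n" "1300 * (ln n)\<^sup>2 / (\<alpha> / 100)\<^sup>2 \<le> n / ln n" "16 * ln n / (\<alpha> / 100)\<^sup>2 \<le> \<alpha> * n"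
      "4 * ln n \<le> (\<alpha> / 100)\<^sup>2 / 2000 * (n / ln n) * reach_prob (sqrt (2 * ln n * (1 - \<alpha> / 4)))"
begin

definition g :: real where "g = \<alpha> / 100"
definition L :: real where "L = ln n"
definition x :: real where "x = real n / real K"
definition h :: nat where "h = nat \<lfloor>g\<^sup>2 / 1000 * (real n / real K)\<rfloor>"
definition t :: nat where "t = nat \<lceil>2 * ln (real n)\<rceil>"
definition S :: "nat set" where "S = switch_set n K h"
definition P :: "nat set" where "P = {i \<in> {1..n}. base_label n K i \<le> 2}"
definition R :: "nat set" where "R = P - S"
definition N :: real where "N = real (card R)"
text \<open>The level, in standard deviations, at which a point contradicts its label. It lies below
  sqrt (2 log n) by a constant factor, which makes \<open>reach_prob r\<close> larger than 1/n by a
  power of n, up to lower-order factors.\<close>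

definition r :: real where "r = sqrt (2 * L * (1 - \<alpha> / 4))"
definition \<rho> :: real where "\<rho> = real K * real p / (real n * ln (real n))"

lemma g: "0 < g" "g < 1" using \<alpha> by (simp_all add: g_def)

lemma L: "2 \<le> L" "real n = exp L" "real K \<le> L"
  using growth K by (simp_all add: L_def)

lemma n_pos: "real n > 0" using L(2) by simp

lemma exp_L: "exp (- L) = 1 / n"
  by (simp add: L(2) exp_minus field_simps)

lemma sizes: "h \<le> n div K" "card S = 2 * h" "g\<^sup>2 / 1000 * x \<le> card S" "card S \<le> g\<^sup>2 / 500 * x"
  "x \<le> N" "N \<le> 2 * x * (1 + g)" "1300 * L\<^sup>2 / g\<^sup>2 \<le> x" "n / L \<le> x"
  unfolding N_def R_def P_def S_def x_def h_def L_def
  by (fact switch_sizes[OF K g growth(1) growth(2)[folded g_def]])+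

lemma t: "1 \<le> t" "t \<le> 3 * L" "1 / 2 ^ t \<le> 1 / real n"
  using flip_count_bounds[OF growth(1)] by (simp_all add: t_def L_def)

lemma r: "r \<ge> 0" using L \<alpha> by (simp add: r_def)

lemma sets_labels: "S \<subseteq> P" "P \<subseteq> {1..n}" "finite S" "R \<subseteq> {1..n} - S"
  using switch_set_base_label(3,4)[OF K(1,2) sizes(1)] by (auto simp: S_def P_def R_def)

lemma x_pos: "x > 0" using K by (simp add: x_def)

lemma N_pos: "N > 0" using x_pos sizes(5) by (rule less_le_trans)

lemma R_nonempty: "R \<noteq> {}" using N_pos by (auto simp: N_def)

lemma \<rho>_nonneg: "\<rho> \<ge> 0" using L(1) by (simp add: \<rho>_def L_def)

lemma p_eq: "real p = \<rho> * L * x"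
  using L(1) n_pos K by (simp add: \<rho>_def x_def L_def)

text \<open>The growth condition gives \<open>card S * reach_prob r / 2 \<ge> 4 * L\<close>, and
  \<open>t \<le> 3 * L\<close> leaves \<open>- L\<close> in the exponent.\<close>

lemma count_tail: "exp (t - card S * reach_prob r / 2) \<le> 1 / n"
proof -
  have q: "reach_prob r \<ge> 0" by (simp add: reach_prob_def)
  have "4 * L \<le> g\<^sup>2 / 2000 * (n / L) * reach_prob r"
    using growth(4) by (simp add: g_def L_def r_def)
  also have "\<dots> \<le> g\<^sup>2 / 2000 * x * reach_prob r"
    using q sizes(8) by (intro mult_right_mono mult_left_mono) auto
  also have "\<dots> = g\<^sup>2 / 1000 * x * (reach_prob r / 2)" by simp
  also have "\<dots> \<le> card S * (reach_prob r / 2)"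
    using q sizes(3) by (intro mult_right_mono) auto
  finally have "t - card S * reach_prob r / 2 \<le> - L" using t(2) by simp
  then show ?thesis unfolding exp_L[symmetric] by simp
qed

lemma center_norm: "(\<Delta> / (2 * \<sigma>))\<^sup>2 \<le> (1 - \<alpha>) * ((1 + sqrt (1 + \<rho>)) * L)"
proof -
  have "\<Delta>\<^sup>2 / (4 * \<sigma>\<^sup>2) \<le> ((1 - \<alpha>) * (4 * \<sigma>\<^sup>2 * (1 + sqrt (1 + \<rho>)) * L)) / (4 * \<sigma>\<^sup>2)"
    using gap by (intro divide_right_mono) (simp_all add: Delta_bar_sq_def \<rho>_def L_def)
  also have "\<dots> = (1 - \<alpha>) * ((1 + sqrt (1 + \<rho>)) * L)" using \<sigma> by simp
  finally show ?thesis by (simp add: power_divide power_mult_distrib)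
qed

text \<open>Uses \<open>K \<ge> 2\<close>. The number 34 lies just above 32 = 4 (1 + 5 + 2), the
  total error in the case of a random center.\<close>

lemma error_level: "34 / n \<le> 17 * real K / n"
  using K n_pos by (intro divide_right_mono) auto

lemma mixture:
  assumes "prob_space \<pi>" "sets \<pi> = sets (vectors p)"
  shows "sign_mixture {1..n} P S p \<pi> (\<lambda>_. 1)"
  by (rule sign_mixture.intro) (use assms sets_labels in auto)

text \<open>A known center of norm \<open>d\<close> is contradicted by a point when a standard
  normal variable exceeds \<open>d\<close>. For \<open>\<rho> \<le> \<alpha>\<close> the threshold
  is close to its value at \<open>\<rho> = 0\<close>, and the factor \<open>1 - \<alpha>\<close>
  gives \<open>d \<le> r\<close>.\<close>

lemma lower_bound_small_dimension:
  assumes \<rho>: "\<rho> \<le> \<alpha>"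
  shows "ereal (1 - 17 * real K / n) \<le> minimax_risk 3 n K p \<sigma> \<Delta>"
proof -
  define d where "d = \<Delta> / (2 * \<sigma>)"
  define \<theta> where "\<theta> = (\<lambda>j\<in>{1..p}. if j = 1 then d else 0)"
  define B where "B = (vectors p)"
  define \<pi> where "\<pi> = return B \<theta>"
  have d: "d > 0" using \<sigma> by (simp add: d_def)
  have "sq p \<theta> = (\<Sum>j\<in>{1..p}. if j = 1 then d\<^sup>2 else 0)"
    unfolding dot_def by (intro sum.cong refl) (simp add: \<theta>_def power2_eq_square)
  also have "\<dots> = d\<^sup>2" using p by simp
  finally have dot: "sq p \<theta> = d\<^sup>2" .
  have \<theta>_ext: "\<theta> \<in> extensional {1..p}" by (simp add: \<theta>_def)
  have \<theta>_space: "\<theta> \<in> space B" using \<theta>_ext by (simp add: B_def space_PiM PiE_def)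
  have single: "{\<theta>} \<in> sets B"
  proof -
    have "Pi\<^sub>E {1..p} (\<lambda>j. {\<theta> j}) \<in> sets B" unfolding B_def by (intro sets_PiM_I_finite) auto
    then show ?thesis using PiE_singleton[OF \<theta>_ext] by simp
  qed
  have prior: "prob_space \<pi>" "sets \<pi> = sets (vectors p)"
    unfolding \<pi>_def using \<theta>_space by (auto intro: prob_space_return simp: B_def)
  have d_r: "d \<le> r"
  proof -
    have "sqrt (1 + \<rho>) \<le> 1 + \<alpha> / 2"
    proof (rule real_le_lsqrt)
      have "(1 + \<alpha> / 2)\<^sup>2 = 1 + \<alpha> + \<alpha>\<^sup>2 / 4" by (simp add: power2_eq_square field_simps)
      then show "1 + \<rho> \<le> (1 + \<alpha> / 2)\<^sup>2" using \<rho> zero_le_power2[of \<alpha>] by linarith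
    qed (use \<alpha> in simp)
    then have "(1 - \<alpha>) * ((1 + sqrt (1 + \<rho>)) * L) \<le> (1 - \<alpha>) * ((2 + \<alpha> / 2) * L)"
      using \<alpha> L by (intro mult_left_mono mult_right_mono) auto
    also have "\<dots> = (1 - \<alpha>) * (2 + \<alpha> / 2) * L" by (rule mult.assoc[symmetric])
    also have "\<dots> \<le> 2 * (1 - \<alpha> / 4) * L"
    proof (rule mult_right_mono)
      have "(1 - \<alpha>) * (2 + \<alpha> / 2) = 2 - 3 / 2 * \<alpha> - \<alpha>\<^sup>2 / 2" by (simp add: power2_eq_square field_simps)
      also have "\<dots> \<le> 2 - 3 / 2 * \<alpha>" by simp
      also have "\<dots> \<le> 2 - \<alpha> / 2" using \<alpha> by simp
      finally show "(1 - \<alpha>) * (2 + \<alpha> / 2) \<le> 2 * (1 - \<alpha> / 4)" by (simp add: right_diff_distrib)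
    qed (use L in simp)
    finally have "(1 - \<alpha>) * ((1 + sqrt (1 + \<rho>)) * L) \<le> 2 * (1 - \<alpha> / 4) * L" .
    from order_trans[OF center_norm this] have "d\<^sup>2 \<le> 2 * L * (1 - \<alpha> / 4)"
      unfolding d_def by (simp only: mult_ac)
    then show ?thesis unfolding r_def by (rule real_le_rsqrt)
  qed
  have flip: "unlikely (noise {1..n} p) (\<lambda>e. \<not> sign_mixture.flippable P S p t \<pi> (\<lambda>i j. \<theta> j + e i j)) (1 / n)"
  proof (rule unlikely_mono)
    \<comment> \<open>\<open>noise_count_lower\<close> with empty \<open>R\<close>, shift
      \<open>\<theta>\<close> and \<open>x = 0\<close>: the direction is the constant
      \<open>\<theta>\<close>.\<close>
    let ?w = "\<lambda>e j. \<theta> j + (\<Sum>k\<in>{}. e k j)"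
    let ?E = "\<lambda>e. 0 < sq p (?w e) \<and> 0 + dot p \<theta> (?w e) \<le> r * sqrt (sq p (?w e)) \<and>
      card {i \<in> S. dot p (\<lambda>j. \<theta> j + e i j) (?w e) \<le> - 0} \<le> t"
    show "unlikely (noise {1..n} p) ?E (exp (t - card S * reach_prob r / 2))"
      by (rule noise_count_lower) (use sets_labels r in auto)
    show "exp (t - card S * reach_prob r / 2) \<le> 1 / n" by (rule count_tail)
    fix e assume bad: "\<not> sign_mixture.flippable P S p t \<pi> (\<lambda>i j. \<theta> j + e i j)"
    have "card {i \<in> S. dot p (\<lambda>j. \<theta> j + e i j) \<theta> \<le> 0} \<le> t"
    proof (rule ccontr)
      assume "\<not> card {i \<in> S. dot p (\<lambda>j. \<theta> j + e i j) \<theta> \<le> 0} \<le> t"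
      then have "t \<le> card {i \<in> S. dot p (\<lambda>j. \<theta> j + e i j) \<theta> \<le> 0}" by simp
      then obtain G where G: "G \<subseteq> {i \<in> S. dot p (\<lambda>j. \<theta> j + e i j) \<theta> \<le> 0}" "card G = t"
        by (elim obtain_subset_with_card_n)
      have "sign_mixture.flippable P S p t \<pi> (\<lambda>i j. \<theta> j + e i j)"
        by (rule sign_mixture.flippable_point_prior[OF mixture[OF prior] \<pi>_def[unfolded B_def] \<theta>_ext _ G(2)]) (use G(1) in auto)
      with bad show False by contradiction
    qed
    moreover have "d\<^sup>2 \<le> r * sqrt (d\<^sup>2)" using d d_r by (simp add: power2_eq_square)
    ultimately show "?E e"
      using d by (simp add: dot)
  qed
  show ?thesis
  proof (rule minimax_risk_ge_bayes[OF K p \<sigma> sizes(1) prior, where B = d and \<beta> = "1 / n" and \<beta>' = 0])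
    show "{\<theta>} \<in> sets \<pi>" using single by (simp add: \<pi>_def)
    show "1 - 0 \<le> measure \<pi> {\<theta>}" using single by (simp add: \<pi>_def measure_return)
    show "\<Delta> / \<sigma> \<le> 2 * sqrt (sq p \<theta>')" if "\<theta>' \<in> {\<theta>}" for \<theta>'
      using that d by (simp add: dot) (simp add: d_def)
    show "\<bar>\<theta>' 1\<bar> \<le> d" if "\<theta>' \<in> {\<theta>}" for \<theta>'
      using that d p by (simp add: \<theta>_def)
    show "unlikely (noise {1..n} p) (\<lambda>e. \<not> sign_mixture.flippable {i \<in> {1..n}. base_label n K i \<le> 2}
        (switch_set n K h) p t \<pi> (\<lambda>i j. \<theta>' j + e i j)) (1 / n)" if "\<theta>' \<in> {\<theta>}" for \<theta>'
      using that flip by (simp add: P_def S_def)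
    have "4 * (1 / 2 ^ t + 1 / n + 0) \<le> 8 / n" using t(3) by simp
    also have "\<dots> < 34 / n" using n_pos by (intro divide_strict_right_mono) auto
    finally show "4 * (1 / 2 ^ t + 1 / n + 0) < 17 * real K / n" using error_level by linarith
  qed simp_all
qed

text \<open>The prior variance is \<open>b / p\<close>, so the squared norm of the center is close
  to \<open>b\<close>, between the required \<open>(\<Delta> / (2 * \<sigma>))^2\<close> and the
  critical value. Most of the proof checks the numerical hypotheses of
  \<open>unlikely_not_flippable_random_center\<close>.\<close>

lemma lower_bound_large_dimension:
  assumes \<rho>: "\<alpha> \<le> \<rho>"
  shows "ereal (1 - 17 * real K / n) \<le> minimax_risk 3 n K p \<sigma> \<Delta>"
proof -
  define s where "s = 1 + sqrt (1 + \<rho>)"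
  define b where "b = (1 - \<alpha> / 2) * (1 + sqrt (1 + \<rho>)) * L"
  define \<tau> where "\<tau> = sqrt (b / p)"
  define \<pi> where "\<pi> = isotropic_gaussian p \<tau>"
  define T0 where "T0 = {\<theta> \<in> space (isotropic_gaussian p \<tau>). (1 - g) * (\<tau>\<^sup>2 * p) \<le> sq p \<theta> \<and> sq p \<theta> \<le> (1 + g) * (\<tau>\<^sup>2 * p)}"
  \<comment> \<open>The drift \<open>N * sq p \<theta>\<close> is about \<open>N * b\<close>, so
    this margin is a fraction \<open>g\<close> of it, small enough for
    \<open>reach_inequality\<close>.\<close>
  define u where "u = g * N * b"
  define m where "m = real (card S)"
  have L0: "L > 0" using L(1) by simp
  have g2: "0 < g\<^sup>2" "g\<^sup>2 \<le> 1" using g by (simp_all add: power_le_one)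
  have s: "2 \<le> s" "\<rho> \<le> s\<^sup>2"
  proof -
    have "1 \<le> sqrt (1 + \<rho>)" using \<rho>_nonneg by simp
    then show "2 \<le> s" by (simp add: s_def)
    have "\<rho> \<le> (sqrt (1 + \<rho>))\<^sup>2" using \<rho>_nonneg by simp
    also have "\<dots> \<le> s\<^sup>2" unfolding s_def using \<rho>_nonneg by (intro power_mono) auto
    finally show "\<rho> \<le> s\<^sup>2" .
  qed
  have b_s: "s * L / 2 \<le> b"
  proof -
    have "1/2 * (s * L) \<le> (1 - \<alpha> / 2) * (s * L)" using \<alpha> s L0 by (intro mult_right_mono) auto
    then show ?thesis by (simp add: b_def s_def mult.assoc)
  qed
  have b_L: "L \<le> b"
  proof -
    have "2 * L \<le> s * L" using s(1) L0 by (intro mult_right_mono) auto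
    then show ?thesis using b_s by linarith
  qed
  have b0: "b > 0" using b_L L0 by linarith
  have b2: "\<rho> * L\<^sup>2 \<le> 4 * b\<^sup>2"
  proof -
    have "\<rho> * L\<^sup>2 \<le> s\<^sup>2 * L\<^sup>2" using s(2) by (intro mult_right_mono) auto
    also have "\<dots> = 4 * (s * L / 2)\<^sup>2" by (simp add: power_mult_distrib power_divide)
    also have "\<dots> \<le> 4 * b\<^sup>2" using b_s s(1) L0 by (intro mult_left_mono power_mono) auto
    finally show ?thesis .
  qed
  have p0: "real p > 0" using p by simp
  have \<tau>: "\<tau> > 0" "\<tau>\<^sup>2 * p = b" using b0 p0 by (simp_all add: \<tau>_def)
  have u0: "u > 0" using g N_pos b0 by (simp add: u_def)
  have gN: "1300 * L\<^sup>2 \<le> g\<^sup>2 * N"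
  proof -
    have "1300 * L\<^sup>2 \<le> g\<^sup>2 * x" using sizes(7) g2 by (simp add: field_simps)
    also have "\<dots> \<le> g\<^sup>2 * N" using sizes(5) g2 by (intro mult_left_mono) auto
    finally show ?thesis .
  qed
  have L2: "2 * L \<le> L\<^sup>2" using L(1) mult_right_mono[of 2 L L] by (simp add: power2_eq_square)
  have g_le: "g\<^sup>2 * N \<le> g * N"
    using g N_pos by (simp add: power2_eq_square mult_le_cancel_right1)
  have m: "0 \<le> m" "m \<le> g\<^sup>2 * N / 500"
  proof -
    have "g\<^sup>2 / 500 * x \<le> g\<^sup>2 / 500 * N" using sizes(5) by (intro mult_left_mono) auto
    then show "m \<le> g\<^sup>2 * N / 500" using sizes(4) by (simp add: m_def)
  qed (simp add: m_def)
  define a where "a = 6 * L / u"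
  have a0: "a > 0" using L0 u0 by (simp add: a_def)
  \<comment> \<open>As \<open>L \<le> b\<close>, multiplication by \<open>a\<close> turns every
    small multiple of \<open>g * N\<close> into a small constant; \<open>card S\<close> and
    \<open>t\<close> are such multiples.\<close>
  have agN: "a * (g * N) \<le> 6"
  proof -
    have "a * (g * N) = 6 * (L / b)" using g N_pos b0 by (simp add: a_def u_def)
    also have "\<dots> \<le> 6 * 1" using b_L b0 by (intro mult_left_mono) auto
    finally show ?thesis by simp
  qed
  have a_small: "a * k \<le> 6 * q" if "k \<le> q * (g * N)" "q \<ge> 0" for k q
  proof -
    have "a * k \<le> a * (q * (g * N))" using that a0 by (intro mult_left_mono) auto
    also have "\<dots> = q * (a * (g * N))" by simp
    also have "\<dots> \<le> q * 6" using that agN by (intro mult_left_mono) auto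
    finally show ?thesis by simp
  qed
  have m_gN: "m \<le> g / 500 * (g * N)" using m(2) by (simp add: power2_eq_square)
  have am: "a * m \<le> 6 * (g / 500)" by (rule a_small[OF m_gN]) (use g in simp)
  have gN_big: "2600 * L \<le> g * N" using gN g_le L2 by linarith
  have a1: "a \<le> 1/2"
  proof -
    have "a * 1 \<le> 6 * (1/12)" by (rule a_small) (use gN_big L(1) in simp_all)
    then show ?thesis by simp
  qed
  have t_gN: "real t \<le> 3 / 2600 * (g * N)" using t(2) gN_big by linarith
  have at: "a * t \<le> 6 * (3 / 2600)" by (rule a_small[OF t_gN]) simp
  \<comment> \<open>The dimension enters through \<open>p = \<rho> * L * x\<close>, and
    \<open>\<rho> * L^2\<close> is at most \<open>4 * b^2\<close>. This keeps the pure noise part of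
    the interactions below a multiple of \<open>L\<close>.\<close>
  have pa: "p * a\<^sup>2 * (g\<^sup>2 * N) \<le> 144 * L"
  proof -
    have "p * a\<^sup>2 * (g\<^sup>2 * N) = 36 * L * (\<rho> * L\<^sup>2 / b\<^sup>2) * (x / N)"
      using g N_pos b0 by (simp add: a_def u_def p_eq power_divide power_mult_distrib) (simp add: power2_eq_square field_simps)
    also have "\<dots> \<le> 36 * L * 4 * 1"
    proof (intro mult_mono mult_left_mono)
      show "\<rho> * L\<^sup>2 / b\<^sup>2 \<le> 4" using b2 b0 by (simp add: divide_le_eq)
      show "x / N \<le> 1" using sizes(5) N_pos by simp
    qed (use L0 x_pos N_pos \<rho>_nonneg in auto)
    finally show ?thesis by simp
  qed
  have pak: "p * a\<^sup>2 * k \<le> 144 * L * q" if "k \<le> q * (g\<^sup>2 * N)" "q \<ge> 0" for k q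
  proof -
    have "p * a\<^sup>2 * k \<le> p * a\<^sup>2 * (q * (g\<^sup>2 * N))" using that by (intro mult_left_mono) auto
    also have "\<dots> = q * (p * a\<^sup>2 * (g\<^sup>2 * N))" by simp
    also have "\<dots> \<le> q * (144 * L)" using that pa by (intro mult_left_mono) auto
    finally show ?thesis by (simp add: mult_ac)
  qed
  have pam: "p * a\<^sup>2 * m \<le> 144 * L * (1 / 500)" by (rule pak) (use m(2) in simp_all)
  have pat: "p * a\<^sup>2 * (real t * real t) \<le> 144 * L * (9 / 1300)"
  proof (rule pak)
    have "real t * real t \<le> (3 * L) * (3 * L)" using t(2) by (intro mult_mono) auto
    also have "\<dots> = 9 * L\<^sup>2" by (simp add: power2_eq_square)
    also have "\<dots> \<le> 9 / 1300 * (g\<^sup>2 * N)" using gN by linarith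
    finally show "real t * real t \<le> 9 / 1300 * (g\<^sup>2 * N)" .
  qed simp
  \<comment> \<open>The reason for separating the cases at \<open>\<rho> = \<alpha>\<close>: here
    \<open>p\<close> is at least of order \<open>n\<close>, because \<open>K \<le> log n\<close>,
    and the norm of the center concentrates up to probability 2/n.\<close>
  have p_n: "\<alpha> * n \<le> p"
  proof -
    have "\<alpha> * n = \<alpha> * L * (n / L)" using L0 by simp
    also have "\<dots> \<le> \<rho> * L * x" using \<rho> \<alpha> L0 sizes(8) by (intro mult_mono) auto
    finally show ?thesis by (simp add: p_eq)
  qed
  have gp: "16 * L \<le> g\<^sup>2 * p"
  proof -
    have "16 * L / g\<^sup>2 \<le> p" using growth(3) p_n by (simp add: g_def L_def)
    then show ?thesis using g2 by (simp add: divide_le_eq mult.commute)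
  qed
  have n32: "32 \<le> real n"
  proof -
    have "16 * L * 1 \<le> 16 * L * (1 / g\<^sup>2)" using g2 L0 by (intro mult_left_mono) auto
    also have "\<dots> \<le> \<alpha> * n" using growth(3) by (simp add: g_def L_def)
    also have "\<dots> \<le> n" using \<alpha> by (simp add: mult_le_cancel_right2)
    finally show ?thesis using L(1) by linarith
  qed
  have prior: "prob_space \<pi>" "sets \<pi> = sets (vectors p)"
    unfolding \<pi>_def using prob_space_isotropic_gaussian[OF \<tau>(1)] sets_isotropic_gaussian by auto
  have flip: "unlikely (noise {1..n} p) (\<lambda>e. \<not> sign_mixture.flippable P S p t \<pi> (\<lambda>i j. \<theta> j + e i j)) (5 / n)"
    if \<theta>: "\<theta> \<in> T0" for \<theta>
  proof -
    define v where "v = sq p \<theta>"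
    have v: "(1 - g) * b \<le> v" "v \<le> (1 + g) * b" using \<theta> by (simp_all add: T0_def \<tau> v_def)
    have v0: "v > 0" using v(1) g b0 by (intro less_le_trans[OF _ v(1)] mult_pos_pos) auto
    have v2: "v \<le> 2 * b"
    proof -
      have "(1 + g) * b \<le> 2 * b" using g b0 by (intro mult_right_mono) auto
      then show ?thesis using v(2) by linarith
    qed
    have va: "4 * v * a * k \<le> 48 * L * q" if "k \<le> q * (g * N)" "q \<ge> 0" for k q
    proof -
      have "4 * v * a * k \<le> 4 * v * a * (q * (g * N))" using that a0 v0 by (intro mult_left_mono) auto
      also have "\<dots> \<le> 4 * (2 * b) * a * (q * (g * N))"
        using that a0 v2 g N_pos by (intro mult_right_mono) auto
      also have "\<dots> = 48 * L * q" using g N_pos b0 by (simp add: a_def u_def)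
      finally show ?thesis .
    qed
    have vam: "4 * v * a * m \<le> 48 * L * (1 / 500)"
    proof (rule va)
      have "g / 500 * (g * N) \<le> 1 / 500 * (g * N)" using g N_pos by (intro mult_right_mono) auto
      then show "m \<le> 1 / 500 * (g * N)" using m_gN by linarith
    qed simp
    have vat: "4 * v * a * t \<le> 48 * L * (3 / 2600)" by (rule va[OF t_gN]) simp
    have reach: "card R * sq p \<theta> + 3 * u \<le> r * sqrt ((1 - g) * (p * card R + (card R)\<^sup>2 * sq p \<theta>))"
    proof -
      have "N * (\<rho> * L / 2) * (1 - g) \<le> p"
      proof -
        have "N * (1 - g) \<le> 2 * x * (1 + g) * (1 - g)" using sizes(6) g by (intro mult_right_mono) auto
        also have "\<dots> = 2 * x * (1 - g\<^sup>2)" by (simp add: power2_eq_square algebra_simps)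
        also have "\<dots> \<le> 2 * x * 1" using x_pos g2 by (intro mult_left_mono) auto
        finally have "\<rho> * L / 2 * (N * (1 - g)) \<le> \<rho> * L / 2 * (2 * x)"
          using \<rho>_nonneg L0 by (intro mult_left_mono) auto
        then show ?thesis by (simp add: p_eq mult_ac)
      qed
      from reach_inequality[OF \<alpha> L0 \<rho>_nonneg N_pos b_def v[unfolded g_def] this[unfolded g_def]]
      show ?thesis by (simp add: N_def u_def r_def v_def g_def mult_ac)
    qed
    have asq: "a\<^sup>2 * card S \<le> 1/2"
    proof -
      have "a\<^sup>2 * card S = a * (a * m)" by (simp add: m_def power2_eq_square)
      also have "\<dots> \<le> 1/2 * (6 * (g / 500))" using a0 m by (intro mult_mono[OF a1 am]) auto
      also have "\<dots> \<le> 1/2" using g by simp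
      finally show ?thesis .
    qed
    have bt: "6 * L * t / u = a * t" by (simp add: a_def)
    let ?flip = "\<lambda>e. \<exists>G\<subseteq>S. card G = t \<and> (\<forall>T\<subseteq>G.
        dot p (\<lambda>j. \<Sum>i\<in>T. \<theta> j + e i j) (\<lambda>j. (\<Sum>k\<in>R. \<theta> j + e k j) + (\<Sum>k\<in>S-T. \<theta> j + e k j)) \<le> 0)"
    let ?bound = "exp (- (u\<^sup>2 / (2 * card R * sq p \<theta>))) + exp (- (g\<^sup>2 * p / 8))
      + card S * exp (- (3 * L)) + card S * (card S * exp (- (3 * L))) + exp (t - card S * reach_prob r / 2)"
    have ex: "unlikely (noise {1..n} p) (\<lambda>e. \<not> ?flip e) ?bound"
    proof (rule unlikely_not_flippable_random_center[where a = a and b = "a * t"])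
      show "finite {1..n}" "S \<subseteq> {1..n}" "R \<subseteq> {1..n} - S" "R \<noteq> {}" using sets_labels R_nonempty by auto
      show "t \<ge> 1" "0 < g" "g < 1" "u > 0" "r \<ge> 0" "a > 0" using t g u0 r a0 by auto
      show "sq p \<theta> > 0" using v0 by (simp add: v_def)
      show "card R * sq p \<theta> + 3 * u \<le> r * sqrt ((1 - g) * (p * card R + (card R)\<^sup>2 * sq p \<theta>))" by (rule reach)
      show "a = 6 * L / u" "a * t = 6 * L * t / u" by (simp_all add: a_def)
      show "a \<le> 1" "a * t \<le> 1/2" using a1 at by linarith+
      show "a\<^sup>2 * card S \<le> 1/2" by (rule asq)
      show "a * card S \<le> 1" using am g by (simp add: m_def)
      show "4 * sq p \<theta> * a * card S + p * a\<^sup>2 * card S \<le> 3 * L"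
        using vam pam L0 unfolding v_def m_def by linarith
      show "4 * sq p \<theta> * (a * t) + p * (a * t)\<^sup>2 \<le> 3 * L"
      proof -
        have "p * (a * t)\<^sup>2 = p * a\<^sup>2 * (real t * real t)" by (simp add: power_mult_distrib) (simp add: power2_eq_square)
        moreover have "4 * sq p \<theta> * (a * t) = 4 * v * a * t" by (simp add: v_def)
        ultimately show ?thesis using vat pat L0 by linarith
      qed
    qed
    show ?thesis
    proof (rule unlikely_mono[OF ex])
      fix e
      assume bad: "\<not> sign_mixture.flippable P S p t \<pi> (\<lambda>i j. \<theta> j + e i j)"
      show "\<not> ?flip e"
      proof (rule notI, elim exE conjE)
        fix G assume G: "G \<subseteq> S" "card G = t" and le: "\<forall>T\<subseteq>G.
          dot p (\<lambda>j. \<Sum>i\<in>T. \<theta> j + e i j) (\<lambda>j. (\<Sum>k\<in>R. \<theta> j + e k j) + (\<Sum>k\<in>S-T. \<theta> j + e k j)) \<le> 0"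
        have "sign_mixture.flippable P S p t \<pi> (\<lambda>i j. \<theta> j + e i j)"
          by (rule sign_mixture.flippable_gaussian_prior[OF mixture[OF prior] \<pi>_def \<tau>(1) R_def G]) (use le in blast)
        with bad show False by contradiction
      qed
    next
      have e1: "exp (- (u\<^sup>2 / (2 * card R * sq p \<theta>))) \<le> 1 / n"
      proof -
        have "L * (2 * N * v) \<le> L * (2 * N * (2 * b))"
          using L0 N_pos v2 by (intro mult_left_mono) auto
        also have "\<dots> = 4 * L * (N * b)" by simp
        also have "\<dots> \<le> (g\<^sup>2 * N * b) * (N * b)"
        proof (rule mult_right_mono)
          have "1 \<le> L\<^sup>2" using L2 L(1) by linarith
          then have "4 * L \<le> (g\<^sup>2 * N) * L" using gN L0 by (intro mult_right_mono) auto
          also have "\<dots> \<le> g\<^sup>2 * N * b" using b_L g2 N_pos by (intro mult_left_mono) auto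
          finally show "4 * L \<le> g\<^sup>2 * N * b" .
        qed (use N_pos b0 in auto)
        also have "\<dots> = u\<^sup>2" by (simp add: u_def power2_eq_square)
        finally have "L \<le> u\<^sup>2 / (2 * N * v)" using N_pos v0 by (simp add: le_divide_eq)
        then have "exp (- (u\<^sup>2 / (2 * N * v))) \<le> exp (- L)" by simp
        then show ?thesis by (simp add: exp_L N_def v_def)
      qed
      have e2: "exp (- (g\<^sup>2 * p / 8)) \<le> 1 / n"
        unfolding exp_L[symmetric] using gp L0 by simp
      have e3L: "exp (- (3 * L)) = 1 / n ^ 3"
      proof -
        have "exp (- (3 * L)) = exp (- L) ^ 3" by (simp add: exp_of_nat_mult[symmetric])
        then show ?thesis by (simp add: exp_L power_divide)
      qed
      have mn: "real (card S) \<le> n"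
        using card_mono[of "{1..n}" S] sets_labels by auto
      have e4: "card S * (card S * exp (- (3 * L))) \<le> 1 / n"
      proof -
        have "card S * (card S * exp (- (3 * L))) \<le> n * (n * exp (- (3 * L)))"
          using mn by (intro mult_mono mult_right_mono) auto
        also have "\<dots> = 1 / n" using n_pos by (simp add: e3L power3_eq_cube)
        finally show ?thesis .
      qed
      have e3: "card S * exp (- (3 * L)) \<le> 1 / n"
      proof -
        have "card S * exp (- (3 * L)) \<le> n * exp (- (3 * L))" using mn by (intro mult_right_mono) auto
        also have "\<dots> \<le> n * (n * exp (- (3 * L)))"
          using n32 by (intro mult_left_mono) (auto simp: mult_le_cancel_right1)
        also have "\<dots> = 1 / n" using n_pos by (simp add: e3L power3_eq_cube)
        finally show ?thesis .
      qed
      have "?bound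
        \<le> 1 / n + 1 / n + 1 / n + 1 / n + 1 / n"
        by (intro add_mono e1 e2 e3 e4 count_tail)
      then show "?bound \<le> 5 / n" by simp
    qed
  qed
  show ?thesis
  proof (rule minimax_risk_ge_bayes[OF K p \<sigma> sizes(1) prior, where B = "sqrt ((1 + g) * b)" and \<beta> = "5 / n" and \<beta>' = "2 / n"])
    show "T0 \<in> sets \<pi>" unfolding T0_def \<pi>_def by (rule isotropic_gaussian_norm(1)[OF g \<tau>(1)])
    have "exp (- (g\<^sup>2 * p / 16)) \<le> 1 / n" unfolding exp_L[symmetric] using gp by simp
    then have "1 - 2 / n \<le> 1 - 2 * exp (- (g\<^sup>2 * p / 16))" by simp
    also have "\<dots> \<le> measure \<pi> T0" unfolding T0_def \<pi>_def by (rule isotropic_gaussian_norm(2)[OF g \<tau>(1)])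
    finally show "1 - 2 / n \<le> measure \<pi> T0" .
    fix \<theta> assume \<theta>: "\<theta> \<in> T0"
    show "\<Delta> / \<sigma> \<le> 2 * sqrt (sq p \<theta>)"
    proof -
      \<comment> \<open>The factor 1 - \<open>\<alpha>\<close> / 2 in \<open>b\<close>, instead of 1
        - \<open>\<alpha>\<close>, leaves room for the relative fluctuation \<open>g\<close> of the
        squared norm.\<close>
      have "(1 - \<alpha>) * (s * L) \<le> ((1 - g) * (1 - \<alpha> / 2)) * (s * L)"
      proof (rule mult_right_mono)
        have "1 - \<alpha> \<le> 1 - \<alpha> / 2 - \<alpha> / 100" using \<alpha> by simp
        also have "\<dots> \<le> 1 - \<alpha> / 2 - \<alpha> / 100 + \<alpha>\<^sup>2 / 200" by simp
        also have "\<dots> = (1 - g) * (1 - \<alpha> / 2)" by (simp add: g_def power2_eq_square field_simps)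
        finally show "1 - \<alpha> \<le> (1 - g) * (1 - \<alpha> / 2)" .
      qed (use s(1) L0 in simp)
      also have "\<dots> = (1 - g) * b" by (simp add: b_def s_def mult_ac)
      also have "\<dots> \<le> sq p \<theta>" using \<theta> by (simp add: T0_def \<tau>)
      finally have "(\<Delta> / (2 * \<sigma>))\<^sup>2 \<le> sq p \<theta>" using center_norm by (simp add: s_def)
      then have "\<Delta> / (2 * \<sigma>) \<le> sqrt (sq p \<theta>)" by (rule real_le_rsqrt)
      then show ?thesis using \<sigma> by (simp add: field_simps)
    qed
    show "\<bar>\<theta> 1\<bar> \<le> sqrt ((1 + g) * b)"
    proof (rule real_le_rsqrt)
      have "\<bar>\<theta> 1\<bar>\<^sup>2 = \<theta> 1 * \<theta> 1" by (simp add: power2_eq_square)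
      also have "\<dots> \<le> sq p \<theta>" unfolding dot_def using p by (intro member_le_sum) auto
      also have "\<dots> \<le> (1 + g) * b" using \<theta> by (simp add: T0_def \<tau>)
      finally show "\<bar>\<theta> 1\<bar>\<^sup>2 \<le> (1 + g) * b" .
    qed
    show "unlikely (noise {1..n} p) (\<lambda>e. \<not> sign_mixture.flippable {i \<in> {1..n}. base_label n K i \<le> 2}
        (switch_set n K h) p t \<pi> (\<lambda>i j. \<theta> j + e i j)) (5 / n)"
      using flip[OF \<theta>] by (simp add: P_def S_def)
  next
    \<comment> \<open>1 from the posterior bound, 5 from the exceptional set, 2 from the centers
      outside \<open>T0\<close>.\<close>
    have "4 * (1 / 2 ^ t + 5 / n + 2 / n) \<le> 32 / n" using t(3) by simp
    also have "\<dots> < 34 / n" using n_pos by (intro divide_strict_right_mono) auto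
    finally show "4 * (1 / 2 ^ t + 5 / n + 2 / n) < 17 * real K / n" using error_level by linarith
  qed (use n32 in \<open>auto simp: field_simps\<close>)
qed

end

theorem theorem2p3:
  shows "\<exists>C>0. \<forall>\<alpha>\<in>{0<..<1}. \<exists>c>0. \<forall>(n::nat) (K::nat) (p::nat) (\<sigma>::real) (\<Delta>::real).
     n \<ge> 2 \<longrightarrow> 2 \<le> K \<longrightarrow> K \<le> n \<longrightarrow> p \<ge> 1 \<longrightarrow> \<sigma> > 0 \<longrightarrow> \<Delta> > 0 \<longrightarrow>
     \<Delta>\<^sup>2 \<le> (1 - \<alpha>) * Delta_bar_sq n K p \<sigma> \<longrightarrow> real K \<le> ln (real n) \<longrightarrow>
     minimax_risk C n K p \<sigma> \<Delta> \<ge> ereal (1 - c * real K / real n)"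
\<comment> \<open>The constant 3 is the one of \<open>delta_n_bound\<close>.\<close>
proof (rule exI[of _ 3], intro conjI ballI)
  fix \<alpha> :: real assume "\<alpha> \<in> {0<..<1}"
  then have \<alpha>: "0 < \<alpha>" "\<alpha> < 1" by simp_all
  from growth_conditions[OF \<alpha>, of "\<alpha> / 100"] \<alpha>
  obtain n0 where n0: "\<And>n. n \<ge> n0 \<Longrightarrow> 2 \<le> ln (real n) \<and> 1300 * (ln n)\<^sup>2 / (\<alpha> / 100)\<^sup>2 \<le> n / ln n
      \<and> 16 * ln n / (\<alpha> / 100)\<^sup>2 \<le> \<alpha> * n
      \<and> 4 * ln n \<le> (\<alpha> / 100)\<^sup>2 / 2000 * (n / ln n) * reach_prob (sqrt (2 * ln n * (1 - \<alpha> / 4)))"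
    unfolding eventually_sequentially by auto
  show "\<exists>c>0. \<forall>(n::nat) (K::nat) (p::nat) (\<sigma>::real) (\<Delta>::real).
     n \<ge> 2 \<longrightarrow> 2 \<le> K \<longrightarrow> K \<le> n \<longrightarrow> p \<ge> 1 \<longrightarrow> \<sigma> > 0 \<longrightarrow> \<Delta> > 0 \<longrightarrow>
     \<Delta>\<^sup>2 \<le> (1 - \<alpha>) * Delta_bar_sq n K p \<sigma> \<longrightarrow> real K \<le> ln (real n) \<longrightarrow>
     minimax_risk 3 n K p \<sigma> \<Delta> \<ge> ereal (1 - c * real K / real n)"
  \<comment> \<open>\<open>n0\<close> depends on \<open>\<alpha>\<close> only. Adding it to the
    constant makes the bound nonpositive for \<open>n < n0\<close>, where
    \<open>minimax_risk_nonneg\<close> suffices.\<close>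
  proof (intro exI[of _ "17 + real n0"] conjI allI impI)
    fix n K p :: nat and \<sigma> \<Delta> :: real
    assume n: "n \<ge> 2" and K: "2 \<le> K" "K \<le> n" and p: "p \<ge> 1" and \<sigma>: "\<sigma> > 0" "\<Delta> > 0"
      and gap: "\<Delta>\<^sup>2 \<le> (1 - \<alpha>) * Delta_bar_sq n K p \<sigma>" and KL: "real K \<le> ln (real n)"
    show "minimax_risk 3 n K p \<sigma> \<Delta> \<ge> ereal (1 - (17 + real n0) * real K / real n)"
    proof (cases "n \<ge> n0")
      case True
      interpret below_threshold \<alpha> \<sigma> \<Delta> n K p
        by (rule below_threshold.intro) (use \<alpha> K KL p \<sigma> gap n0[OF True] in auto)
      have "1 - (17 + real n0) * real K / real n \<le> 1 - 17 * real K / real n"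
        by (intro diff_left_mono divide_right_mono mult_right_mono) auto
      then show ?thesis
        using lower_bound_small_dimension lower_bound_large_dimension
        by (meson ereal_less_eq(3) linear order_trans)
    next
      case False
      have "real n * 1 \<le> (17 + real n0) * real K" using False K by (intro mult_mono) auto
      then have "1 - (17 + real n0) * real K / real n \<le> 0" using n by (simp add: le_divide_eq)
      then have "ereal (1 - (17 + real n0) * real K / real n) \<le> 0" by (simp add: zero_ereal_def)
      also have "0 \<le> minimax_risk 3 n K p \<sigma> \<Delta>" by (rule minimax_risk_nonneg[OF K KL p \<sigma>])
      finally show ?thesis .
    qed
  qed simp
qed simp

end
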